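(* Let $\vec\psi$ satisfy (H1), let $G_n\to_{lwc}\mu$, and let $\mu$ satisfy (H2). (a) Fix $B$ and $\beta_0<\beta_1$. Suppose $h\in\mathcal H^\star$ on $[\beta_0,\beta_1]\times\{B\}$, $h$ satisfies (H3$^\beta$) on $[\beta_0,\beta_1]$, and for every $\beta\in[\beta_0,\beta_1]$, $\limsup_n a^{\mathrm e}_n(\beta,B)\le a^{\mathrm e}(\beta,B,h)$. Then $$\limsup_{n\to\infty}[\phi_n(\beta_1,B)-\phi_n(\beta_0,B)]\le\Phi_\mu(\beta_1,B,h)-\Phi_\mu(\beta_0,B,h).$$ (b) Fix $\beta$ and $B_0<B_1$. Suppose $h\in\mathcal H^\star$ on $\{\beta\}\times[B_0,B_1]$, $h$ satisfies (H3$^B$) on $[B_0,B_1]$, and for every $B\in[B_0,B_1]$, $\limsup_n a^{\mathrm{vx}}_n(\beta,B)\le a^{\mathrm{vx}}(\beta,B,h)$. Then $$\limsup_{n\to\infty}[\phi_n(\beta,B_1)-\phi_n(\beta,B_0)]\le\Phi_\mu(\beta,B_1,h)-\Phi_\mu(\beta,B_0,h).$$ The same conclusions hold with all inequalities reversed and $\limsup$ replaced by $\liminf$ (i.e. if $\liminf_n a_n\ge a(\cdot,h)$ then $\liminf$ of the increments $\ge$ the Bethe increments).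
   Context: Graphs are undirected and locally finite; $\partial v$ neighbours, $D_v=|\partial v|$, $B_t(v)$ ball of radius $t$. $\mathcal T_*$: rooted trees $(T,o)$ up to isomorphism with the local metric; $T_t=B_t(o)$; $T_0$ the one-vertex tree. A measure $\mu$ on rooted graphs is unimodular if $\mathbb E_\mu[\sum_x f(G,o,x)]=\mathbb E_\mu[\sum_x f(G,x,o)]$ for all nonnegative Borel $f$ on doubly-rooted graphs. "$G_n\to_{lwc}\mu$": random finite graphs $G_n=(V_n=[n],E_n)$, $I_n$ uniform on $V_n$, $\mathbb E_n$ expectation over $G_n,I_n$; $(G_n)$ uniformly sparse ($\lim_L\limsup_n\mathbb E_n[D_{I_n}\mathbf 1\{D_{I_n}\ge L\}]=0$); $B_t(I_n)\to T_t$ in law for each $t$ where $T\sim\mu$ on $\mathcal T_*$ (unimodular); $\mu(D_o=0)<1$. Specification: finite $\mathscr X$; symmetric $\psi^\beta:\mathscr X^2\to[0,\infty)$ ($\beta\in\mathbb R$), $\bar\psi^B:\mathscr X\to[0,\infty)$ ($B\in\mathbb R$); $\xi=\log\psi$, $\bar\xi=\log\bar\psi$ with $\log0=-\infty$. Factor model on finite $G=(V,E)$: $\nu_G(\vec\sigma)=Z_G(\beta,B)^{-1}\prod_{(ij)\in E}\psi^\beta(\sigma_i,\sigma_j)\prod_i\bar\psi^B(\sigma_i)$; $\langle\cdot\rangle_n^{\beta,B}$ expectation under $\nu_{G_n}$ given $G_n$; $\phi_n(\beta,B)=\frac1n\mathbb E_n\log Z_{G_n}(\beta,B)$. (H1):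 $\bar\psi^B(\sigma)>0$ for all $\sigma$; some $\sigma^{\mathrm{perm}}\in\mathscr X$ has $\min_\sigma\psi^\beta(\sigma,\sigma^{\mathrm{perm}})>0$; $\bar\xi^B(\sigma)$ is $C^1$ in $B$; each $\xi^\beta(\sigma,\sigma')$ is either $\equiv-\infty$ in $\beta$ or finite and $C^1$ in $\beta$ (set $\partial_\beta\xi\equiv0$ in the former case). (H2): $\mathbb E_\mu[D_o]<\infty$, and if $\psi$ is not everywhere positive then $\mathbb E_\mu[e^{cD_o}]<\infty$ for all $c\in\mathbb R$. Messages: $\mathcal T_\to$ = trees rooted at a directed edge $x\to y$; $\mu^\uparrow$ = law of $(T,J\to o)$, $T\sim\mu$ conditioned on $D_o\ge1$, $J$ uniform on $\partial o$. A message $h$ is a measurable $(T,x\to y,\beta,B)\mapsto h^{\beta,B}_{x\to y}\in\Delta_{\mathscr X}$ modulo $\mu^\uparrow$-null sets. BP map: $(\mathrm{BP}^{\beta,B}h)_{x\to y}(\sigma)\propto\bar\psi^B(\sigma)\prod_{v\in\partial x\setminus y}\sum_{\sigma_v}\psi^\beta(\sigma,\sigma_v)h_{v\to x}(\sigma_v)$. "$h\in\mathcal H^\star$" on a set of parameters means $h^{\beta,B}=\mathrm{BP}^{\beta,B}h^{\beta,B}$ $\mu^\uparrow$-a.s. for each $(\beta,B)$ in it. Bethe functional: $\Phi_T(\beta,B,h)=\log\{\sum_\sigma\bar\psi(\sigma)\prod_{j\in\partial o}\sum_{\sigma_j}\psi(\sigma,\sigma_j)h_{j\to o}(\sigma_j)\}-\frac12\sum_{j\in\partial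 o}\log\{\sum_{\sigma,\sigma_j}\psi(\sigma,\sigma_j)h_{j\to o}(\sigma_j)h_{o\to j}(\sigma)\}$ (all at $(\beta,B)$), $\Phi_\mu=\mathbb E_\mu\Phi_T$. Tree measures: for such a fixed point $h$ and $T\in\mathcal T_*$, $\nu^h_T$ is the unique probability measure on $\mathscr X^{V(T)}$ whose marginal on every finite connected subtree $U\ni o$ is proportional to $\sum_{\vec\sigma_{\partial U}}\prod_{(ij)\in E(U^+)}\psi(\sigma_i,\sigma_j)\prod_{i\in U}\bar\psi(\sigma_i)\prod_{v\in\partial U}h_{v\to p(v)}(\sigma_v)$, where $\partial U$ are vertices outside $U$ adjacent to $U$, $U^+$ the subgraph induced by $U\cup\partial U$, and $p(v)$ the neighbour of $v$ in $U$; $\langle\cdot\rangle^{h,\beta,B}_T$ is its expectation. Derivative functionals: $a^{\mathrm e}_n(\beta,B)=\frac12\mathbb E_n[\sum_{j\in\partial I_n}\langle\partial_\beta\xi(\sigma_{I_n},\sigma_j)\rangle_n^{\beta,B}]$, $a^{\mathrm e}(\beta,B,h)=\frac12\mathbb E_\mu[\sum_{j\in\partial o}\langle\partial_\beta\xi(\sigma_o,\sigma_j)\rangle^{h,\beta,B}_T]$, $a^{\mathrm{vx}}_n(\beta,B)=\mathbb E_n[\langle\partial_B\bar\xi(\sigma_{I_n})\rangle^{\beta,B}_n]$, $a^{\mathrm{vx}}(\beta,B,h)=\mathbb E_\mu[\langle\partial_B\bar\xi(\sigma_o)\rangle^{h,\beta,B}_T]$. (H3$^\beta$) on $[\beta_0,\beta_1]$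 (with $B$ fixed): $\mu^\uparrow$-a.s., for every $\sigma$, $\beta\mapsto h^{\beta,B}_{x\to y}(\sigma)$ is continuous on $[\beta_0,\beta_1]$ with total variation bounded by a deterministic constant depending only on $\beta_0,\beta_1$. (H3$^B$) on $[B_0,B_1]$ is the analogous condition in $B$ with $\beta$ fixed. *)

theory Defs
  imports "HOL-Probability.Probability"
begin

text \<open>A rooted locally finite tree up to rooted isomorphism is coinductively a finite
  multiset of (isomorphism classes of) rooted subtrees hanging at the children of the root.
  Equality in this codatatype is exactly rooted isomorphism.\<close>
codatatype utree = Node (children: "utree multiset")

definition deg :: "utree \<Rightarrow> nat" where
  "deg T = size (children T)"

primcorec trunc :: "nat \<Rightarrow> utree \<Rightarrow> utree" where
  "trunc t T = Node (if t = 0 then {#} else image_mset (trunc (t - 1)) (children T))"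

text \<open>Borel sigma-algebra of the local topology: generated by the balls (cylinders).\<close>
definition utreeM :: "utree measure" where
  "utreeM = sigma UNIV {{T. trunc t T = H} | t H. True}"

text \<open>Trees rooted at a directed edge x \<rightarrow> y, up to isomorphism: the pair (X, Y) where X is
  the tree rooted at x with the branch towards y removed and Y is the tree rooted at y with
  the branch towards x removed.\<close>
type_synonym dtree = "utree \<times> utree"

definition dtreeM :: "dtree measure" where
  "dtreeM = utreeM \<Otimes>\<^sub>M utreeM"

text \<open>For T rooted at o and a child j of o: the directed edges j \<rightarrow> o and o \<rightarrow> j.\<close>
definition edge_in :: "utree \<Rightarrow> utree \<Rightarrow> dtree" where
  "edge_in T j = (j, Node (children T - {#j#}))"

definition edge_out :: "utree \<Rightarrow> utree \<Rightarrow> dtree" where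
  "edge_out T j = (Node (children T - {#j#}), j)"

text \<open>mu-up: law of (T, J \<rightarrow> o), T ~ mu conditioned on D_o \<ge> 1, J uniform on the neighbours of o.\<close>
definition mu_up :: "utree measure \<Rightarrow> dtree measure" where
  "mu_up \<mu> = measure_of (space dtreeM) (sets dtreeM)
     (\<lambda>A. (\<integral>\<^sup>+ T. indicator {T. deg T \<ge> 1} T *
              (\<Sum>j\<in>#children T. indicator A (edge_in T j)) / of_nat (deg T) \<partial>\<mu>)
          / emeasure \<mu> {T. deg T \<ge> 1})"

text \<open>A doubly rooted tree (T, o, x) up to isomorphism is the list [B_0,...,B_k] of the
  bushes hanging off the path o = v_0, ..., v_k = x (B_i = v_i with its off-path branches).
  (T, x, o) is then the reversed list. dr k T lists, with multiplicity, all (T, o, x)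
  with x at distance k from o.\<close>
fun dr :: "nat \<Rightarrow> utree \<Rightarrow> utree list multiset" where
  "dr 0 T = {#[T]#}"
| "dr (Suc k) T =
     (\<Sum>c\<in>#children T. image_mset (\<lambda>l. Node (children T - {#c#}) # l) (dr k c))"

definition drM :: "utree list measure" where
  "drM = sigma UNIV
     {{l. length l = k \<and> (\<forall>i<k. l ! i \<in> A i)} | k A. \<forall>i<k. A i \<in> sets utreeM}"

definition unimodular :: "utree measure \<Rightarrow> bool" where
  "unimodular \<mu> \<longleftrightarrow>
     (\<forall>f \<in> borel_measurable drM.
        (\<integral>\<^sup>+ T. (\<Sum>k. \<Sum>l\<in>#dr k T. f l) \<partial>\<mu>) = (\<integral>\<^sup>+ T. (\<Sum>k. \<Sum>l\<in>#dr k T. f (rev l)) \<partial>\<mu>))"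

definition graph_on :: "nat \<Rightarrow> nat set set \<Rightarrow> bool" where
  "graph_on n E \<longleftrightarrow> (\<forall>e\<in>E. card e = 2 \<and> e \<subseteq> {..<n})"

definition nbrs :: "nat set set \<Rightarrow> nat \<Rightarrow> nat set" where
  "nbrs E v = {w. {v, w} \<in> E}"

definition gdeg :: "nat set set \<Rightarrow> nat \<Rightarrow> nat" where
  "gdeg E v = card (nbrs E v)"

definition adj :: "nat set set \<Rightarrow> (nat \<times> nat) set" where
  "adj E = {(a, b). {a, b} \<in> E}"

definition ball :: "nat set set \<Rightarrow> nat \<Rightarrow> nat \<Rightarrow> nat set" where
  "ball E v t = {w. \<exists>k\<le>t. (v, w) \<in> (adj E) ^^ k}"

text \<open>The (connected) induced subgraph on B_t(v) is a tree iff #edges + 1 = #vertices.\<close>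
definition ball_is_tree :: "nat set set \<Rightarrow> nat \<Rightarrow> nat \<Rightarrow> bool" where
  "ball_is_tree E v t \<longleftrightarrow> card {e\<in>E. e \<subseteq> ball E v t} + 1 = card (ball E v t)"

fun unf :: "nat set set \<Rightarrow> nat \<Rightarrow> nat \<Rightarrow> nat option \<Rightarrow> utree" where
  "unf E 0 v p = Node {#}"
| "unf E (Suc t) v p =
     Node (image_mset (\<lambda>w. unf E t w (Some v)) (mset_set (nbrs E v - set_option p)))"

definition ball_iso :: "nat set set \<Rightarrow> nat \<Rightarrow> nat \<Rightarrow> utree \<Rightarrow> bool" where
  "ball_iso E v t H \<longleftrightarrow> ball_is_tree E v t \<and> unf E t v None = H"

definition En :: "(nat \<Rightarrow> nat set set pmf) \<Rightarrow> nat \<Rightarrow> (nat set set \<Rightarrow> nat \<Rightarrow> real) \<Rightarrow> real" where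
  "En G n X = measure_pmf.expectation (G n) (\<lambda>E. (\<Sum>i<n. X E i) / real n)"

text \<open>Local weak convergence G_n \<rightarrow> mu (convergence in law of B_t(I_n) to T_t on the
  countable discrete space of finite rooted graphs of radius \<le> t).\<close>
definition lwc :: "(nat \<Rightarrow> nat set set pmf) \<Rightarrow> utree measure \<Rightarrow> bool" where
  "lwc G \<mu> \<longleftrightarrow>
     (\<forall>n. \<forall>E\<in>set_pmf (G n). graph_on n E) \<and>
     prob_space \<mu> \<and> sets \<mu> = sets utreeM \<and> unimodular \<mu> \<and>
     ((\<lambda>L::nat. limsup (\<lambda>n. ereal (En G n
         (\<lambda>E i. real (gdeg E i) * (if gdeg E i \<ge> L then 1 else 0))))) \<longlonglongrightarrow> 0) \<and>
     (\<forall>t H. (\<lambda>n. En G n (\<lambda>E i. if ball_iso E i t H then 1 else 0))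
              \<longlonglongrightarrow> measure \<mu> {T. trunc t T = H}) \<and>
     measure \<mu> {T. deg T = 0} < 1"

definition C1 :: "(real \<Rightarrow> real) \<Rightarrow> bool" where
  "C1 f \<longleftrightarrow> (\<exists>f'. continuous_on UNIV f' \<and> (\<forall>x. (f has_real_derivative f' x) (at x)))"

definition spec :: "(real \<Rightarrow> 'x::finite \<Rightarrow> 'x \<Rightarrow> real) \<Rightarrow> (real \<Rightarrow> 'x \<Rightarrow> real) \<Rightarrow> bool" where
  "spec \<psi> \<psi>b \<longleftrightarrow> (\<forall>\<beta> s s'. \<psi> \<beta> s s' = \<psi> \<beta> s' s \<and> \<psi> \<beta> s s' \<ge> 0) \<and> (\<forall>B s. \<psi>b B s \<ge> 0)"

definition H1 :: "(real \<Rightarrow> 'x::finite \<Rightarrow> 'x \<Rightarrow> real) \<Rightarrow> (real \<Rightarrow> 'x \<Rightarrow> real) \<Rightarrow> bool" where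
  "H1 \<psi> \<psi>b \<longleftrightarrow>
     (\<forall>B s. \<psi>b B s > 0) \<and>
     (\<exists>p. \<forall>\<beta> s. \<psi> \<beta> s p > 0) \<and>
     (\<forall>s. C1 (\<lambda>B. ln (\<psi>b B s))) \<and>
     (\<forall>s s'. (\<forall>\<beta>. \<psi> \<beta> s s' = 0) \<or> ((\<forall>\<beta>. \<psi> \<beta> s s' > 0) \<and> C1 (\<lambda>\<beta>. ln (\<psi> \<beta> s s'))))"

definition H2 :: "utree measure \<Rightarrow> (real \<Rightarrow> 'x::finite \<Rightarrow> 'x \<Rightarrow> real) \<Rightarrow> bool" where
  "H2 \<mu> \<psi> \<longleftrightarrow>
     (\<integral>\<^sup>+ T. ennreal (real (deg T)) \<partial>\<mu>) < \<infinity> \<and>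
     (\<not> (\<forall>\<beta> s s'. \<psi> \<beta> s s' > 0) \<longrightarrow>
        (\<forall>c::real. (\<integral>\<^sup>+ T. ennreal (exp (c * real (deg T))) \<partial>\<mu>) < \<infinity>))"

text \<open>partial_beta xi (set to 0 when xi is identically -infinity) and partial_B xi-bar.\<close>
definition dxi :: "(real \<Rightarrow> 'x \<Rightarrow> 'x \<Rightarrow> real) \<Rightarrow> real \<Rightarrow> 'x \<Rightarrow> 'x \<Rightarrow> real" where
  "dxi \<psi> \<beta> s s' = (if \<forall>b. \<psi> b s s' = 0 then 0 else deriv (\<lambda>b. ln (\<psi> b s s')) \<beta>)"

definition dxib :: "(real \<Rightarrow> 'x \<Rightarrow> real) \<Rightarrow> real \<Rightarrow> 'x \<Rightarrow> real" where
  "dxib \<psi>b B s = deriv (\<lambda>b. ln (\<psi>b b s)) B"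

definition configs :: "nat \<Rightarrow> (nat \<Rightarrow> 'x::finite) set" where
  "configs n = PiE {..<n} (\<lambda>_. UNIV)"

definition gweight :: "(real \<Rightarrow> 'x::finite \<Rightarrow> 'x \<Rightarrow> real) \<Rightarrow> (real \<Rightarrow> 'x \<Rightarrow> real) \<Rightarrow> real \<Rightarrow> real
    \<Rightarrow> nat \<Rightarrow> nat set set \<Rightarrow> (nat \<Rightarrow> 'x) \<Rightarrow> real" where
  "gweight \<psi> \<psi>b \<beta> B n E \<sigma> =
     (\<Prod>e\<in>E. \<psi> \<beta> (\<sigma> (Min e)) (\<sigma> (Max e))) * (\<Prod>i<n. \<psi>b B (\<sigma> i))"

definition Zg :: "(real \<Rightarrow> 'x::finite \<Rightarrow> 'x \<Rightarrow> real) \<Rightarrow> (real \<Rightarrow> 'x \<Rightarrow> real) \<Rightarrow> real \<Rightarrow> real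
    \<Rightarrow> nat \<Rightarrow> nat set set \<Rightarrow> real" where
  "Zg \<psi> \<psi>b \<beta> B n E = (\<Sum>\<sigma>\<in>configs n. gweight \<psi> \<psi>b \<beta> B n E \<sigma>)"

definition gibbs_exp :: "(real \<Rightarrow> 'x::finite \<Rightarrow> 'x \<Rightarrow> real) \<Rightarrow> (real \<Rightarrow> 'x \<Rightarrow> real) \<Rightarrow> real \<Rightarrow> real
    \<Rightarrow> nat \<Rightarrow> nat set set \<Rightarrow> ((nat \<Rightarrow> 'x) \<Rightarrow> real) \<Rightarrow> real" where
  "gibbs_exp \<psi> \<psi>b \<beta> B n E f =
     (\<Sum>\<sigma>\<in>configs n. gweight \<psi> \<psi>b \<beta> B n E \<sigma> * f \<sigma>) / Zg \<psi> \<psi>b \<beta> B n E"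

definition phin :: "(real \<Rightarrow> 'x::finite \<Rightarrow> 'x \<Rightarrow> real) \<Rightarrow> (real \<Rightarrow> 'x \<Rightarrow> real)
    \<Rightarrow> (nat \<Rightarrow> nat set set pmf) \<Rightarrow> nat \<Rightarrow> real \<Rightarrow> real \<Rightarrow> real" where
  "phin \<psi> \<psi>b G n \<beta> B = measure_pmf.expectation (G n) (\<lambda>E. ln (Zg \<psi> \<psi>b \<beta> B n E)) / real n"

definition aen :: "(real \<Rightarrow> 'x::finite \<Rightarrow> 'x \<Rightarrow> real) \<Rightarrow> (real \<Rightarrow> 'x \<Rightarrow> real)
    \<Rightarrow> (nat \<Rightarrow> nat set set pmf) \<Rightarrow> nat \<Rightarrow> real \<Rightarrow> real \<Rightarrow> real" where
  "aen \<psi> \<psi>b G n \<beta> B = 1/2 * En G n (\<lambda>E i.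
      \<Sum>j\<in>nbrs E i. gibbs_exp \<psi> \<psi>b \<beta> B n E (\<lambda>\<sigma>. dxi \<psi> \<beta> (\<sigma> i) (\<sigma> j)))"

definition avxn :: "(real \<Rightarrow> 'x::finite \<Rightarrow> 'x \<Rightarrow> real) \<Rightarrow> (real \<Rightarrow> 'x \<Rightarrow> real)
    \<Rightarrow> (nat \<Rightarrow> nat set set pmf) \<Rightarrow> nat \<Rightarrow> real \<Rightarrow> real \<Rightarrow> real" where
  "avxn \<psi> \<psi>b G n \<beta> B = En G n (\<lambda>E i.
      gibbs_exp \<psi> \<psi>b \<beta> B n E (\<lambda>\<sigma>. dxib \<psi>b B (\<sigma> i)))"

type_synonym 'x message = "real \<Rightarrow> real \<Rightarrow> dtree \<Rightarrow> 'x \<Rightarrow> real"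

definition is_message :: "'x::finite message \<Rightarrow> bool" where
  "is_message h \<longleftrightarrow>
     (\<forall>\<beta> B e s. h \<beta> B e s \<ge> 0) \<and> (\<forall>\<beta> B e. (\<Sum>s\<in>UNIV. h \<beta> B e s) = 1) \<and>
     (\<forall>s. (\<lambda>(p, e). h (fst p) (snd p) e s) \<in> borel_measurable ((borel \<Otimes>\<^sub>M borel) \<Otimes>\<^sub>M dtreeM))"

text \<open>Unnormalised BP update at the directed edge e = (X, Y) (x \<rightarrow> y): the neighbours v of x
  other than y are the children of X, and the edge v \<rightarrow> x is (v, X - v + Y).\<close>
definition bpu :: "(real \<Rightarrow> 'x::finite \<Rightarrow> 'x \<Rightarrow> real) \<Rightarrow> (real \<Rightarrow> 'x \<Rightarrow> real) \<Rightarrow> 'x message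
    \<Rightarrow> real \<Rightarrow> real \<Rightarrow> dtree \<Rightarrow> 'x \<Rightarrow> real" where
  "bpu \<psi> \<psi>b h \<beta> B e s = \<psi>b B s *
     (\<Prod>v\<in>#children (fst e). \<Sum>sv\<in>UNIV.
        \<psi> \<beta> s sv * h \<beta> B (v, Node (children (fst e) - {#v#} + {#snd e#})) sv)"

definition BP :: "(real \<Rightarrow> 'x::finite \<Rightarrow> 'x \<Rightarrow> real) \<Rightarrow> (real \<Rightarrow> 'x \<Rightarrow> real) \<Rightarrow> 'x message
    \<Rightarrow> real \<Rightarrow> real \<Rightarrow> dtree \<Rightarrow> 'x \<Rightarrow> real" where
  "BP \<psi> \<psi>b h \<beta> B e s = bpu \<psi> \<psi>b h \<beta> B e s / (\<Sum>s'\<in>UNIV. bpu \<psi> \<psi>b h \<beta> B e s')"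

definition fixed_on :: "utree measure \<Rightarrow> (real \<Rightarrow> 'x::finite \<Rightarrow> 'x \<Rightarrow> real) \<Rightarrow> (real \<Rightarrow> 'x \<Rightarrow> real)
    \<Rightarrow> 'x message \<Rightarrow> (real \<times> real) set \<Rightarrow> bool" where
  "fixed_on \<mu> \<psi> \<psi>b h P \<longleftrightarrow>
     (\<forall>(\<beta>, B)\<in>P. AE e in mu_up \<mu>. h \<beta> B e = BP \<psi> \<psi>b h \<beta> B e)"

definition tv :: "(real \<Rightarrow> real) \<Rightarrow> real \<Rightarrow> real \<Rightarrow> ereal" where
  "tv f a b = (SUP xs \<in> {xs. sorted xs \<and> set xs \<subseteq> {a..b}}.
      ereal (\<Sum>i<length xs - 1. \<bar>f (xs ! Suc i) - f (xs ! i)\<bar>))"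

definition H3beta :: "utree measure \<Rightarrow> 'x::finite message \<Rightarrow> real \<Rightarrow> real \<Rightarrow> real \<Rightarrow> bool" where
  "H3beta \<mu> h B \<beta>0 \<beta>1 \<longleftrightarrow> (\<exists>C::real. AE e in mu_up \<mu>. \<forall>s.
      continuous_on {\<beta>0..\<beta>1} (\<lambda>\<beta>. h \<beta> B e s) \<and> tv (\<lambda>\<beta>. h \<beta> B e s) \<beta>0 \<beta>1 \<le> ereal C)"

definition H3B :: "utree measure \<Rightarrow> 'x::finite message \<Rightarrow> real \<Rightarrow> real \<Rightarrow> real \<Rightarrow> bool" where
  "H3B \<mu> h \<beta> B0 B1 \<longleftrightarrow> (\<exists>C::real. AE e in mu_up \<mu>. \<forall>s.
      continuous_on {B0..B1} (\<lambda>B. h \<beta> B e s) \<and> tv (\<lambda>B. h \<beta> B e s) B0 B1 \<le> ereal C)"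

text \<open>Marginal of nu^h_T on U = {o} (unnormalised): the boundary is the set of children of o.\<close>
definition rootw :: "(real \<Rightarrow> 'x::finite \<Rightarrow> 'x \<Rightarrow> real) \<Rightarrow> (real \<Rightarrow> 'x \<Rightarrow> real) \<Rightarrow> 'x message
    \<Rightarrow> real \<Rightarrow> real \<Rightarrow> utree \<Rightarrow> 'x \<Rightarrow> real" where
  "rootw \<psi> \<psi>b h \<beta> B T s = \<psi>b B s *
     (\<Prod>j\<in>#children T. \<Sum>sj\<in>UNIV. \<psi> \<beta> s sj * h \<beta> B (edge_in T j) sj)"

text \<open>Marginal of nu^h_T on U = {o, j} (unnormalised), j a child of o.\<close>
definition edgew :: "(real \<Rightarrow> 'x::finite \<Rightarrow> 'x \<Rightarrow> real) \<Rightarrow> (real \<Rightarrow> 'x \<Rightarrow> real) \<Rightarrow> 'x message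
    \<Rightarrow> real \<Rightarrow> real \<Rightarrow> utree \<Rightarrow> utree \<Rightarrow> 'x \<Rightarrow> 'x \<Rightarrow> real" where
  "edgew \<psi> \<psi>b h \<beta> B T j so sj =
     \<psi> \<beta> so sj * bpu \<psi> \<psi>b h \<beta> B (edge_out T j) so * bpu \<psi> \<psi>b h \<beta> B (edge_in T j) sj"

definition ae :: "utree measure \<Rightarrow> (real \<Rightarrow> 'x::finite \<Rightarrow> 'x \<Rightarrow> real) \<Rightarrow> (real \<Rightarrow> 'x \<Rightarrow> real)
    \<Rightarrow> 'x message \<Rightarrow> real \<Rightarrow> real \<Rightarrow> real" where
  "ae \<mu> \<psi> \<psi>b h \<beta> B = 1/2 * (\<integral>T. (\<Sum>j\<in>#children T.
      (\<Sum>so\<in>UNIV. \<Sum>sj\<in>UNIV. edgew \<psi> \<psi>b h \<beta> B T j so sj * dxi \<psi> \<beta> so sj)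
      / (\<Sum>so\<in>UNIV. \<Sum>sj\<in>UNIV. edgew \<psi> \<psi>b h \<beta> B T j so sj)) \<partial>\<mu>)"

definition avx :: "utree measure \<Rightarrow> (real \<Rightarrow> 'x::finite \<Rightarrow> 'x \<Rightarrow> real) \<Rightarrow> (real \<Rightarrow> 'x \<Rightarrow> real)
    \<Rightarrow> 'x message \<Rightarrow> real \<Rightarrow> real \<Rightarrow> real" where
  "avx \<mu> \<psi> \<psi>b h \<beta> B = (\<integral>T.
      (\<Sum>s\<in>UNIV. rootw \<psi> \<psi>b h \<beta> B T s * dxib \<psi>b B s)
      / (\<Sum>s\<in>UNIV. rootw \<psi> \<psi>b h \<beta> B T s) \<partial>\<mu>)"

definition PhiT :: "(real \<Rightarrow> 'x::finite \<Rightarrow> 'x \<Rightarrow> real) \<Rightarrow> (real \<Rightarrow> 'x \<Rightarrow> real) \<Rightarrow> 'x message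
    \<Rightarrow> real \<Rightarrow> real \<Rightarrow> utree \<Rightarrow> real" where
  "PhiT \<psi> \<psi>b h \<beta> B T =
     ln (\<Sum>s\<in>UNIV. rootw \<psi> \<psi>b h \<beta> B T s)
     - 1/2 * (\<Sum>j\<in>#children T. ln (\<Sum>s\<in>UNIV. \<Sum>sj\<in>UNIV.
          \<psi> \<beta> s sj * h \<beta> B (edge_in T j) sj * h \<beta> B (edge_out T j) s))"

definition Phi :: "utree measure \<Rightarrow> (real \<Rightarrow> 'x::finite \<Rightarrow> 'x \<Rightarrow> real) \<Rightarrow> (real \<Rightarrow> 'x \<Rightarrow> real)
    \<Rightarrow> 'x message \<Rightarrow> real \<Rightarrow> real \<Rightarrow> real" where
  "Phi \<mu> \<psi> \<psi>b h \<beta> B = (\<integral>T. PhiT \<psi> \<psi>b h \<beta> B T \<partial>\<mu>)"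

end

(* By Gibbs' formula the derivative of phi_n in beta (or B) is a_n, so it remains to
   integrate the hypothesis limsup a_n <= a and to show that the increment of the Bethe
   functional along h is the integral of a. The messages h are only continuous and of bounded
   variation in the parameter, so this is done with Riemann-Stieltjes sums over uniform grids:
   tree by tree, the error of the first-order expansion of Phi_T vanishes with the mesh. At a
   BP fixed point the derivatives of the vertex and of the edge term of Phi_T in h_{j->o}
   agree; what is left of the h-increments is antisymmetric under reversal of the edge oj, so
   its mean is zero by unimodularity. Everything is done for one parameter t on which both psi
   and psi-bar may depend; the two halves of the theorem freeze one of them. *)
theory Submission
  imports Defs
begin

section \<open>Measurability of sums over the children of the root\<close>

text \<open>The grids are therefore fixed in advance: their points are countable, so almost surely
  the equation holds at all of them. In the expansion of a tree it is used at left endpoints of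
  cells; between grid points only bounds that pass through continuity survive. Under the
  expectation, the treewise error of the expansion is dominated uniformly in the mesh, because (H3)
  bounds the variation by one constant for all trees. The factor \<open>1 / Ze\<close> in front of
  the message increments may grow exponentially in the degree when a pair factor vanishes, and the
  exponential moments in (H2) pay for it. On the graph side, uniform sparsity bounds the derivatives
  and permits a reverse Fatou argument. Neighbours of the root form a multiset of trees, so
  measurability of sums over them comes from a kernel that picks a random edge, and reversal of
  edges from a transport function supported on neighbouring pairs.\<close>

lemma trunc_0: "trunc 0 T = Node {#}"
  by (subst trunc.code) simp

lemma trunc_Suc: "trunc (Suc n) T = Node (image_mset (trunc n) (children T))"
  by (subst trunc.code) simp

lemma trunc_trunc: "k \<le> n \<Longrightarrow> trunc k (trunc n T) = trunc k T"
proof (induction k arbitrary: n T)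
  case (Suc k)
  then obtain m where n: "n = Suc m" "k \<le> m" by (cases n) auto
  then show ?case using Suc.IH by (simp add: trunc_Suc multiset.map_comp comp_def)
qed (simp add: trunc_0)

lemma trunc_Node_trunc: "trunc k (Node (image_mset (trunc k) (children T))) = trunc k T"
  using trunc_trunc[of k "Suc k" T] by (simp add: trunc_Suc)

text \<open>A truncation at depth \<open>n + 1\<close> is a finite multiset of truncations at depth
  \<open>n\<close>, so finite lists enumerate it. Countability turns preimages under
  \<open>trunc\<close> into countable unions of cylinders.\<close>

lemma countable_range_trunc: "countable (range (trunc n))"
proof (induction n)
  case 0
  have "range (trunc 0) \<subseteq> {Node {#}}" by (auto simp: trunc_0)
  then show ?case by (rule countable_subset) simp
next
  case (Suc n)
  have "range (trunc (Suc n)) \<subseteq> (\<lambda>xs. Node (mset xs)) ` lists (range (trunc n))"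
  proof
    fix H assume "H \<in> range (trunc (Suc n))"
    then obtain T where H: "H = Node (image_mset (trunc n) (children T))" by (auto simp: trunc_Suc)
    obtain xs where xs: "mset xs = children T" using ex_mset by blast
    have "H = Node (mset (map (trunc n) xs))" using H xs by simp
    moreover have "map (trunc n) xs \<in> lists (range (trunc n))" by auto
    ultimately show "H \<in> (\<lambda>xs. Node (mset xs)) ` lists (range (trunc n))" by blast
  qed
  then show ?case by (rule countable_subset) (use Suc in \<open>simp add: countable_lists\<close>)
qed

lemma space_utreeM [simp]: "space utreeM = UNIV"
  by (simp add: utreeM_def)

lemma space_dtreeM [simp]: "space dtreeM = UNIV"
  by (simp add: dtreeM_def space_pair_measure)

lemma sets_utreeM: "sets utreeM = sigma_sets UNIV {{T. trunc t T = H} | t H. True}"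
  by (simp add: utreeM_def)

lemma cylinder_sets [measurable]: "{T. trunc t T = H} \<in> sets utreeM"
  unfolding sets_utreeM by (rule sigma_sets.Basic) auto

lemma measurable_trunc [measurable]: "trunc n \<in> utreeM \<rightarrow>\<^sub>M count_space UNIV"
proof (rule measurableI)
  fix S :: "utree set"
  have "trunc n -` S \<inter> space utreeM = (\<Union>H\<in>S \<inter> range (trunc n). {T. trunc n T = H})" by auto
  also have "\<dots> \<in> sets utreeM"
    by (intro sets.countable_UN'' countable_Int2 countable_range_trunc cylinder_sets)
  finally show "trunc n -` S \<inter> space utreeM \<in> sets utreeM" .
qed simp

lemma measurable_utreeM_I:
  assumes "\<And>t. (\<lambda>x. trunc t (f x)) \<in> M \<rightarrow>\<^sub>M count_space UNIV"
  shows "f \<in> M \<rightarrow>\<^sub>M utreeM"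
  unfolding utreeM_def
proof (rule measurable_measure_of)
  fix A assume "A \<in> {{T. trunc t T = H} |t H. True}"
  then obtain t H where A: "A = {T. trunc t T = H}" by auto
  have "(\<lambda>x. trunc t (f x)) -` {H} \<inter> space M \<in> sets M"
    using assms by (rule measurable_sets) simp
  then show "f -` A \<inter> space M \<in> sets M" by (simp add: A vimage_def)
qed auto

lemma measurable_deg [measurable]: "deg \<in> utreeM \<rightarrow>\<^sub>M count_space UNIV"
proof -
  have "deg = (\<lambda>T. (size \<circ> children) (trunc 1 T))" by (auto simp: deg_def trunc_Suc fun_eq_iff)
  then show ?thesis using measurable_compose[OF measurable_trunc, of "size \<circ> children" "count_space UNIV" 1] by simp
qed

text \<open>The ball of radius \<open>t\<close> of the joined tree depends only on the balls of
  radius \<open>t\<close> of the two pieces. Needed because \<open>bpu\<close> hangs the branch of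
  one endpoint back on the other before it reads a message.\<close>

lemma measurable_attach [measurable]:
  "(\<lambda>(Z, Y). Node (add_mset Y (children Z))) \<in> utreeM \<Otimes>\<^sub>M utreeM \<rightarrow>\<^sub>M utreeM"
proof (rule measurable_utreeM_I, rule measurableI)
  fix t and S :: "utree set"
  let ?g = "\<lambda>(Z, Y). Node (add_mset Y (children Z))"
  have eq: "trunc t (?g (Z, Y)) = trunc t (?g (trunc t Z, trunc t Y))" for Z Y
    by (cases t) (simp_all add: trunc_0 trunc_Suc multiset.map_comp comp_def trunc_trunc trunc_Node_trunc)
  have "(\<lambda>x. trunc t (?g x)) -` S \<inter> space (utreeM \<Otimes>\<^sub>M utreeM) =
    (\<Union>H\<in>{H \<in> range (trunc t) \<times> range (trunc t). trunc t (?g H) \<in> S}.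
        {Z. trunc t Z = fst H} \<times> {Y. trunc t Y = snd H})"
  proof (intro set_eqI iffI)
    fix x assume x: "x \<in> (\<lambda>x. trunc t (?g x)) -` S \<inter> space (utreeM \<Otimes>\<^sub>M utreeM)"
    obtain Z Y where [simp]: "x = (Z, Y)" by (cases x)
    have "trunc t (?g (trunc t Z, trunc t Y)) \<in> S" using x unfolding eq[of Z Y, symmetric] by simp
    then show "x \<in> (\<Union>H\<in>{H \<in> range (trunc t) \<times> range (trunc t). trunc t (?g H) \<in> S}.
        {Z. trunc t Z = fst H} \<times> {Y. trunc t Y = snd H})"
      by (intro UN_I[of "(trunc t Z, trunc t Y)"]) simp_all
  next
    fix x assume x: "x \<in> (\<Union>H\<in>{H \<in> range (trunc t) \<times> range (trunc t). trunc t (?g H) \<in> S}.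
        {Z. trunc t Z = fst H} \<times> {Y. trunc t Y = snd H})"
    obtain Z Y where [simp]: "x = (Z, Y)" by (cases x)
    have "trunc t (?g (trunc t Z, trunc t Y)) \<in> S" using x by (auto simp del: trunc.simps)
    then have "trunc t (?g (Z, Y)) \<in> S" unfolding eq[of Z Y, symmetric] .
    then show "x \<in> (\<lambda>x. trunc t (?g x)) -` S \<inter> space (utreeM \<Otimes>\<^sub>M utreeM)"
      by (simp add: space_pair_measure)
  qed
  also have "\<dots> \<in> sets (utreeM \<Otimes>\<^sub>M utreeM)"
  proof (intro sets.countable_UN'' pair_measureI cylinder_sets)
    show "countable {H \<in> range (trunc t) \<times> range (trunc t). trunc t (?g H) \<in> S}"
      by (rule countable_subset[OF _ countable_SIGMA[OF countable_range_trunc countable_range_trunc]]) auto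
  qed
  finally show "(\<lambda>x. trunc t (?g x)) -` S \<inter> space (utreeM \<Otimes>\<^sub>M utreeM) \<in> sets (utreeM \<Otimes>\<^sub>M utreeM)" .
qed simp

text \<open>The deeper truncation determines the shallower one, so two cylinders are nested or
  disjoint; the empty set is adjoined for the disjoint case.\<close>

lemma Int_stable_cylinders: "Int_stable (insert {} {{T. trunc t T = H} | t H. True})"
proof (rule Int_stableI)
  fix A B assume A: "A \<in> insert {} {{T. trunc t T = H} | t H. True}" and B: "B \<in> insert {} {{T. trunc t T = H} | t H. True}"
  have *: "{T. trunc t T = H} \<inter> {T. trunc t' T = H'} \<in> insert {} {{T. trunc t T = H} | t H. True}"
    if "t \<le> t'" for t t' H H'
  proof (cases "trunc t H' = H")
    case True
    then have "{T. trunc t T = H} \<inter> {T. trunc t' T = H'} = {T. trunc t' T = H'}"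
      using trunc_trunc[OF that] by auto
    then show ?thesis by auto
  next
    case False
    then have "{T. trunc t T = H} \<inter> {T. trunc t' T = H'} = {}"
      using trunc_trunc[OF that] by auto
    then show ?thesis by auto
  qed
  show "A \<inter> B \<in> insert {} {{T. trunc t T = H} | t H. True}"
  proof (cases "A = {} \<or> B = {}")
    case False
    then obtain t H t' H' where "A = {T. trunc t T = H}" "B = {T. trunc t' T = H'}"
      using A B by auto
    then show ?thesis
      using *[of t t' H H'] *[of t' t H' H] by (cases "t \<le> t'") (simp_all add: Int_commute)
  qed auto
qed

text \<open>Deleting a child commutes with truncating the children only because \<open>j\<close> is
  present: truncation may identify distinct trees, and an absent \<open>j\<close> could then delete
  a wrong child. One level of depth is lost.\<close>

lemma trunc_remove_child:
  assumes "j \<in># children T"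
  shows "trunc m (Node (children T - {#j#})) =
         trunc m (Node (children (trunc (Suc m) T) - {#trunc m j#}))"
proof (cases m)
  case 0 then show ?thesis by (simp add: trunc_0)
next
  case (Suc k)
  obtain M where M: "children T = add_mset j M" using assms by (metis multi_member_split)
  show ?thesis using Suc by (simp add: M trunc_Suc multiset.map_comp comp_def trunc_trunc trunc_Node_trunc)
qed

text \<open>The sum counts incoming edges with a property visible at depth \<open>m\<close> on both
  sides, hence it is a function of \<open>trunc (Suc m) T\<close>, a measurable map into a discrete
  space.\<close>

lemma measurable_count_cylinder:
  "(\<lambda>T. \<Sum>j\<in>#children T. indicator {e. S (trunc m (fst e)) (trunc m (snd e))} (edge_in T j) :: ennreal)
     \<in> borel_measurable utreeM"
proof -
  define \<phi> :: "utree \<Rightarrow> utree \<Rightarrow> ennreal" where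
    "\<phi> T' x = (if S x (trunc m (Node (children T' - {#x#}))) then 1 else 0)" for T' x
  have "(\<Sum>j\<in>#children T. indicator {e. S (trunc m (fst e)) (trunc m (snd e))} (edge_in T j) :: ennreal)
      = (\<lambda>T'. \<Sum>x\<in>#children T'. \<phi> T' x) (trunc (Suc m) T)" for T
  proof -
    have "(\<Sum>j\<in>#children T. indicator {e. S (trunc m (fst e)) (trunc m (snd e))} (edge_in T j) :: ennreal)
       = (\<Sum>j\<in>#children T. \<phi> (trunc (Suc m) T) (trunc m j))"
      by (intro arg_cong[where f = sum_mset] image_mset_cong)
         (auto simp: edge_in_def indicator_def trunc_remove_child \<phi>_def)
    also have "\<dots> = (\<Sum>x\<in>#children (trunc (Suc m) T). \<phi> (trunc (Suc m) T) x)"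
      by (simp add: trunc_Suc[of m T] multiset.map_comp comp_def)
    finally show ?thesis .
  qed
  then show ?thesis
    using measurable_compose[OF measurable_trunc, of "\<lambda>T'. \<Sum>x\<in>#children T'. \<phi> T' x" borel "Suc m"]
    by simp
qed

section \<open>Uniform choice of an edge at the root, as a kernel\<close>

text \<open>Law of a uniformly chosen incoming edge; it carries measurability from cylinders to
  arbitrary functions of the edge. The null measure at an isolated root fits the convention 0 / 0 =
  0 in \<open>nn_integral_edge_kernel\<close>.\<close>

definition edge_kernel :: "utree \<Rightarrow> dtree measure" where
  "edge_kernel T = (if deg T = 0 then null_measure dtreeM
     else distr (measure_pmf (pmf_of_multiset (image_mset (edge_in T) (children T)))) dtreeM id)"

lemma sum_mset_eq_sum_count:
  fixes f :: "'a \<Rightarrow> 'b::semiring_1"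
  shows "(\<Sum>x\<in>#M. f x) = (\<Sum>x\<in>set_mset M. of_nat (count M x) * f x)"
proof (induction M)
  case (add x M)
  have "(\<Sum>y\<in>set_mset (add_mset x M). of_nat (count (add_mset x M) y) * f y)
     = (\<Sum>y\<in>set_mset (add_mset x M). of_nat (count M y) * f y) + (\<Sum>y\<in>set_mset (add_mset x M). if y = x then f y else 0)"
    by (simp only: sum.distrib[symmetric], rule sum.cong) (auto simp: algebra_simps)
  also have "(\<Sum>y\<in>set_mset (add_mset x M). of_nat (count M y) * f y) = (\<Sum>y\<in>set_mset M. of_nat (count M y) * f y)"
    by (rule sum.mono_neutral_right) (auto simp: not_in_iff)
  finally show ?case using add by (simp add: add.commute)
qed simp

lemma nn_integral_pmf_of_multiset:
  assumes "M \<noteq> {#}"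
  shows "(\<integral>\<^sup>+x. f x \<partial>measure_pmf (pmf_of_multiset M)) = (\<Sum>x\<in>#M. f x) / of_nat (size M)"
proof -
  have "(\<integral>\<^sup>+x. f x \<partial>measure_pmf (pmf_of_multiset M))
      = (\<Sum>x\<in>set_mset M. f x * ennreal (real (count M x) / real (size M)))"
    using assms by (subst nn_integral_measure_pmf_finite) auto
  also have "\<dots> = (\<Sum>x\<in>set_mset M. of_nat (count M x) * f x / of_nat (size M))"
  proof (rule sum.cong[OF refl])
    fix x
    have "ennreal (real (count M x) / real (size M)) = of_nat (count M x) / of_nat (size M)"
      using assms by (subst divide_ennreal[symmetric])
        (simp_all add: ennreal_of_nat_eq_real_of_nat nonempty_has_size)
    then show "f x * ennreal (real (count M x) / real (size M)) = of_nat (count M x) * f x / of_nat (size M)"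
      by (simp only: ennreal_times_divide) (simp only: mult.commute)
  qed
  also have "\<dots> = (\<Sum>x\<in>set_mset M. of_nat (count M x) * f x) / of_nat (size M)"
    by (simp add: divide_ennreal_def sum_distrib_right)
  finally show ?thesis by (simp add: sum_mset_eq_sum_count)
qed

lemma sets_edge_kernel [simp]: "sets (edge_kernel T) = sets dtreeM"
  by (simp add: edge_kernel_def)

lemma space_edge_kernel [simp]: "space (edge_kernel T) = UNIV"
  by (simp add: edge_kernel_def)

lemma children_eq_empty_iff: "children T = {#} \<longleftrightarrow> deg T = 0"
  by (simp add: deg_def)

lemma nn_integral_edge_kernel:
  assumes "f \<in> borel_measurable dtreeM"
  shows "(\<integral>\<^sup>+e. f e \<partial>edge_kernel T) = (\<Sum>j\<in>#children T. f (edge_in T j)) / of_nat (deg T)"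
proof (cases "deg T = 0")
  case True then show ?thesis by (simp add: edge_kernel_def children_eq_empty_iff[THEN iffD2])
next
  case False
  then have "children T \<noteq> {#}" by (simp add: children_eq_empty_iff)
  with False show ?thesis using assms
    by (simp add: edge_kernel_def nn_integral_distr nn_integral_pmf_of_multiset
      multiset.map_comp comp_def flip: deg_def)
qed

lemma emeasure_edge_kernel:
  assumes "A \<in> sets dtreeM"
  shows "emeasure (edge_kernel T) A = (\<Sum>j\<in>#children T. indicator A (edge_in T j)) / of_nat (deg T)"
  using nn_integral_edge_kernel[of "indicator A" T] assms by (simp only: nn_integral_indicator borel_measurable_indicator sets_edge_kernel)

lemma subprob_space_edge_kernel: "subprob_space (edge_kernel T)"
proof (cases "deg T = 0")
  case True
  then show ?thesis by (intro subprob_spaceI) (simp_all add: edge_kernel_def)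
next
  case False
  have "prob_space (distr (measure_pmf (pmf_of_multiset (image_mset (edge_in T) (children T)))) dtreeM id)"
    by (intro measure_pmf.prob_space_distr) simp
  then show ?thesis using False by (simp add: edge_kernel_def prob_space_imp_subprob_space)
qed

definition cylinders :: "utree set set" where
  "cylinders = insert {} {{T. trunc t T = H} | t H. True}"

lemma UNIV_in_cylinders: "UNIV \<in> cylinders"
proof -
  have "UNIV = {T. trunc 0 T = Node {#}}" by (simp add: trunc_0)
  then show ?thesis unfolding cylinders_def by blast
qed

lemma sets_utreeM_cylinders: "sets utreeM = sigma_sets UNIV cylinders"
  unfolding sets_utreeM
proof (rule sigma_sets_eqI)
  fix A assume "A \<in> {{T. trunc t T = H} | t H. True}"
  then show "A \<in> sigma_sets UNIV cylinders"
    by (intro sigma_sets.Basic) (simp add: cylinders_def)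
next
  fix A assume "A \<in> cylinders"
  then consider "A = {}" | "A \<in> {{T. trunc t T = H} | t H. True}" by (auto simp only: cylinders_def insert_iff)
  then show "A \<in> sigma_sets UNIV {{T. trunc t T = H} | t H. True}"
    by cases (simp_all only: sigma_sets.Empty sigma_sets.Basic)
qed

lemma sets_dtreeM: "sets dtreeM = sigma_sets UNIV {A \<times> B | A B. A \<in> cylinders \<and> B \<in> cylinders}"
proof -
  have "sets (utreeM \<Otimes>\<^sub>M utreeM) =
     sets (sigma (space utreeM \<times> space utreeM) {a \<times> b | a b. a \<in> cylinders \<and> b \<in> cylinders})"
    by (rule sets_pair_eq[where Ca = "{UNIV}" and Cb = "{UNIV}"])
       (use UNIV_in_cylinders in \<open>simp_all add: sets_utreeM_cylinders\<close>)
  also have "\<dots> = sigma_sets UNIV {A \<times> B | A B. A \<in> cylinders \<and> B \<in> cylinders}"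
    by simp
  finally show ?thesis by (simp only: dtreeM_def)
qed

text \<open>Products of cylinders form a pi-system generating \<open>dtreeM\<close>, and on such a
  product the kernel is a count of edges visible at finite depth, divided by the degree.\<close>

lemma measurable_edge_kernel [measurable]: "edge_kernel \<in> utreeM \<rightarrow>\<^sub>M subprob_algebra dtreeM"
proof (rule measurable_subprob_algebra_generated[OF sets_dtreeM])
  show "Int_stable {A \<times> B |A B. A \<in> cylinders \<and> B \<in> cylinders}"
  proof (rule Int_stableI, clarify)
    fix A B C D assume "A \<in> cylinders" "B \<in> cylinders" "C \<in> cylinders" "D \<in> cylinders"
    then have "A \<inter> C \<in> cylinders" "B \<inter> D \<in> cylinders"
      using Int_stable_cylinders unfolding cylinders_def[symmetric] Int_stable_def by simp_all
    then show "\<exists>A' B'. A \<times> B \<inter> C \<times> D = A' \<times> B' \<and> A' \<in> cylinders \<and> B' \<in> cylinders"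
      by (intro exI[of _ "A \<inter> C"] exI[of _ "B \<inter> D"]) (simp add: Times_Int_Times)
  qed
  \<comment> \<open>A cylinder can be read off at every sufficiently large depth, so the two factors
    of a rectangle can be tested at one common depth.\<close>
  have cyl: "\<exists>m R. \<forall>n\<ge>m. A = {T. R (trunc n T)}" if "A \<in> cylinders" for A
  proof (cases "A = {}")
    case True then show ?thesis by (intro exI[of _ 0] exI[of _ "\<lambda>_. False"]) auto
  next
    case False
    then obtain t H where "A = {T. trunc t T = H}" using \<open>A \<in> cylinders\<close> by (auto simp: cylinders_def)
    then show ?thesis by (intro exI[of _ t] exI[of _ "\<lambda>T. trunc t T = H"]) (auto simp: trunc_trunc)
  qed
  have cnt: "(\<lambda>T. emeasure (edge_kernel T) (A \<times> B)) \<in> borel_measurable utreeM"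
    if AB: "A \<in> cylinders" "B \<in> cylinders" for A B
  proof -
    obtain m R where m: "\<And>n. n \<ge> m \<Longrightarrow> A = {T. R (trunc n T)}" using cyl[OF AB(1)] by blast
    obtain m' R' where m': "\<And>n. n \<ge> m' \<Longrightarrow> B = {T. R' (trunc n T)}" using cyl[OF AB(2)] by blast
    let ?n = "max m m'"
    have eq: "A \<times> B = {e. (\<lambda>x y. R x \<and> R' y) (trunc ?n (fst e)) (trunc ?n (snd e))}"
      using m[of ?n] m'[of ?n] by auto
    have "A \<times> B \<in> sets dtreeM"
      unfolding sets_dtreeM by (rule sigma_sets.Basic) (use AB in auto)
    then have "(\<lambda>T. emeasure (edge_kernel T) (A \<times> B)) =
       (\<lambda>T. (\<Sum>j\<in>#children T. indicator (A \<times> B) (edge_in T j)) / of_nat (deg T))"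
      by (simp add: emeasure_edge_kernel fun_eq_iff)
    also have "\<dots> \<in> borel_measurable utreeM"
      unfolding eq by (intro borel_measurable_divide_ennreal measurable_count_cylinder) measurable
    finally show ?thesis .
  qed
  show "(\<lambda>a. emeasure (edge_kernel a) A) \<in> borel_measurable utreeM"
    if "A \<in> {A \<times> B |A B. A \<in> cylinders \<and> B \<in> cylinders}" for A
    using that cnt by (elim CollectE exE conjE) simp
  show "(\<lambda>a. emeasure (edge_kernel a) UNIV) \<in> borel_measurable utreeM"
    using cnt[OF UNIV_in_cylinders UNIV_in_cylinders] by simp
qed (auto simp: subprob_space_edge_kernel)

text \<open>The sum is the degree times the integral against \<open>edge_kernel\<close>. The extra
  variable in \<open>N\<close> is there for \<open>bpu\<close>, whose product over the branches at
  one endpoint also involves the other endpoint.\<close>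

lemma measurable_sum_children_ennreal:
  fixes F :: "dtree \<times> 'b \<Rightarrow> ennreal"
  assumes F: "F \<in> borel_measurable (dtreeM \<Otimes>\<^sub>M N)"
  shows "(\<lambda>x. \<Sum>j\<in>#children (fst x). F (edge_in (fst x) j, snd x)) \<in> borel_measurable (utreeM \<Otimes>\<^sub>M N)"
proof -
  have K: "(\<lambda>x. edge_kernel (fst x)) \<in> utreeM \<Otimes>\<^sub>M N \<rightarrow>\<^sub>M subprob_algebra dtreeM"
    by measurable
  have G: "(\<lambda>(x, e). F (e, snd x)) \<in> borel_measurable ((utreeM \<Otimes>\<^sub>M N) \<Otimes>\<^sub>M dtreeM)"
    using F by measurable
  have m: "(\<lambda>x. of_nat (deg (fst x)) * (\<integral>\<^sup>+e. F (e, snd x) \<partial>edge_kernel (fst x))) \<in> borel_measurable (utreeM \<Otimes>\<^sub>M N)"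
    using nn_integral_measurable_subprob_algebra2[OF G K] by measurable
  have "of_nat (deg (fst x)) * (\<integral>\<^sup>+e. F (e, snd x) \<partial>edge_kernel (fst x)) = (\<Sum>j\<in>#children (fst x). F (edge_in (fst x) j, snd x))"
    if "x \<in> space (utreeM \<Otimes>\<^sub>M N)" for x
  proof (cases "deg (fst x) = 0")
    case True then show ?thesis by (simp add: children_eq_empty_iff[THEN iffD2])
  next
    case False
    have "(\<lambda>e. F (e, snd x)) \<in> borel_measurable dtreeM"
      using F that by (auto simp: space_pair_measure)
    moreover have "c * a / c = a" if "c \<noteq> 0" "c \<noteq> \<top>" for a c :: ennreal
      using that by (subst mult.commute) (rule ennreal_mult_divide_eq)
    ultimately show ?thesis using False
      by (subst nn_integral_edge_kernel) (simp_all add: ennreal_times_divide)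
  qed
  then show ?thesis using m by (subst (asm) measurable_cong) auto
qed

section \<open>Mass transport along edges\<close>

lemma measurable_sum_children_root_ennreal [measurable (raw)]:
  fixes F :: "dtree \<Rightarrow> ennreal"
  assumes [measurable]: "F \<in> borel_measurable dtreeM"
  shows "(\<lambda>T. \<Sum>j\<in>#children T. F (edge_in T j)) \<in> borel_measurable utreeM"
proof -
  have "(\<lambda>x. \<Sum>j\<in>#children (fst x). F (fst (edge_in (fst x) j, snd x))) \<in> borel_measurable (utreeM \<Otimes>\<^sub>M count_space (UNIV :: unit set))"
    by (rule measurable_sum_children_ennreal[where F = "\<lambda>z. F (fst z)"]) measurable
  from measurable_compose[OF measurable_Pair2' this, of "()"] show ?thesis by simp
qed

lemma sum_mset_ennreal:
  assumes "\<And>x. x \<in># M \<Longrightarrow> f x \<ge> 0"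
  shows "(\<Sum>x\<in>#M. ennreal (f x)) = ennreal (\<Sum>x\<in>#M. f x)" "(\<Sum>x\<in>#M. f x) \<ge> 0"
proof -
  have "(\<Sum>x\<in>#M. ennreal (f x)) = ennreal (\<Sum>x\<in>#M. f x) \<and> (\<Sum>x\<in>#M. f x) \<ge> 0"
    using assms by (induction M) (auto simp: ennreal_plus)
  then show "(\<Sum>x\<in>#M. ennreal (f x)) = ennreal (\<Sum>x\<in>#M. f x)" "(\<Sum>x\<in>#M. f x) \<ge> 0" by auto
qed

lemma sum_mset_diff:
  fixes f g :: "'a \<Rightarrow> real"
  shows "(\<Sum>x\<in>#M. f x - g x) = (\<Sum>x\<in>#M. f x) - (\<Sum>x\<in>#M. g x)"
  by (induction M) auto

lemma measurable_sum_children: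
  fixes F :: "dtree \<times> 'b \<Rightarrow> real"
  assumes [measurable]: "F \<in> borel_measurable (dtreeM \<Otimes>\<^sub>M N)"
  shows "(\<lambda>x. \<Sum>j\<in>#children (fst x). F (edge_in (fst x) j, snd x)) \<in> borel_measurable (utreeM \<Otimes>\<^sub>M N)"
proof -
  have eq: "(\<Sum>j\<in>#children T. F (edge_in T j, y)) =
      enn2real (\<Sum>j\<in>#children T. ennreal (max 0 (F (edge_in T j, y))))
    - enn2real (\<Sum>j\<in>#children T. ennreal (max 0 (- F (edge_in T j, y))))" for T y
  proof -
    have "(\<Sum>j\<in>#children T. F (edge_in T j, y)) = (\<Sum>j\<in>#children T. max 0 (F (edge_in T j, y)) - max 0 (- F (edge_in T j, y)))"
      by (intro arg_cong[where f = sum_mset] image_mset_cong) (auto simp: max_def)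
    also have "\<dots> = (\<Sum>j\<in>#children T. max 0 (F (edge_in T j, y))) - (\<Sum>j\<in>#children T. max 0 (- F (edge_in T j, y)))"
      by (rule sum_mset_diff)
    finally show ?thesis
      by (subst (1 2) sum_mset_ennreal(1)) (simp_all add: enn2real_ennreal sum_mset_ennreal(2))
  qed
  have [measurable]: "(\<lambda>x. \<Sum>j\<in>#children (fst x). ennreal (max 0 (F (edge_in (fst x) j, snd x)))) \<in> borel_measurable (utreeM \<Otimes>\<^sub>M N)"
    by (rule measurable_sum_children_ennreal[where F = "\<lambda>z. ennreal (max 0 (F z))"]) measurable
  have [measurable]: "(\<lambda>x. \<Sum>j\<in>#children (fst x). ennreal (max 0 (- F (edge_in (fst x) j, snd x)))) \<in> borel_measurable (utreeM \<Otimes>\<^sub>M N)"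
    by (rule measurable_sum_children_ennreal[where F = "\<lambda>z. ennreal (max 0 (- F z))"]) measurable
  show ?thesis unfolding eq by measurable
qed

lemma prod_mset_exp_sum_ln:
  assumes "\<And>x. x \<in># M \<Longrightarrow> f x > (0::real)"
  shows "(\<Prod>x\<in>#M. f x) = exp (\<Sum>x\<in>#M. ln (f x))"
  using assms by (induction M) (auto simp: exp_add)

text \<open>Reduces measurability of products to that of sums. The sum counting vanishing factors
  takes over where a logarithm would be taken at 0.\<close>

lemma prod_mset_eq_exp:
  fixes f :: "'a \<Rightarrow> real"
  assumes "\<And>x. x \<in># M \<Longrightarrow> f x \<ge> 0"
  shows "(\<Prod>x\<in>#M. f x) = (if (\<Sum>x\<in>#M. if f x = 0 then 1 else 0) = (0::real) then exp (\<Sum>x\<in>#M. ln (f x)) else 0)"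
proof (cases "\<exists>x\<in>#M. f x = 0")
  case True
  then obtain x N where "M = add_mset x N" "f x = 0" by (metis multi_member_split)
  moreover have "(\<Sum>x\<in>#N. if f x = 0 then 1 else 0) \<ge> (0::real)" by (rule sum_mset_ennreal(2)) auto
  ultimately show ?thesis by auto
next
  case False
  then have "(\<Sum>x\<in>#M. if f x = 0 then 1 else 0) = (0::real)" by (auto intro!: sum_mset.neutral)
  moreover have "f x > 0" if "x \<in># M" for x using False assms that by (force simp: less_le)
  ultimately show ?thesis by (simp add: prod_mset_exp_sum_ln)
qed

lemma measurable_prod_children:
  fixes F :: "dtree \<times> 'b \<Rightarrow> real"
  assumes [measurable]: "F \<in> borel_measurable (dtreeM \<Otimes>\<^sub>M N)" and "\<And>z. F z \<ge> 0"
  shows "(\<lambda>x. \<Prod>j\<in>#children (fst x). F (edge_in (fst x) j, snd x)) \<in> borel_measurable (utreeM \<Otimes>\<^sub>M N)"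
proof -
  have [measurable]: "(\<lambda>x. \<Sum>j\<in>#children (fst x). if F (edge_in (fst x) j, snd x) = 0 then 1 else 0 :: real) \<in> borel_measurable (utreeM \<Otimes>\<^sub>M N)"
    by (rule measurable_sum_children[where F = "\<lambda>z. if F z = 0 then 1 else 0"]) measurable
  have [measurable]: "(\<lambda>x. \<Sum>j\<in>#children (fst x). ln (F (edge_in (fst x) j, snd x))) \<in> borel_measurable (utreeM \<Otimes>\<^sub>M N)"
    by (rule measurable_sum_children[where F = "\<lambda>z. ln (F z)"]) measurable
  show ?thesis using assms(2) by (subst prod_mset_eq_exp) auto
qed

lemma measurable_sum_children_root [measurable (raw)]:
  fixes F :: "dtree \<Rightarrow> real"
  assumes [measurable]: "F \<in> borel_measurable dtreeM"
  shows "(\<lambda>T. \<Sum>j\<in>#children T. F (edge_in T j)) \<in> borel_measurable utreeM"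
proof -
  have "(\<lambda>x. \<Sum>j\<in>#children (fst x). F (fst (edge_in (fst x) j, snd x))) \<in> borel_measurable (utreeM \<Otimes>\<^sub>M count_space (UNIV :: unit set))"
    by (rule measurable_sum_children[where F = "\<lambda>z. F (fst z)"]) measurable
  from measurable_compose[OF measurable_Pair2' this, of "()"] show ?thesis by simp
qed

lemma measurable_prod_children_root:
  fixes F :: "dtree \<Rightarrow> real"
  assumes [measurable]: "F \<in> borel_measurable dtreeM" and "\<And>z. F z \<ge> 0"
  shows "(\<lambda>T. \<Prod>j\<in>#children T. F (edge_in T j)) \<in> borel_measurable utreeM"
proof -
  have "(\<lambda>x. \<Prod>j\<in>#children (fst x). F (fst (edge_in (fst x) j, snd x))) \<in> borel_measurable (utreeM \<Otimes>\<^sub>M count_space (UNIV :: unit set))"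
    by (rule measurable_prod_children[where F = "\<lambda>z. F (fst z)"]) (measurable, rule assms(2))
  from measurable_compose[OF measurable_Pair2' this, of "()"] show ?thesis by simp
qed

lemma edge_out_eq_swap: "edge_out T j = prod.swap (edge_in T j)"
  by (simp add: edge_in_def edge_out_def)

lemma measurable_swap_dtreeM [measurable]: "prod.swap \<in> dtreeM \<rightarrow>\<^sub>M dtreeM"
  unfolding dtreeM_def prod.swap_def by measurable

text \<open>Mass transport with a function that charges only doubly rooted trees whose roots are
  neighbours, coded as lists of length two; reversing the list reverses the edge.\<close>

lemma unimodular_edges:
  fixes F :: "dtree \<Rightarrow> ennreal"
  assumes "unimodular \<mu>" and [measurable]: "F \<in> borel_measurable dtreeM"
  shows "(\<integral>\<^sup>+T. (\<Sum>j\<in>#children T. F (edge_in T j)) \<partial>\<mu>) = (\<integral>\<^sup>+T. (\<Sum>j\<in>#children T. F (edge_out T j)) \<partial>\<mu>)"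
proof -
  \<comment> \<open>\<open>dr 1 T\<close> lists the bush of the root first and the child second,
    whereas \<open>edge_in\<close> puts the child first; hence the swapped indices.\<close>
  define f :: "utree list \<Rightarrow> ennreal" where "f l = (if length l = 2 then F (l ! 1, l ! 0) else 0)" for l
  have gen: "{l. length l = k \<and> (\<forall>i<k. l ! i \<in> A i)} \<in> sets drM" if "\<forall>i<k. A i \<in> sets utreeM" for k A
    unfolding drM_def using that by (intro in_measure_of) auto
  have len: "{l. length l = k} \<in> sets drM" for k
    using gen[of k "\<lambda>_. UNIV"] sets.top[of utreeM] by simp
  let ?R = "restrict_space drM {l. length l = 2}"
  \<comment> \<open>The generators of \<open>drM\<close> control \<open>!\<close> only within the
    length of the list, so measurability is claimed on lists of length two.\<close>
  have nth: "(\<lambda>l. l ! i) \<in> ?R \<rightarrow>\<^sub>M utreeM" if "i < 2" for i :: nat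
  proof (rule measurableI)
    fix S assume S: "S \<in> sets utreeM"
    have "(\<lambda>l. l ! i) -` S \<inter> space ?R = {l. length l = 2} \<inter> {l. length l = 2 \<and> (\<forall>k<2. l ! k \<in> (if k = i then S else UNIV))}"
      using that by (auto simp: space_restrict_space drM_def)
    also have "\<dots> \<in> sets ?R"
      using gen[of 2 "\<lambda>k. if k = i then S else UNIV"] S sets.top[of utreeM] len
      by (auto simp: sets_restrict_space)
    finally show "(\<lambda>l. l ! i) -` S \<inter> space ?R \<in> sets ?R" .
  qed simp
  have "(\<lambda>l. F (l ! 1, l ! 0)) \<in> borel_measurable ?R"
    by (rule measurable_compose[OF _ assms(2)]) (auto simp: dtreeM_def intro!: measurable_Pair nth)
  then have "f \<in> borel_measurable drM"
    unfolding f_def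
    by (intro measurable_If_restrict_space_iff[THEN iffD2]) (auto simp: len drM_def[THEN arg_cong, of space])
  then have eq: "(\<integral>\<^sup>+ T. (\<Sum>k. \<Sum>l\<in>#dr k T. f l) \<partial>\<mu>) = (\<integral>\<^sup>+ T. (\<Sum>k. \<Sum>l\<in>#dr k T. f (rev l)) \<partial>\<mu>)"
    using assms(1) by (simp add: unimodular_def)
  have length_dr: "l \<in># dr k T \<Longrightarrow> length l = Suc k" for l k T
  proof (induction k arbitrary: T l)
    case (Suc k) then show ?case by (fastforce simp: sum_mset_sum_list in_Union_mset_iff)
  qed auto
  \<comment> \<open>Lists in \<open>dr k T\<close> have length \<open>k + 1\<close>, so only
    distance 1 contributes to the series.\<close>
  have sum1: "(\<Sum>k. \<Sum>l\<in>#dr k T. g l) = (\<Sum>j\<in>#children T. g [Node (children T - {#j#}), j])"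
    if g: "\<And>l. length l \<noteq> 2 \<Longrightarrow> g l = 0" for g :: "utree list \<Rightarrow> ennreal" and T
  proof -
    have "(\<Sum>l\<in>#dr k T. g l) = 0" if "k \<noteq> 1" for k
      using that length_dr[of _ k T] by (intro sum_mset.neutral) (auto intro!: g)
    then have "(\<Sum>k. \<Sum>l\<in>#dr k T. g l) = (\<Sum>l\<in>#dr 1 T. g l)"
      by (subst suminf_finite[of "{1}"]) auto
    also have "dr 1 T = image_mset (\<lambda>c. [Node (children T - {#c#}), c]) (children T)"
    proof -
      have "(\<Sum>c\<in>#M. image_mset (\<lambda>l. h c # l) {#[c]#}) = image_mset (\<lambda>c. [h c, c]) M" for M and h :: "utree \<Rightarrow> utree"
        by (induction M) auto
      then show ?thesis by simp
    qed
    finally show ?thesis by (simp add: multiset.map_comp comp_def)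
  qed
  have "(\<Sum>k. \<Sum>l\<in>#dr k T. f l) = (\<Sum>j\<in>#children T. F (edge_in T j))"
       "(\<Sum>k. \<Sum>l\<in>#dr k T. f (rev l)) = (\<Sum>j\<in>#children T. F (edge_out T j))" for T
    by (subst sum1; simp add: f_def edge_in_def edge_out_def)+
  then show ?thesis using eq by simp
qed

section \<open>The law of a uniform edge into the root\<close>

text \<open>\<open>measure_of\<close> reproduces a set function only once that function is known to
  be a measure. Exhibiting it as a rescaled mixture of \<open>edge_kernel\<close> supplies countable
  additivity.\<close>

lemma mu_up_eq:
  assumes "sets \<mu> = sets utreeM" "prob_space \<mu>"
  shows "mu_up \<mu> = scale_measure (1 / emeasure \<mu> {T. deg T \<ge> 1}) (\<mu> \<bind> edge_kernel)"
proof -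
  interpret prob_space \<mu> by fact
  have K: "edge_kernel \<in> \<mu> \<rightarrow>\<^sub>M subprob_algebra dtreeM"
    using measurable_edge_kernel assms(1) by (simp cong: measurable_cong_sets)
  have sets_bind: "sets (\<mu> \<bind> edge_kernel) = sets dtreeM"
    by (rule sets_bind) (auto simp: not_empty)
  let ?c = "1 / emeasure \<mu> {T. deg T \<ge> 1}"
  let ?N = "scale_measure ?c (\<mu> \<bind> edge_kernel)"
  have "?N = measure_of (space ?N) (sets ?N) (emeasure ?N)" by (rule measure_of_of_measure[symmetric])
  also have "\<dots> = measure_of (space dtreeM) (sets dtreeM) (emeasure ?N)"
    using sets_bind sets_eq_imp_space_eq[OF sets_bind] by (simp add: space_scale_measure)
  also have "\<dots> = mu_up \<mu>"
    unfolding mu_up_def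
  proof (rule measure_of_eq)
    show "sets dtreeM \<subseteq> Pow (space dtreeM)" by simp
    fix A assume "A \<in> sigma_sets (space dtreeM) (sets dtreeM)"
    then have A: "A \<in> sets dtreeM" by (metis sets.sigma_sets_eq)
    have "emeasure ?N A = ?c * (\<integral>\<^sup>+ T. emeasure (edge_kernel T) A \<partial>\<mu>)"
      using emeasure_bind[OF not_empty K A] by simp
    also have "(\<integral>\<^sup>+ T. emeasure (edge_kernel T) A \<partial>\<mu>) =
      (\<integral>\<^sup>+ T. indicator {T. deg T \<ge> 1} T * (\<Sum>j\<in>#children T. indicator A (edge_in T j)) / of_nat (deg T) \<partial>\<mu>)"
      (is "_ = ?I")
    proof (intro nn_integral_cong)
      fix T
      show "emeasure (edge_kernel T) A = indicator {T. deg T \<ge> 1} T * (\<Sum>j\<in>#children T. indicator A (edge_in T j)) / of_nat (deg T)"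
        using A by (cases "deg T = 0") (simp_all add: emeasure_edge_kernel children_eq_empty_iff[THEN iffD2])
    qed
    also have "?c * ?I = ?I / emeasure \<mu> {T. deg T \<ge> 1}"
      by (simp add: divide_ennreal_def mult.commute)
    finally show "emeasure ?N A = ?I / emeasure \<mu> {T. deg T \<ge> 1}" .
  qed
  finally show ?thesis by simp
qed

text \<open>Given the tree, each child is chosen with positive probability, so almost surely no
  incoming edge lies in a given null set. Mass transport applied to the indicator of that set gives
  the same for outgoing edges.\<close>

lemma AE_mu_upD:
  assumes \<mu>: "sets \<mu> = sets utreeM" "prob_space \<mu>" "unimodular \<mu>"
    and ae: "AE e in mu_up \<mu>. R e"
  shows "AE T in \<mu>. \<forall>j\<in>#children T. R (edge_in T j) \<and> R (edge_out T j)"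
proof -
  interpret prob_space \<mu> by fact
  have K: "edge_kernel \<in> \<mu> \<rightarrow>\<^sub>M subprob_algebra dtreeM"
    using measurable_edge_kernel \<mu>(1) by (simp cong: measurable_cong_sets)
  have [measurable_cong]: "sets \<mu> = sets utreeM" by fact
  have sets_bind: "sets (\<mu> \<bind> edge_kernel) = sets dtreeM"
    by (rule sets_bind) (auto simp: not_empty)
  let ?c = "1 / emeasure \<mu> {T. deg T \<ge> 1}"
  obtain N where N: "{e\<in>space (mu_up \<mu>). \<not> R e} \<subseteq> N" "emeasure (mu_up \<mu>) N = 0" "N \<in> sets (mu_up \<mu>)"
    using ae by (rule AE_E)
  have N_sets [measurable]: "N \<in> sets dtreeM" using N(3) sets_bind by (simp add: mu_up_eq[OF \<mu>(1,2)])
  have sp: "space (mu_up \<mu>) = UNIV"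
    using sets_eq_imp_space_eq[OF sets_bind] by (simp add: mu_up_eq[OF \<mu>(1,2)] space_scale_measure)
  have "?c * emeasure (\<mu> \<bind> edge_kernel) N = 0"
    using N(2) by (simp add: mu_up_eq[OF \<mu>(1,2)])
  moreover have "?c \<noteq> 0" by (simp add: ennreal_divide_eq_0_iff)
  ultimately have "emeasure (\<mu> \<bind> edge_kernel) N = 0" by (metis mult_eq_0_iff)
  then have "(\<integral>\<^sup>+ T. emeasure (edge_kernel T) N \<partial>\<mu>) = 0"
    using emeasure_bind[OF not_empty K N_sets] by simp
  then have "AE T in \<mu>. emeasure (edge_kernel T) N = 0"
    by (subst (asm) nn_integral_0_iff_AE) (use K in measurable)
  then have AE0: "AE T in \<mu>. (\<Sum>j\<in>#children T. indicator N (edge_in T j)) = (0::ennreal)"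
  proof eventually_elim
    case (elim T)
    show ?case
      using elim by (auto simp: emeasure_edge_kernel[OF N_sets] ennreal_divide_eq_0_iff)
  qed
  then have "(\<integral>\<^sup>+T. (\<Sum>j\<in>#children T. indicator N (edge_in T j)) \<partial>\<mu>) = 0"
    by (subst nn_integral_0_iff_AE) measurable
  then have "(\<integral>\<^sup>+T. (\<Sum>j\<in>#children T. indicator N (prod.swap (edge_in T j))) \<partial>\<mu>) = 0"
    by (subst (asm) unimodular_edges[OF \<mu>(3)]) (auto simp: edge_out_eq_swap)
  then have "AE T in \<mu>. (\<Sum>j\<in>#children T. indicator N (prod.swap (edge_in T j))) = (0::ennreal)"
    by (subst (asm) nn_integral_0_iff_AE) measurable
  with AE0 show ?thesis
  proof eventually_elim
    case (elim T)
    have *: "x \<notin># M \<or> g x = 0" if "(\<Sum>x\<in>#M. g x) = (0::ennreal)" for M g and x :: utree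
      using that by (induction M) auto
    show ?case using elim *[of "\<lambda>j. indicator N (edge_in T j)" "children T"]
        *[of "\<lambda>j. indicator N (prod.swap (edge_in T j))" "children T"] N(1) sp
      by (fastforce simp: edge_out_eq_swap indicator_eq_0_iff)
  qed
qed

section \<open>Riemann--Stieltjes increments\<close>

text \<open>By the mean value theorem the error is \<open>(\<phi>' z - \<phi>' x) * (y - x)\<close>
  for an intermediate \<open>z\<close>, and uniform continuity of \<open>\<phi>'\<close> makes the
  first factor small.\<close>

lemma uniform_linear_approximation:
  fixes \<phi> :: "real \<Rightarrow> real"
  assumes der: "\<And>x. x \<in> {m..M} \<Longrightarrow> (\<phi> has_real_derivative \<phi>' x) (at x)"
    and cont: "continuous_on {m..M} \<phi>'" and "\<epsilon> > 0"
  obtains \<eta> where "\<eta> > 0"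
    "\<And>x y. x \<in> {m..M} \<Longrightarrow> y \<in> {m..M} \<Longrightarrow> \<bar>y - x\<bar> < \<eta> \<Longrightarrow> \<bar>\<phi> y - \<phi> x - \<phi>' x * (y - x)\<bar> \<le> \<epsilon> * \<bar>y - x\<bar>"
proof -
  have "uniformly_continuous_on {m..M} \<phi>'"
    using cont by (intro compact_uniformly_continuous) auto
  then obtain \<eta> where \<eta>: "\<eta> > 0"
    "\<And>x y. x \<in> {m..M} \<Longrightarrow> y \<in> {m..M} \<Longrightarrow> \<bar>y - x\<bar> < \<eta> \<Longrightarrow> \<bar>\<phi>' y - \<phi>' x\<bar> < \<epsilon>"
    using \<open>\<epsilon> > 0\<close> unfolding uniformly_continuous_on_def dist_real_def by metis
  have "\<bar>\<phi> y - \<phi> x - \<phi>' x * (y - x)\<bar> \<le> \<epsilon> * \<bar>y - x\<bar>"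
    if xy: "x \<in> {m..M}" "y \<in> {m..M}" "\<bar>y - x\<bar> < \<eta>" for x y
  proof (cases "x = y")
    case False
    have "\<exists>z. min x y < z \<and> z < max x y \<and> \<phi> y - \<phi> x = \<phi>' z * (y - x)"
    proof -
      have "\<exists>z. z > min x y \<and> z < max x y \<and> \<phi> (max x y) - \<phi> (min x y) = (max x y - min x y) * \<phi>' z"
        by (rule MVT2) (use False xy der in \<open>auto simp: min_def max_def split: if_splits\<close>)
      then obtain z where z: "z > min x y" "z < max x y" "\<phi> (max x y) - \<phi> (min x y) = (max x y - min x y) * \<phi>' z"
        by blast
      have "\<phi> y - \<phi> x = \<phi>' z * (y - x)"
        using z(3) by (cases "x \<le> y") (simp_all add: min_def max_def algebra_simps)
      with z show ?thesis by blast
    qed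
    then obtain z where z: "min x y < z" "z < max x y" "\<phi> y - \<phi> x = \<phi>' z * (y - x)" by blast
    have "\<bar>\<phi>' z - \<phi>' x\<bar> \<le> \<epsilon>"
      using \<eta>(2)[of x z] z(1,2) xy by (auto simp: min_def max_def split: if_splits)
    then have "\<bar>\<phi>' z - \<phi>' x\<bar> * \<bar>y - x\<bar> \<le> \<epsilon> * \<bar>y - x\<bar>" by (rule mult_right_mono) simp
    moreover have "\<phi> y - \<phi> x - \<phi>' x * (y - x) = (\<phi>' z - \<phi>' x) * (y - x)"
      using z(3) by (simp add: algebra_simps)
    ultimately show ?thesis by (simp add: abs_mult)
  qed simp
  with \<eta>(1) show ?thesis by (rule that)
qed

text \<open>A path f is followed through its Riemann-Stieltjes increments: L s t plays the role of df
  between s and t, and the error is measured against a control V (the variation of everything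
  that moves), so that errors add up over a partition to at most \<open>\<epsilon> * (V b - V a)\<close>.\<close>

locale bv_control =
  fixes a b :: real and V :: "real \<Rightarrow> real"
  assumes a_less_b: "a < b"
    and V_id: "\<And>s t. a \<le> s \<Longrightarrow> s \<le> t \<Longrightarrow> t \<le> b \<Longrightarrow> t - s \<le> V t - V s"
begin

text \<open>\<open>V\<close> need not be continuous, so smallness of increments of \<open>f\<close>
  must come from continuity of \<open>f\<close>; the Lipschitz bound turns an error proportional to
  the increment of \<open>f\<close> into one charged to \<open>V\<close>. Both are what makes the
  class closed under composition.\<close>

definition appr :: "(real \<Rightarrow> real) \<Rightarrow> (real \<Rightarrow> real \<Rightarrow> real) \<Rightarrow> bool" where
  "appr f L \<longleftrightarrow> continuous_on {a..b} f
     \<and> (\<exists>C\<ge>0. \<forall>s t. a \<le> s \<and> s \<le> t \<and> t \<le> b \<longrightarrow> \<bar>f t - f s\<bar> \<le> C * (V t - V s))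
     \<and> (\<forall>\<epsilon>>0. \<exists>\<delta>>0. \<forall>s t. a \<le> s \<and> s \<le> t \<and> t \<le> b \<and> t - s < \<delta>
           \<longrightarrow> \<bar>f t - f s - L s t\<bar> \<le> \<epsilon> * (V t - V s))"

lemma V_mono: "a \<le> s \<Longrightarrow> s \<le> t \<Longrightarrow> t \<le> b \<Longrightarrow> 0 \<le> V t - V s"
  using V_id[of s t] by simp

lemma apprI:
  assumes "continuous_on {a..b} f" "C \<ge> 0"
    and "\<And>s t. a \<le> s \<Longrightarrow> s \<le> t \<Longrightarrow> t \<le> b \<Longrightarrow> \<bar>f t - f s\<bar> \<le> C * (V t - V s)"
    and "\<And>\<epsilon>. \<epsilon> > 0 \<Longrightarrow> \<exists>\<delta>>0. \<forall>s t. a \<le> s \<and> s \<le> t \<and> t \<le> b \<and> t - s < \<delta>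
           \<longrightarrow> \<bar>f t - f s - L s t\<bar> \<le> \<epsilon> * (V t - V s)"
  shows "appr f L"
  using assms unfolding appr_def by blast

lemma apprD:
  assumes "appr f L"
  shows "continuous_on {a..b} f"
    and "\<exists>C\<ge>0. \<forall>s t. a \<le> s \<and> s \<le> t \<and> t \<le> b \<longrightarrow> \<bar>f t - f s\<bar> \<le> C * (V t - V s)"
    and "\<epsilon> > 0 \<Longrightarrow> \<exists>\<delta>>0. \<forall>s t. a \<le> s \<and> s \<le> t \<and> t \<le> b \<and> t - s < \<delta>
           \<longrightarrow> \<bar>f t - f s - L s t\<bar> \<le> \<epsilon> * (V t - V s)"
  using assms unfolding appr_def by blast+

lemma appr_const: "appr (\<lambda>_. c) (\<lambda>_ _. 0)"
  by (rule apprI[where C = 0]) (auto intro!: exI[of _ 1] mult_nonneg_nonneg V_mono)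

lemma appr_path:
  assumes "continuous_on {a..b} f" "\<And>s t. a \<le> s \<Longrightarrow> s \<le> t \<Longrightarrow> t \<le> b \<Longrightarrow> \<bar>f t - f s\<bar> \<le> V t - V s"
  shows "appr f (\<lambda>s t. f t - f s)"
  by (rule apprI[where C = 1]) (use assms in \<open>auto intro!: exI[of _ 1] mult_nonneg_nonneg V_mono\<close>)

lemma appr_id: "appr (\<lambda>t. t) (\<lambda>s t. t - s)"
  by (rule appr_path) (use V_id in \<open>auto intro!: continuous_intros\<close>)

lemma appr_chain:
  assumes f: "appr f L"
    and der: "\<And>x. x \<in> {m..M} \<Longrightarrow> (\<phi> has_real_derivative \<phi>' x) (at x)"
    and cont: "continuous_on {m..M} \<phi>'"
    and ran: "\<And>t. t \<in> {a..b} \<Longrightarrow> f t \<in> {m..M}"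
  shows "appr (\<lambda>t. \<phi> (f t)) (\<lambda>s t. \<phi>' (f s) * L s t)"
proof -
  have "bounded (\<phi>' ` {m..M})" using cont by (intro compact_imp_bounded compact_continuous_image) auto
  then obtain K where K: "K > 0" "\<And>x. x \<in> {m..M} \<Longrightarrow> \<bar>\<phi>' x\<bar> \<le> K"
    unfolding bounded_pos by auto
  obtain C where C: "C \<ge> 0" "\<And>s t. a \<le> s \<Longrightarrow> s \<le> t \<Longrightarrow> t \<le> b \<Longrightarrow> \<bar>f t - f s\<bar> \<le> C * (V t - V s)"
    using apprD(2)[OF f] by blast
  have cf: "continuous_on {a..b} f" using f by (rule apprD)
  have lip: "\<bar>\<phi> y - \<phi> x\<bar> \<le> K * \<bar>y - x\<bar>" if "x \<in> {m..M}" "y \<in> {m..M}" for x y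
  proof -
    have "norm (\<phi> y - \<phi> x) \<le> K * norm (y - x)"
      by (rule field_differentiable_bound[of "{m..M}" \<phi> \<phi>'])
         (use der K that in \<open>auto intro: has_field_derivative_at_within\<close>)
    then show ?thesis by simp
  qed
  show ?thesis
  proof (rule apprI[where C = "K * C"])
    show "continuous_on {a..b} (\<lambda>t. \<phi> (f t))"
    proof (rule continuous_on_compose2[OF _ cf])
      show "continuous_on {m..M} \<phi>"
        using der by (meson DERIV_isCont continuous_at_imp_continuous_on)
    qed (use ran in auto)
    show "K * C \<ge> 0" using K C by simp
    fix s t assume st: "a \<le> s" "s \<le> t" "t \<le> b"
    have "\<bar>\<phi> (f t) - \<phi> (f s)\<bar> \<le> K * \<bar>f t - f s\<bar>" using st by (intro lip ran) auto
    also have "\<dots> \<le> K * (C * (V t - V s))" using K C(2)[OF st] by (intro mult_left_mono) auto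
    finally show "\<bar>\<phi> (f t) - \<phi> (f s)\<bar> \<le> K * C * (V t - V s)" by simp
  next
    fix \<epsilon> :: real assume "\<epsilon> > 0"
    \<comment> \<open>The error is shared between the Taylor remainder of \<open>\<phi>\<close> and
      the error already present in \<open>L\<close>; \<open>C + 1\<close> keeps the denominator
      positive when \<open>C = 0\<close>.\<close>
    define \<epsilon>1 where "\<epsilon>1 = \<epsilon> / (2 * (C + 1))"
    define \<epsilon>2 where "\<epsilon>2 = \<epsilon> / (2 * K)"
    have pos: "\<epsilon>1 > 0" "\<epsilon>2 > 0" using \<open>\<epsilon> > 0\<close> C(1) K(1) by (auto simp: \<epsilon>1_def \<epsilon>2_def)
    obtain \<eta> where \<eta>: "\<eta> > 0" "\<And>x y. x \<in> {m..M} \<Longrightarrow> y \<in> {m..M} \<Longrightarrow> \<bar>y - x\<bar> < \<eta> \<Longrightarrow>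
        \<bar>\<phi> y - \<phi> x - \<phi>' x * (y - x)\<bar> \<le> \<epsilon>1 * \<bar>y - x\<bar>"
      using uniform_linear_approximation[OF der cont pos(1)] by blast
    have "uniformly_continuous_on {a..b} f" using cf by (intro compact_uniformly_continuous) auto
    then obtain \<delta>1 where \<delta>1: "\<delta>1 > 0" "\<And>s t. s \<in> {a..b} \<Longrightarrow> t \<in> {a..b} \<Longrightarrow> \<bar>t - s\<bar> < \<delta>1 \<Longrightarrow> \<bar>f t - f s\<bar> < \<eta>"
      using \<eta>(1) unfolding uniformly_continuous_on_def dist_real_def by metis
    obtain \<delta>2 where \<delta>2: "\<delta>2 > 0" "\<And>s t. a \<le> s \<Longrightarrow> s \<le> t \<Longrightarrow> t \<le> b \<Longrightarrow> t - s < \<delta>2 \<Longrightarrow> \<bar>f t - f s - L s t\<bar> \<le> \<epsilon>2 * (V t - V s)"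
      using apprD(3)[OF f pos(2)] by blast
    show "\<exists>\<delta>>0. \<forall>s t. a \<le> s \<and> s \<le> t \<and> t \<le> b \<and> t - s < \<delta>
           \<longrightarrow> \<bar>\<phi> (f t) - \<phi> (f s) - \<phi>' (f s) * L s t\<bar> \<le> \<epsilon> * (V t - V s)"
    proof (intro exI[of _ "min \<delta>1 \<delta>2"] conjI allI impI; (elim conjE)?)
      fix s t assume st: "a \<le> s" "s \<le> t" "t \<le> b" and d: "t - s < min \<delta>1 \<delta>2"
      have V: "0 \<le> V t - V s" using st by (rule V_mono)
      have "\<bar>\<phi> (f t) - \<phi> (f s) - \<phi>' (f s) * (f t - f s)\<bar> \<le> \<epsilon>1 * \<bar>f t - f s\<bar>"
        using st d by (intro \<eta>(2) \<delta>1(2) ran) auto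
      also have "\<dots> \<le> \<epsilon>1 * (C * (V t - V s))" using pos C(2)[OF st] by (intro mult_left_mono) auto
      also have "\<dots> \<le> \<epsilon>1 * ((C + 1) * (V t - V s))"
        using pos V by (intro mult_left_mono mult_right_mono) auto
      also have "\<dots> = \<epsilon> / 2 * (V t - V s)" using C(1) by (simp add: \<epsilon>1_def field_simps)
      finally have 1: "\<bar>\<phi> (f t) - \<phi> (f s) - \<phi>' (f s) * (f t - f s)\<bar> \<le> \<epsilon> / 2 * (V t - V s)" .
      have "\<bar>\<phi>' (f s) * (f t - f s - L s t)\<bar> \<le> K * (\<epsilon>2 * (V t - V s))"
        unfolding abs_mult using st d by (intro mult_mono K(2) ran \<delta>2(2)) (auto simp: K(1) less_imp_le)
      also have "\<dots> = \<epsilon> / 2 * (V t - V s)" using K(1) by (simp add: \<epsilon>2_def)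
      finally have 2: "\<bar>\<phi>' (f s) * (f t - f s - L s t)\<bar> \<le> \<epsilon> / 2 * (V t - V s)" .
      show "\<bar>\<phi> (f t) - \<phi> (f s) - \<phi>' (f s) * L s t\<bar> \<le> \<epsilon> * (V t - V s)"
        using 1 2 by (simp add: algebra_simps abs_if split: if_splits)
    qed (use \<delta>1 \<delta>2 in auto)
  qed
qed

lemma appr_C1:
  assumes "\<And>x. x \<in> {a..b} \<Longrightarrow> (\<phi> has_real_derivative \<phi>' x) (at x)" "continuous_on {a..b} \<phi>'"
  shows "appr \<phi> (\<lambda>s t. \<phi>' s * (t - s))"
  by (rule appr_chain[OF appr_id assms]) auto

lemma appr_add:
  assumes f: "appr f L" and g: "appr g M"
  shows "appr (\<lambda>t. f t + g t) (\<lambda>s t. L s t + M s t)"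
proof -
  obtain C where C: "C \<ge> 0" "\<And>s t. a \<le> s \<Longrightarrow> s \<le> t \<Longrightarrow> t \<le> b \<Longrightarrow> \<bar>f t - f s\<bar> \<le> C * (V t - V s)"
    using apprD(2)[OF f] by blast
  obtain D where D: "D \<ge> 0" "\<And>s t. a \<le> s \<Longrightarrow> s \<le> t \<Longrightarrow> t \<le> b \<Longrightarrow> \<bar>g t - g s\<bar> \<le> D * (V t - V s)"
    using apprD(2)[OF g] by blast
  show ?thesis
  proof (rule apprI[where C = "C + D"])
    show "continuous_on {a..b} (\<lambda>t. f t + g t)" using f g by (intro continuous_intros apprD(1))
    show "C + D \<ge> 0" using C D by simp
    fix s t assume st: "a \<le> s" "s \<le> t" "t \<le> b"
    show "\<bar>f t + g t - (f s + g s)\<bar> \<le> (C + D) * (V t - V s)"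
      using C(2)[OF st] D(2)[OF st] by (simp add: distrib_right)
  next
    fix \<epsilon> :: real assume "\<epsilon> > 0"
    then have e2: "\<epsilon> / 2 > 0" by simp
    obtain \<delta>1 where \<delta>1: "\<delta>1 > 0" "\<And>s t. a \<le> s \<Longrightarrow> s \<le> t \<Longrightarrow> t \<le> b \<Longrightarrow> t - s < \<delta>1 \<Longrightarrow> \<bar>f t - f s - L s t\<bar> \<le> \<epsilon> / 2 * (V t - V s)"
      using apprD(3)[OF f e2] by blast
    obtain \<delta>2 where \<delta>2: "\<delta>2 > 0" "\<And>s t. a \<le> s \<Longrightarrow> s \<le> t \<Longrightarrow> t \<le> b \<Longrightarrow> t - s < \<delta>2 \<Longrightarrow> \<bar>g t - g s - M s t\<bar> \<le> \<epsilon> / 2 * (V t - V s)"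
      using apprD(3)[OF g e2] by blast
    show "\<exists>\<delta>>0. \<forall>s t. a \<le> s \<and> s \<le> t \<and> t \<le> b \<and> t - s < \<delta>
           \<longrightarrow> \<bar>f t + g t - (f s + g s) - (L s t + M s t)\<bar> \<le> \<epsilon> * (V t - V s)"
    proof (intro exI[of _ "min \<delta>1 \<delta>2"] conjI allI impI; (elim conjE)?)
      fix s t assume st: "a \<le> s" "s \<le> t" "t \<le> b" and d: "t - s < min \<delta>1 \<delta>2"
      then show "\<bar>f t + g t - (f s + g s) - (L s t + M s t)\<bar> \<le> \<epsilon> * (V t - V s)"
        using \<delta>1(2)[of s t] \<delta>2(2)[of s t] by (simp add: abs_if split: if_splits)
    qed (use \<delta>1 \<delta>2 in auto)
  qed
qed

lemma appr_bounded:
  assumes "appr f L"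
  obtains m where "\<And>t. t \<in> {a..b} \<Longrightarrow> \<bar>f t\<bar> \<le> m"
proof -
  have "bounded (f ` {a..b})"
    using apprD(1)[OF assms] by (intro compact_imp_bounded compact_continuous_image) auto
  then obtain m where "\<forall>x\<in>f ` {a..b}. norm x \<le> m" unfolding bounded_iff by blast
  then show ?thesis by (intro that[of m]) auto
qed

lemma appr_cmult:
  assumes f: "appr f L"
  shows "appr (\<lambda>t. c * f t) (\<lambda>s t. c * L s t)"
proof -
  obtain m where m: "\<And>t. t \<in> {a..b} \<Longrightarrow> \<bar>f t\<bar> \<le> m" using appr_bounded[OF f] by blast
  show ?thesis
    by (rule appr_chain[OF f, where \<phi> = "\<lambda>x. c * x" and m = "- m" and M = m])
       (use m in \<open>auto intro!: derivative_eq_intros continuous_intros simp: abs_le_iff minus_le_iff\<close>)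
qed

lemma appr_diff:
  "appr f L \<Longrightarrow> appr g M \<Longrightarrow> appr (\<lambda>t. f t - g t) (\<lambda>s t. L s t - M s t)"
  using appr_add[of f L "\<lambda>t. -1 * g t" "\<lambda>s t. -1 * M s t"] appr_cmult[of g M "-1"] by simp

lemma appr_square:
  assumes f: "appr f L"
  shows "appr (\<lambda>t. f t * f t) (\<lambda>s t. 2 * f s * L s t)"
proof -
  obtain m where m: "\<And>t. t \<in> {a..b} \<Longrightarrow> \<bar>f t\<bar> \<le> m" using appr_bounded[OF f] by blast
  show ?thesis
    by (rule appr_chain[OF f, where \<phi> = "\<lambda>x. x * x" and m = "- m" and M = m])
       (use m in \<open>auto intro!: derivative_eq_intros continuous_intros simp: abs_le_iff minus_le_iff\<close>)
qed

text \<open>Polarisation: \<open>f g\<close> is half of \<open>(f + g)^2 - f^2 - g^2\<close>, so the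
  one-variable chain rule for squaring yields the product rule.\<close>

lemma appr_mult:
  assumes f: "appr f L" and g: "appr g M"
  shows "appr (\<lambda>t. f t * g t) (\<lambda>s t. L s t * g s + f s * M s t)"
proof -
  have "appr (\<lambda>t. 1/2 * ((f t + g t) * (f t + g t) - f t * f t - g t * g t))
      (\<lambda>s t. 1/2 * (2 * (f s + g s) * (L s t + M s t) - 2 * f s * L s t - 2 * g s * M s t))"
    by (intro appr_cmult appr_diff appr_square appr_add f g)
  then show ?thesis by (simp add: algebra_simps)
qed

lemma appr_sum:
  "(\<And>i. i \<in> I \<Longrightarrow> appr (f i) (L i)) \<Longrightarrow> appr (\<lambda>t. \<Sum>i\<in>I. f i t) (\<lambda>s t. \<Sum>i\<in>I. L i s t)"
  by (induction I rule: infinite_finite_induct) (auto intro!: appr_const appr_add)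

lemma appr_sum_mset:
  "(\<And>i. i \<in># I \<Longrightarrow> appr (f i) (L i)) \<Longrightarrow> appr (\<lambda>t. \<Sum>i\<in>#I. f i t) (\<lambda>s t. \<Sum>i\<in>#I. L i s t)"
  by (induction I) (auto intro!: appr_const appr_add)

text \<open>A continuous positive path stays above its minimum, so the chain rule for
  \<open>ln\<close> is applied on a compact interval away from 0.\<close>

lemma appr_ln:
  assumes f: "appr f L" and pos: "\<And>t. t \<in> {a..b} \<Longrightarrow> f t > 0"
  shows "appr (\<lambda>t. ln (f t)) (\<lambda>s t. L s t / f s)"
proof -
  obtain M where M: "\<And>t. t \<in> {a..b} \<Longrightarrow> \<bar>f t\<bar> \<le> M" using appr_bounded[OF f] by blast
  obtain t0 where t0: "t0 \<in> {a..b}" "\<And>t. t \<in> {a..b} \<Longrightarrow> f t0 \<le> f t"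
    using continuous_attains_inf[of "{a..b}" f] apprD(1)[OF f] a_less_b by auto
  have "appr (\<lambda>t. ln (f t)) (\<lambda>s t. inverse (f s) * L s t)"
    by (rule appr_chain[OF f, where m = "f t0" and M = M])
       (use pos[OF t0(1)] t0 M in \<open>auto intro!: derivative_eq_intros continuous_intros simp: field_simps abs_le_iff\<close>)
  then show ?thesis by (simp add: divide_inverse mult.commute)
qed

lemma appr_exp:
  assumes f: "appr f L"
  shows "appr (\<lambda>t. exp (f t)) (\<lambda>s t. exp (f s) * L s t)"
proof -
  obtain m where m: "\<And>t. t \<in> {a..b} \<Longrightarrow> \<bar>f t\<bar> \<le> m" using appr_bounded[OF f] by blast
  show ?thesis
    by (rule appr_chain[OF f, where m = "- m" and M = m])
       (use m in \<open>auto intro!: derivative_eq_intros continuous_intros simp: abs_le_iff minus_le_iff\<close>)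
qed

end

section \<open>Uniform grids and Riemann-Stieltjes sums\<close>

text \<open>The same grids serve all trees, and their points form a countable set. For
  \<open>N = 0\<close> division by zero makes every point equal to \<open>a\<close>.\<close>

definition grid :: "real \<Rightarrow> real \<Rightarrow> nat \<Rightarrow> nat \<Rightarrow> real" where
  "grid a b N k = a + real k * (b - a) / real N"

lemma grid_Suc: "grid a b N (Suc k) = grid a b N k + (b - a) / real N"
  by (cases "N = 0") (simp_all add: grid_def field_simps)

lemma grid_bounds:
  assumes "a < b" "k \<le> N" shows "a \<le> grid a b N k" "grid a b N k \<le> b"
proof -
  show "a \<le> grid a b N k" using assms by (simp add: grid_def)
  have "real k / real N \<le> 1" using assms by (cases "N = 0") auto
  then have "(b - a) * (real k / real N) \<le> (b - a) * 1" using assms by (intro mult_left_mono) auto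
  then show "grid a b N k \<le> b" by (simp add: grid_def mult.commute)
qed

lemma grid_ends: "grid a b N 0 = a" "N > 0 \<Longrightarrow> grid a b N N = b"
  by (auto simp: grid_def)

lemma sum_grid_telescope:
  fixes f :: "real \<Rightarrow> real"
  assumes "N > 0"
  shows "(\<Sum>k<N. f (grid a b N (Suc k)) - f (grid a b N k)) = f b - f a"
  using sum_lessThan_telescope[of "\<lambda>k. f (grid a b N k)" N] assms by (simp add: grid_ends)

text \<open>The errors on the cells are small multiples of the increments of \<open>V\<close>, which
  telescope to \<open>V b - V a\<close>.\<close>

lemma (in bv_control) appr_grid_sum:
  assumes f: "appr f L"
  shows "(\<lambda>N. f b - f a - (\<Sum>k<N. L (grid a b N k) (grid a b N (Suc k)))) \<longlonglongrightarrow> 0"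
proof (rule LIMSEQ_I)
  fix r :: real assume "r > 0"
  define W where "W = V b - V a + 1"
  have W: "W > 0" "V b - V a < W" using V_mono[of a b] a_less_b by (auto simp: W_def)
  have "r / W > 0" using \<open>r > 0\<close> W by simp
  from apprD(3)[OF f this] obtain \<delta> where \<delta>: "\<delta> > 0"
    "\<And>s t. a \<le> s \<Longrightarrow> s \<le> t \<Longrightarrow> t \<le> b \<Longrightarrow> t - s < \<delta> \<Longrightarrow> \<bar>f t - f s - L s t\<bar> \<le> r / W * (V t - V s)"
    by blast
  obtain N0 where N0: "(b - a) / \<delta> < real N0" using reals_Archimedean2 by blast
  show "\<exists>no. \<forall>N\<ge>no. norm (f b - f a - (\<Sum>k<N. L (grid a b N k) (grid a b N (Suc k))) - 0) < r"
  proof (intro exI allI impI)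
    fix N assume "N \<ge> Suc N0"
    then have N: "N > 0" "(b - a) / \<delta> < real N" using N0 by linarith+
    let ?g = "grid a b N"
    have mesh: "(b - a) / real N < \<delta>" using N \<delta>(1) a_less_b by (simp add: field_simps)
    have "f b - f a - (\<Sum>k<N. L (?g k) (?g (Suc k))) = (\<Sum>k<N. f (?g (Suc k)) - f (?g k) - L (?g k) (?g (Suc k)))"
      using sum_grid_telescope[OF N(1), of f] by (simp add: sum_subtractf)
    also have "\<bar>\<dots>\<bar> \<le> (\<Sum>k<N. r / W * (V (?g (Suc k)) - V (?g k)))"
    proof (rule sum_abs[THEN order_trans], rule sum_mono)
      fix k assume "k \<in> {..<N}"
      then show "\<bar>f (?g (Suc k)) - f (?g k) - L (?g k) (?g (Suc k))\<bar> \<le> r / W * (V (?g (Suc k)) - V (?g k))"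
        using a_less_b mesh by (intro \<delta>(2) grid_bounds) (auto simp: grid_Suc)
    qed
    also have "\<dots> = r / W * (V b - V a)"
      using sum_grid_telescope[OF N(1), of V a b] by (subst sum_distrib_left[symmetric]) simp
    also have "\<dots> < r / W * W" using \<open>r / W > 0\<close> W by (intro mult_strict_left_mono)
    finally show "norm (f b - f a - (\<Sum>k<N. L (?g k) (?g (Suc k))) - 0) < r" using W by simp
  qed
qed

subsection \<open>Total variation\<close>

lemma tv_nonneg: "a \<le> b \<Longrightarrow> 0 \<le> tv f a b"
  unfolding tv_def by (rule SUP_upper2[of "[]"]) (auto simp: zero_ereal_def)

text \<open>Any partition of \<open>[a, s]\<close> can be continued by \<open>s\<close> and
  \<open>t\<close>, so the variation grows by at least the last jump. This makes the variation up to
  time \<open>t\<close> usable as a control.\<close>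

lemma tv_extend:
  assumes "a \<le> s" "s \<le> t"
  shows "tv f a s + ereal \<bar>f t - f s\<bar> \<le> tv f a t"
proof -
  have "tv f a s \<le> tv f a t - ereal \<bar>f t - f s\<bar>"
    unfolding tv_def[of f a s]
  proof (rule SUP_least)
    fix xs assume "xs \<in> {xs. sorted xs \<and> set xs \<subseteq> {a..s}}"
    then have xs: "sorted xs" "set xs \<subseteq> {a..s}" by simp_all
    define S where "S xs = (\<Sum>i<length xs - 1. \<bar>f (xs ! Suc i) - f (xs ! i)\<bar>)" for xs
    have up: "ereal (S ys) \<le> tv f a t" if "sorted ys" "set ys \<subseteq> {a..t}" for ys
      unfolding tv_def S_def using that by (intro SUP_upper) simp
    have app: "S (ys @ [y]) = S ys + \<bar>f y - f (last ys)\<bar>" if ne: "ys \<noteq> []" for ys y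
    proof -
      obtain m where m: "length ys = Suc m" using ne by (cases ys) auto
      have "S (ys @ [y]) = (\<Sum>i<m. \<bar>f ((ys @ [y]) ! Suc i) - f ((ys @ [y]) ! i)\<bar>)
          + \<bar>f ((ys @ [y]) ! Suc m) - f ((ys @ [y]) ! m)\<bar>"
        by (simp add: S_def m)
      also have "(\<Sum>i<m. \<bar>f ((ys @ [y]) ! Suc i) - f ((ys @ [y]) ! i)\<bar>) = S ys"
        unfolding S_def by (rule sum.cong) (simp_all add: m nth_append)
      also have "(ys @ [y]) ! Suc m = y" using m by (simp add: nth_append)
      also have "(ys @ [y]) ! m = last ys" using m ne by (simp add: nth_append last_conv_nth)
      finally show ?thesis .
    qed
    have "ereal (S xs + \<bar>f t - f s\<bar>) \<le> tv f a t"
    proof (cases "xs = []")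
      case True
      have "ereal (S [s, t]) \<le> tv f a t" using assms by (intro up) auto
      then show ?thesis by (simp add: True S_def)
    next
      case False
      have "ereal (S ((xs @ [s]) @ [t])) \<le> tv f a t"
        using xs assms by (intro up) (force simp: sorted_append)+
      \<comment> \<open>Passing through \<open>s\<close> first adds a nonnegative term and lets the
        last jump start from \<open>s\<close>, whatever the last point of \<open>xs\<close>
        is.\<close>
      moreover have "S xs + \<bar>f t - f s\<bar> \<le> S ((xs @ [s]) @ [t])"
        using app[OF False, of s] app[of "xs @ [s]" t] by simp
      then have "ereal (S xs + \<bar>f t - f s\<bar>) \<le> ereal (S ((xs @ [s]) @ [t]))" by simp
      ultimately show ?thesis by (rule order_trans[rotated])
    qed
    then show "ereal (\<Sum>i<length xs - 1. \<bar>f (xs ! Suc i) - f (xs ! i)\<bar>) \<le> tv f a t - ereal \<bar>f t - f s\<bar>"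
      unfolding S_def[symmetric] by (simp add: ereal_le_minus_iff)
  qed
  then show ?thesis by (simp add: ereal_le_minus_iff)
qed

lemma tv_mono:
  assumes "a \<le> s" "s \<le> t" shows "tv f a s \<le> tv f a t"
  unfolding tv_def using assms by (intro SUP_subset_mono) auto

text \<open>The bound \<open>C\<close> makes the variation finite, so the extended-real inequality
  becomes one between real increments.\<close>

lemma real_tv_increment:
  assumes "a \<le> s" "s \<le> t" "t \<le> b" "tv f a b \<le> ereal C"
  shows "\<bar>f t - f s\<bar> \<le> real_of_ereal (tv f a t) - real_of_ereal (tv f a s)"
    and "real_of_ereal (tv f a t) \<le> C"
proof -
  have t: "0 \<le> tv f a t" "tv f a t \<le> ereal C"
    using assms tv_nonneg[of a t f] tv_mono[of a t b f] by auto
  have s: "0 \<le> tv f a s" "tv f a s \<le> ereal C"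
    using assms tv_nonneg[of a s f] tv_mono[of a s b f] by auto
  obtain x where x: "tv f a t = ereal x" using t by (cases "tv f a t") auto
  obtain y where y: "tv f a s = ereal y" using s by (cases "tv f a s") auto
  show "\<bar>f t - f s\<bar> \<le> real_of_ereal (tv f a t) - real_of_ereal (tv f a s)"
    using tv_extend[OF assms(1,2), of f] by (simp add: x y)
  show "real_of_ereal (tv f a t) \<le> C" using t(2) by (simp add: x)
qed

lemma sum_grid_le_tv:
  assumes "a < b" "tv f a b \<le> ereal C"
  shows "(\<Sum>k<N. \<bar>f (grid a b N (Suc k)) - f (grid a b N k)\<bar>) \<le> C"
proof (cases "N = 0")
  case True
  have "0 \<le> ereal C" using order_trans[OF tv_nonneg[of a b f] assms(2)] assms(1) by simp
  then show ?thesis using True by simp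
next
  case False
  let ?v = "\<lambda>t. real_of_ereal (tv f a t)"
  have "(\<Sum>k<N. \<bar>f (grid a b N (Suc k)) - f (grid a b N k)\<bar>) \<le> (\<Sum>k<N. ?v (grid a b N (Suc k)) - ?v (grid a b N k))"
  proof (rule sum_mono)
    fix k assume "k \<in> {..<N}"
    then show "\<bar>f (grid a b N (Suc k)) - f (grid a b N k)\<bar> \<le> ?v (grid a b N (Suc k)) - ?v (grid a b N k)"
      using assms grid_bounds[of a b "Suc k" N] grid_bounds[of a b k N]
      by (intro real_tv_increment(1)[where b = b and C = C]) (auto simp: grid_Suc)
  qed
  also have "\<dots> = ?v b - ?v a" using sum_grid_telescope[of N ?v] False by simp
  also have "\<dots> \<le> ?v b" using tv_nonneg[of a a f] by (simp add: real_of_ereal_pos)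
  also have "\<dots> \<le> C" using real_tv_increment(2)[of a b b b f C] assms by simp
  finally show ?thesis .
qed

section \<open>Bethe functional along a path of fixed points\<close>

lemma sum_mset_mono_real:
  fixes f g :: "'a \<Rightarrow> real"
  assumes "\<And>x. x \<in># M \<Longrightarrow> f x \<le> g x"
  shows "(\<Sum>x\<in>#M. f x) \<le> (\<Sum>x\<in>#M. g x)"
  using assms by (induction M) (auto intro!: add_mono)

lemma abs_sum_mset_le:
  fixes f :: "'a \<Rightarrow> real"
  shows "\<bar>\<Sum>x\<in>#M. f x\<bar> \<le> (\<Sum>x\<in>#M. \<bar>f x\<bar>)"
  by (induction M) (auto intro: abs_triangle_ineq[THEN order_trans])

lemma abs_sum_mset_le_size:
  fixes f :: "'a \<Rightarrow> real"
  assumes "\<And>x. x \<in># M \<Longrightarrow> \<bar>f x\<bar> \<le> c"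
  shows "\<bar>\<Sum>x\<in>#M. f x\<bar> \<le> real (size M) * c"
  using assms
proof (induction M)
  case (add x M)
  then have "\<bar>f x\<bar> \<le> c" "\<bar>\<Sum>x\<in>#M. f x\<bar> \<le> real (size M) * c" by auto
  then show ?case by (simp add: distrib_right abs_le_iff)
qed simp

lemma sum_mult_sum_mset:
  fixes f :: "'a \<Rightarrow> 'b \<Rightarrow> real"
  shows "(\<Sum>i\<in>I. c i * (\<Sum>j\<in>#M. f i j)) = (\<Sum>j\<in>#M. \<Sum>i\<in>I. c i * f i j)"
  by (induction M) (auto simp: distrib_left sum.distrib)

lemma sum_sum_mset_swap:
  fixes f :: "'a \<Rightarrow> 'b \<Rightarrow> real"
  shows "(\<Sum>i\<in>I. \<Sum>j\<in>#M. f i j) = (\<Sum>j\<in>#M. \<Sum>i\<in>I. f i j)"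
  using sum_mult_sum_mset[of "\<lambda>_. 1" f M I] by simp

lemma sum_mset_mult_left:
  fixes f :: "'a \<Rightarrow> real"
  shows "(\<Sum>j\<in>#M. c * f j) = c * (\<Sum>j\<in>#M. f j)"
  by (induction M) (auto simp: distrib_left)

lemma prod_mset_bounds:
  fixes f :: "'a \<Rightarrow> real"
  assumes "0 \<le> m" "\<And>x. x \<in># A \<Longrightarrow> m \<le> f x" "\<And>x. x \<in># A \<Longrightarrow> f x \<le> M"
  shows "m ^ size A \<le> (\<Prod>x\<in>#A. f x)" "(\<Prod>x\<in>#A. f x) \<le> M ^ size A"
proof -
  have "m ^ size A \<le> (\<Prod>x\<in>#A. f x) \<and> (\<Prod>x\<in>#A. f x) \<le> M ^ size A"
    using assms(2,3)
  proof (induction A)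
    case (add x A)
    have IH: "m ^ size A \<le> (\<Prod>x\<in>#A. f x)" "(\<Prod>x\<in>#A. f x) \<le> M ^ size A" using add by auto
    have x: "m \<le> f x" "f x \<le> M" using add.prems by auto
    have nn: "0 \<le> f x" "0 \<le> (\<Prod>x\<in>#A. f x)" "0 \<le> M"
      using x IH(1) assms(1) zero_le_power[OF assms(1), of "size A"] by linarith+
    show ?case using IH x nn assms(1) by (auto intro!: mult_mono)
  qed simp
  then show "m ^ size A \<le> (\<Prod>x\<in>#A. f x)" "(\<Prod>x\<in>#A. f x) \<le> M ^ size A" by auto
qed

lemma prod_mset_nonneg:
  fixes f :: "'a \<Rightarrow> real"
  assumes "\<And>x. x \<in># A \<Longrightarrow> 0 \<le> f x"
  shows "0 \<le> (\<Prod>x\<in>#A. f x)"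
  using assms by (induction A) auto

text \<open>Serves to pass from grid points to all parameters by continuity. The witness
  \<open>k\<close> is the floor of the position of \<open>t\<close> measured in units of the
  mesh.\<close>

lemma grid_dense:
  assumes "a < b" "t \<in> {a..b}" "\<delta> > 0"
  obtains N k where "k \<le> N" "\<bar>grid a b N k - t\<bar> < \<delta>"
proof -
  obtain N0 where N0: "(b - a) / \<delta> < real N0" using reals_Archimedean2 by blast
  then have N: "N0 > 0" using assms by (metis divide_pos_pos diff_gt_0_iff_gt less_trans of_nat_0_less_iff)
  define x where "x = (t - a) * real N0 / (b - a)"
  define k where "k = nat \<lfloor>x\<rfloor>"
  have x0: "0 \<le> x" using assms by (auto simp: x_def)
  have xN: "x \<le> real N0"
    using assms mult_right_mono[of "t - a" "b - a" "real N0"] by (simp add: x_def divide_le_eq mult.commute)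
  have k: "real k \<le> x" "x < real k + 1"
    using x0 by (auto simp: k_def of_nat_nat intro: real_of_int_floor_add_one_gt)
  have kN: "k \<le> N0" using k xN by linarith
  have t: "t = a + x * (b - a) / real N0" using assms N by (simp add: x_def field_simps)
  have eq: "t - grid a b N0 k = (x - real k) * ((b - a) / real N0)"
    unfolding grid_def by (subst (1) t) (simp add: algebra_simps diff_divide_distrib)
  have pos: "(b - a) / real N0 > 0" using assms N by simp
  have lt: "(b - a) / real N0 < \<delta>" using N0 N assms by (simp add: field_simps)
  have "0 \<le> t - grid a b N0 k" unfolding eq using k pos by (intro mult_nonneg_nonneg) auto
  moreover have "t - grid a b N0 k \<le> 1 * ((b - a) / real N0)"
    unfolding eq using k pos by (intro mult_right_mono) auto
  ultimately have "\<bar>grid a b N0 k - t\<bar> < \<delta>" using lt by linarith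
  with kN show ?thesis by (rule that)
qed

text \<open>From \<open>ln x \<le> x - 1\<close> at \<open>x\<close> and at \<open>1 / x\<close>.
  The form fits the edge terms, for which upper bounds of both \<open>Ze\<close> and
  \<open>1 / Ze\<close> are at hand.\<close>

lemma abs_ln_le: "x > 0 \<Longrightarrow> \<bar>ln x\<bar> \<le> x + 1 / x" for x :: real
proof -
  assume "x > 0"
  then have "ln x \<le> x - 1" "- ln x \<le> 1 / x - 1" "0 < 1 / x"
    using ln_le_minus_one[of x] ln_le_minus_one[of "1 / x"] by (auto simp: ln_div)
  then show ?thesis using \<open>x > 0\<close> unfolding abs_le_iff by linarith
qed

text \<open>Total weight 0 is included, since the quotient is then 0; the bounds on means thus need
  no positivity of a partition function.\<close>

lemma abs_weighted_mean_le:
  fixes w f :: "'a \<Rightarrow> real"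
  assumes "\<And>i. i \<in> I \<Longrightarrow> 0 \<le> w i" "\<And>i. i \<in> I \<Longrightarrow> \<bar>f i\<bar> \<le> c" "0 \<le> c"
  shows "\<bar>(\<Sum>i\<in>I. w i * f i) / (\<Sum>i\<in>I. w i)\<bar> \<le> c"
proof -
  have "\<bar>\<Sum>i\<in>I. w i * f i\<bar> \<le> (\<Sum>i\<in>I. w i * c)"
    using assms by (intro sum_abs[THEN order_trans] sum_mono) (auto simp: abs_mult intro!: mult_left_mono)
  also have "\<dots> = c * (\<Sum>i\<in>I. w i)" by (simp add: sum_distrib_left mult.commute)
  finally have le: "\<bar>\<Sum>i\<in>I. w i * f i\<bar> \<le> c * (\<Sum>i\<in>I. w i)" .
  have "0 \<le> (\<Sum>i\<in>I. w i)" using assms(1) by (rule sum_nonneg)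
  then show ?thesis using le assms(3) by (cases "(\<Sum>i\<in>I. w i) = 0") (auto simp: abs_divide field_simps)
qed

text \<open>\<open>p\<close> is the permissive spin and \<open>C\<close> the constant of (H3). On
  the compact interval \<open>K\<close> bounds the factors and their logarithmic derivatives from
  above, and \<open>\<kappa>\<close> bounds vertex factors and pair factors with \<open>p\<close>
  from below. The null set in \<open>h_fixed\<close> may depend on \<open>t\<close>.\<close>

locale bethe =
  fixes P :: "real \<Rightarrow> 'x::finite \<Rightarrow> 'x \<Rightarrow> real" and Q :: "real \<Rightarrow> 'x \<Rightarrow> real"
    and h :: "real \<Rightarrow> dtree \<Rightarrow> 'x \<Rightarrow> real" and \<mu> :: "utree measure"
    and a b :: real and p :: 'x and K \<kappa> C :: real
  assumes a_less_b: "a < b"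
    and P_sym: "\<And>t s s'. P t s s' = P t s' s"
    and P_nonneg: "\<And>t s s'. 0 \<le> P t s s'"
    and Q_nonneg: "\<And>t s. 0 \<le> Q t s"
    and P_deriv: "\<And>t s s'. ((\<lambda>t. P t s s') has_real_derivative P t s s' * dxi P t s s') (at t)"
    and dxi_continuous: "\<And>s s'. continuous_on {a..b} (\<lambda>t. dxi P t s s')"
    and Q_deriv: "\<And>t s. ((\<lambda>t. ln (Q t s)) has_real_derivative dxib Q t s) (at t)"
    and dxib_continuous: "\<And>s. continuous_on {a..b} (\<lambda>t. dxib Q t s)"
    and K_ge_1: "1 \<le> K" and \<kappa>_pos: "0 < \<kappa>" and \<kappa>_le_1: "\<kappa> \<le> 1"
    and P_le: "\<And>t s s'. t \<in> {a..b} \<Longrightarrow> P t s s' \<le> K"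
    and Q_le: "\<And>t s. t \<in> {a..b} \<Longrightarrow> Q t s \<le> K"
    and Q_ge: "\<And>t s. t \<in> {a..b} \<Longrightarrow> \<kappa> \<le> Q t s"
    and P_perm_ge: "\<And>t s. t \<in> {a..b} \<Longrightarrow> \<kappa> \<le> P t s p"
    and P_ge: "\<And>t s s'. \<forall>t s s'. P t s s' > 0 \<Longrightarrow> t \<in> {a..b} \<Longrightarrow> \<kappa> \<le> P t s s'"
    and dxi_le: "\<And>t s s'. t \<in> {a..b} \<Longrightarrow> \<bar>dxi P t s s'\<bar> \<le> K"
    and dxib_le: "\<And>t s. t \<in> {a..b} \<Longrightarrow> \<bar>dxib Q t s\<bar> \<le> K"
    and \<mu>_sets: "sets \<mu> = sets utreeM" and \<mu>_prob: "prob_space \<mu>" and \<mu>_unimodular: "unimodular \<mu>"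
    and \<mu>_H2: "H2 \<mu> P"
    and h_measurable [measurable]: "\<And>t s. (\<lambda>e. h t e s) \<in> borel_measurable dtreeM"
    and h_nonneg: "\<And>t e s. 0 \<le> h t e s"
    and h_sum: "\<And>t e. (\<Sum>s\<in>UNIV. h t e s) = 1"
    and h_fixed: "\<And>t. t \<in> {a..b} \<Longrightarrow> AE e in mu_up \<mu>. h t e = BP P Q (\<lambda>_. h) t t e"
    and h_bv: "AE e in mu_up \<mu>. \<forall>s. continuous_on {a..b} (\<lambda>t. h t e s) \<and> tv (\<lambda>t. h t e s) a b \<le> ereal C"

context bethe begin

sublocale prob_space \<mu> by (rule \<mu>_prob)

lemma \<mu>_measurable_cong [measurable_cong]: "sets \<mu> = sets utreeM" by (rule \<mu>_sets)

section \<open>Edge and vertex quantities of the Bethe functional\<close>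

text \<open>The message as it arrives at the other endpoint, after passing the pair factor.\<close>

definition u :: "real \<Rightarrow> dtree \<Rightarrow> 'x \<Rightarrow> real" where
  "u t e s = (\<Sum>s'\<in>UNIV. P t s s' * h t e s')"

definition Ze :: "real \<Rightarrow> dtree \<Rightarrow> real" where
  "Ze t e = (\<Sum>s\<in>UNIV. u t e s * h t (prod.swap e) s)"

abbreviation rw :: "real \<Rightarrow> utree \<Rightarrow> 'x \<Rightarrow> real" where
  "rw t T s \<equiv> rootw P Q (\<lambda>_. h) t t T s"

definition Zv :: "real \<Rightarrow> utree \<Rightarrow> real" where
  "Zv t T = (\<Sum>s\<in>UNIV. rw t T s)"

abbreviation bpw :: "real \<Rightarrow> dtree \<Rightarrow> 'x \<Rightarrow> real" where
  "bpw t e s \<equiv> bpu P Q (\<lambda>_. h) t t e s"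

definition bp :: "real \<Rightarrow> dtree \<Rightarrow> bool" where
  "bp t e \<longleftrightarrow> h t e = BP P Q (\<lambda>_. h) t t e"

definition nrm :: "real \<Rightarrow> dtree \<Rightarrow> real" where
  "nrm t e = (\<Sum>s\<in>UNIV. bpw t e s)"

text \<open>Mean of \<open>dxi\<close> under the edge marginal built from the two opposite
  messages.\<close>

definition q :: "real \<Rightarrow> dtree \<Rightarrow> real" where
  "q t e = (\<Sum>s\<in>UNIV. \<Sum>s'\<in>UNIV. P t s s' * dxi P t s s' * h t e s' * h t (prod.swap e) s) / Ze t e"

definition vx :: "real \<Rightarrow> utree \<Rightarrow> real" where
  "vx t T = (\<Sum>s\<in>UNIV. rw t T s * dxib Q t s) / Zv t T"

text \<open>First-order increment of \<open>ln Ze\<close> when only the message on the reversed edge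
  moves. Thus \<open>Y s t (edge_out T j)\<close> belongs to the incoming message and
  \<open>Y s t (edge_in T j)\<close> to the outgoing one.\<close>

definition Y :: "real \<Rightarrow> real \<Rightarrow> dtree \<Rightarrow> real" where
  "Y s t e = (\<Sum>\<sigma>\<in>UNIV. u s e \<sigma> * (h t (prod.swap e) \<sigma> - h s (prod.swap e) \<sigma>)) / Ze s e"

lemma rw_eq: "rw t T s = Q t s * (\<Prod>j\<in>#children T. u t (edge_in T j) s)"
  by (simp add: rootw_def u_def)

lemma PhiT_eq: "PhiT P Q (\<lambda>_. h) t t T = ln (Zv t T) - 1/2 * (\<Sum>j\<in>#children T. ln (Ze t (edge_in T j)))"
  by (simp add: PhiT_def Zv_def Ze_def u_def edge_out_eq_swap sum_distrib_right)

lemma Ze_swap: "Ze t (prod.swap e) = Ze t e"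
proof -
  have "Ze t (prod.swap e) = (\<Sum>s\<in>UNIV. \<Sum>s'\<in>UNIV. P t s s' * h t (prod.swap e) s' * h t e s)"
    by (simp add: Ze_def u_def sum_distrib_right)
  also have "\<dots> = (\<Sum>s'\<in>UNIV. \<Sum>s\<in>UNIV. P t s' s * h t e s * h t (prod.swap e) s')"
    by (subst sum.swap) (simp add: P_sym[of t] mult_ac)
  finally show ?thesis by (simp add: Ze_def u_def sum_distrib_right)
qed

subsection \<open>Bounds\<close>

lemma u_nonneg: "0 \<le> u t e s"
  unfolding u_def by (intro sum_nonneg mult_nonneg_nonneg P_nonneg h_nonneg)

lemma u_le: "t \<in> {a..b} \<Longrightarrow> u t e s \<le> K"
proof -
  assume "t \<in> {a..b}"
  then have "u t e s \<le> (\<Sum>s'\<in>UNIV. K * h t e s')"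
    unfolding u_def by (intro sum_mono mult_right_mono P_le h_nonneg)
  then show ?thesis by (simp add: h_sum flip: sum_distrib_left)
qed

lemma u_ge:
  assumes "\<And>s'. c \<le> P t s s'" shows "c \<le> u t e s"
proof -
  have "(\<Sum>s'\<in>UNIV. c * h t e s') \<le> u t e s"
    unfolding u_def by (intro sum_mono mult_right_mono assms h_nonneg)
  then show ?thesis by (simp add: h_sum flip: sum_distrib_left)
qed

lemma u_perm_ge: "t \<in> {a..b} \<Longrightarrow> \<kappa> \<le> u t e p"
  by (rule u_ge) (metis P_sym P_perm_ge)

lemma u_ge_perm: "t \<in> {a..b} \<Longrightarrow> \<kappa> * h t e p \<le> u t e s"
proof -
  assume t: "t \<in> {a..b}"
  have "\<kappa> * h t e p \<le> P t s p * h t e p" using t by (intro mult_right_mono P_perm_ge h_nonneg)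
  also have "\<dots> \<le> u t e s"
    unfolding u_def by (rule member_le_sum) (auto intro: mult_nonneg_nonneg P_nonneg h_nonneg)
  finally show ?thesis .
qed

lemma h_le_1: "h t e s \<le> 1"
  using member_le_sum[of s UNIV "h t e"] by (simp add: h_nonneg h_sum)

lemma rw_nonneg: "0 \<le> rw t T s"
  unfolding rw_eq by (intro mult_nonneg_nonneg Q_nonneg prod_mset_nonneg u_nonneg)

lemma rw_le:
  assumes "t \<in> {a..b}" shows "rw t T s \<le> K * K ^ deg T"
  unfolding rw_eq deg_def using assms K_ge_1
  by (intro mult_mono Q_le prod_mset_bounds(2)[of 0] prod_mset_nonneg) (auto simp: u_nonneg u_le)

text \<open>At the permissive spin every pair factor is at least \<open>\<kappa>\<close> whatever
  the neighbours do, so \<open>Zv\<close> is bounded below on every tree, with a bound that depends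
  only on the degree.\<close>

lemma rw_perm_ge:
  assumes "t \<in> {a..b}" shows "\<kappa> * \<kappa> ^ deg T \<le> rw t T p"
  unfolding rw_eq deg_def using assms \<kappa>_pos
  by (intro mult_mono Q_ge prod_mset_bounds(1)[where M = K]) (auto simp: u_le u_perm_ge Q_nonneg)

lemma Zv_ge: "t \<in> {a..b} \<Longrightarrow> \<kappa> ^ Suc (deg T) \<le> Zv t T"
  using rw_perm_ge[of t T] member_le_sum[of p UNIV "rw t T"] by (simp add: Zv_def rw_nonneg)

lemma Zv_pos: "t \<in> {a..b} \<Longrightarrow> 0 < Zv t T"
  using Zv_ge[of t T] \<kappa>_pos by (meson less_le_trans zero_less_power)

lemma Zv_le:
  assumes "t \<in> {a..b}" shows "Zv t T \<le> real CARD('x) * K ^ Suc (deg T)"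
  using sum_bounded_above[of UNIV "rw t T" "K * K ^ deg T"] rw_le[OF assms] by (simp add: Zv_def)

lemma vx_le: "t \<in> {a..b} \<Longrightarrow> \<bar>vx t T\<bar> \<le> K"
  unfolding vx_def Zv_def using K_ge_1 by (intro abs_weighted_mean_le rw_nonneg dxib_le) auto

lemma q_le: "t \<in> {a..b} \<Longrightarrow> \<bar>q t e\<bar> \<le> K"
proof -
  assume t: "t \<in> {a..b}"
  let ?w = "\<lambda>i. P t (fst i) (snd i) * h t e (snd i) * h t (prod.swap e) (fst i)"
  have double: "(\<Sum>s\<in>UNIV. \<Sum>s'\<in>UNIV. g s s') = (\<Sum>i\<in>UNIV. g (fst i) (snd i))" for g :: "'x \<Rightarrow> 'x \<Rightarrow> real"
    by (simp add: sum.cartesian_product case_prod_beta UNIV_Times_UNIV)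
  have Ze: "Ze t e = (\<Sum>i\<in>UNIV. ?w i)"
    by (simp only: Ze_def u_def sum_distrib_right double)
  have eq: "q t e = (\<Sum>i\<in>UNIV. ?w i * dxi P t (fst i) (snd i)) / (\<Sum>i\<in>UNIV. ?w i)"
    unfolding q_def Ze double by (simp add: mult_ac)
  show ?thesis unfolding eq using K_ge_1 t
    by (intro abs_weighted_mean_le mult_nonneg_nonneg P_nonneg h_nonneg dxi_le) auto
qed

text \<open>Once the factor of \<open>j\<close> is singled out, the remaining factors at the root
  are those of the BP update along the edge from the root to \<open>j\<close>. This links the vertex
  term to outgoing messages.\<close>

lemma bpw_identity:
  assumes "j \<in># children T"
  shows "rw t T s = u t (edge_in T j) s * bpw t (edge_out T j) s"
proof -
  obtain M where M: "children T = add_mset j M" using assms by (metis multi_member_split)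
  have "(\<Prod>v\<in>#M. u t (edge_in T v) s)
      = (\<Prod>v\<in>#M. \<Sum>sv\<in>UNIV. P t s sv * h t (v, Node (M - {#v#} + {#j#})) sv)"
    by (intro arg_cong[where f = prod_mset] image_mset_cong) (simp add: u_def edge_in_def M)
  then show ?thesis
    unfolding rw_eq by (simp add: M bpu_def edge_out_def mult_ac)
qed

text \<open>Division by zero gives 0, so a vanishing normaliser would force the message to sum to 0
  instead of 1.\<close>

lemma bp_bpw:
  assumes "bp t e"
  shows "nrm t e \<noteq> 0" "bpw t e s = nrm t e * h t e s"
proof -
  have eq: "h t e s = bpw t e s / nrm t e" for s
    using assms by (simp add: bp_def BP_def nrm_def fun_eq_iff)
  show nz: "nrm t e \<noteq> 0"
  proof
    assume "nrm t e = 0"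
    then have "(\<Sum>s\<in>UNIV. h t e s) = 0" by (simp add: eq)
    then show False by (simp add: h_sum)
  qed
  show "bpw t e s = nrm t e * h t e s" using nz by (simp add: eq[of s])
qed

text \<open>The weight of \<open>p\<close> at degree \<open>d\<close> is at least
  \<open>\<kappa>^(d+1)\<close> and the normaliser at most \<open>CARD('x) * K^(d+1)\<close>;
  enlarging the cardinality to its own power \<open>d + 1\<close> makes the ratio the pure power
  \<open>r^(d+1)\<close>.\<close>

definition r :: real where "r = \<kappa> / (real CARD('x) * K)"

lemma r_pos: "0 < r" using \<kappa>_pos K_ge_1 by (simp add: r_def)

lemma bp_perm_ge:
  assumes "t \<in> {a..b}" "bp t e"
  shows "r ^ Suc (deg (fst e)) \<le> h t e p"
proof -
  let ?d = "deg (fst e)"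
  let ?f = "\<lambda>v s. \<Sum>sv\<in>UNIV. P t s sv * h t (v, Node (children (fst e) - {#v#} + {#snd e#})) sv"
  have f: "?f v s = u t (v, Node (children (fst e) - {#v#} + {#snd e#})) s" for v s by (simp add: u_def)
  have le: "bpw t e s \<le> K * K ^ ?d" for s
    unfolding bpu_def deg_def f using assms(1) K_ge_1
    by (intro mult_mono Q_le prod_mset_bounds(2)[of 0] prod_mset_nonneg) (auto simp: u_nonneg u_le)
  have ge: "\<kappa> * \<kappa> ^ ?d \<le> bpw t e p"
    unfolding bpu_def deg_def f using assms(1) \<kappa>_pos
    by (intro mult_mono Q_ge prod_mset_bounds(1)[where M = K]) (auto simp: u_le u_perm_ge Q_nonneg)
  have nn: "0 \<le> bpw t e s" for s
    unfolding bpu_def f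
    by (intro mult_nonneg_nonneg Q_nonneg prod_mset_nonneg u_nonneg)
  have "nrm t e \<le> real CARD('x) * (K * K ^ ?d)"
    using sum_bounded_above[of UNIV "bpw t e" "K * K ^ ?d"] le by (simp add: nrm_def)
  also have "\<dots> \<le> (real CARD('x) * K) ^ Suc ?d"
  proof -
    have "1 \<le> real CARD('x) ^ ?d" by (intro one_le_power) (simp add: Suc_leI)
    then have "real CARD('x) * (K * K ^ ?d) * 1 \<le> real CARD('x) * (K * K ^ ?d) * real CARD('x) ^ ?d"
      using K_ge_1 by (intro mult_left_mono) auto
    then show ?thesis by (simp add: power_mult_distrib mult_ac)
  qed
  finally have N: "nrm t e \<le> (real CARD('x) * K) ^ Suc ?d" .
  have Npos: "0 < nrm t e"
    using bp_bpw(1)[OF assms(2)] sum_nonneg[of UNIV "bpw t e"] nn by (simp add: nrm_def less_le)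
  have "r ^ Suc ?d = \<kappa> ^ Suc ?d / (real CARD('x) * K) ^ Suc ?d" by (simp add: r_def power_divide)
  also have "\<dots> \<le> \<kappa> ^ Suc ?d / nrm t e"
    using N Npos \<kappa>_pos by (intro divide_left_mono) (auto intro!: mult_pos_pos)
  also have "\<dots> \<le> bpw t e p / nrm t e" using ge Npos by (intro divide_right_mono) auto
  also have "\<dots> = h t e p" using bp_bpw[OF assms(2)] by simp
  finally show ?thesis .
qed

subsection \<open>Almost sure properties\<close>

text \<open>The BP equation is asked for on the countable set of grid points only, so that almost
  every edge is good. The variation bound is the same for all good edges.\<close>

definition good :: "dtree \<Rightarrow> bool" where
  "good e \<longleftrightarrow> (\<forall>s. continuous_on {a..b} (\<lambda>t. h t e s) \<and> tv (\<lambda>t. h t e s) a b \<le> ereal C)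
     \<and> (\<forall>N k. k \<le> N \<longrightarrow> bp (grid a b N k) e)"

definition goodT :: "utree \<Rightarrow> bool" where
  "goodT T \<longleftrightarrow> (\<forall>j\<in>#children T. good (edge_in T j) \<and> good (edge_out T j))"

lemma AE_goodT: "AE T in \<mu>. goodT T"
  unfolding goodT_def
proof (rule AE_mu_upD[OF \<mu>_sets \<mu>_prob \<mu>_unimodular])
  have "AE e in mu_up \<mu>. k \<le> N \<longrightarrow> bp (grid a b N k) e" for N k
    using h_fixed[of "grid a b N k"] grid_bounds[OF a_less_b, of k N]
    by (cases "k \<le> N") (auto simp: bp_def)
  then have "AE e in mu_up \<mu>. \<forall>N k. k \<le> N \<longrightarrow> bp (grid a b N k) e"
    by (simp add: AE_all_countable)
  with h_bv show "AE e in mu_up \<mu>. good e"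
    by eventually_elim (simp add: good_def)
qed

text \<open>Known at grid points and extended by density and continuity. The bound is extended
  rather than the BP equation, because \<open>good e\<close> does not control the messages that
  enter \<open>bpu\<close> at \<open>e\<close>.\<close>

lemma good_perm_ge:
  assumes "good e" "t \<in> {a..b}"
  shows "r ^ Suc (deg (fst e)) \<le> h t e p"
proof (rule ccontr)
  let ?c = "r ^ Suc (deg (fst e))"
  assume "\<not> ?c \<le> h t e p"
  then have pos: "?c - h t e p > 0" by simp
  have "continuous_on {a..b} (\<lambda>t. h t e p)" using assms by (simp add: good_def)
  then obtain d where d: "d > 0" "\<And>t'. t' \<in> {a..b} \<Longrightarrow> \<bar>t' - t\<bar> < d \<Longrightarrow> \<bar>h t' e p - h t e p\<bar> < ?c - h t e p"
    using assms(2) pos unfolding continuous_on_iff dist_real_def by metis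
  obtain N k where k: "k \<le> N" "\<bar>grid a b N k - t\<bar> < d"
    using grid_dense[OF a_less_b assms(2) d(1)] by blast
  have m: "grid a b N k \<in> {a..b}" using grid_bounds[OF a_less_b k(1)] by simp
  have "?c \<le> h (grid a b N k) e p"
    using assms(1) k(1) m by (intro bp_perm_ge) (auto simp: good_def)
  then show False using d(2)[OF m k(2)] by linarith
qed

lemma good_perm_pos: "good e \<Longrightarrow> t \<in> {a..b} \<Longrightarrow> 0 < h t e p"
  using good_perm_ge[of e t] r_pos by (meson less_le_trans zero_less_power)

lemma good_u_pos: "good e \<Longrightarrow> t \<in> {a..b} \<Longrightarrow> 0 < u t e s"
  using u_ge_perm[of t e s] good_perm_pos[of e t] \<kappa>_pos by (meson less_le_trans mult_pos_pos)

text \<open>If \<open>P\<close> vanishes somewhere, \<open>1 / Ze\<close> is controlled only through the permissive spin, whose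
  probability under a fixed point may decay exponentially in the degree; this is where the
  exponential moments of (H2) enter.\<close>

definition M :: "nat \<Rightarrow> real" where
  "M d = (if \<forall>t s s'. P t s s' > 0 then 1 / \<kappa> else 1 / (\<kappa> * r ^ d))"

lemma M_pos: "0 < M d" using \<kappa>_pos r_pos by (simp add: M_def)

lemma Ze_good:
  assumes T: "goodT T" "j \<in># children T" and t: "t \<in> {a..b}"
  shows "0 < Ze t (edge_in T j)" "1 / Ze t (edge_in T j) \<le> M (deg T)"
proof -
  let ?e = "edge_in T j"
  have out: "good (prod.swap ?e)" using T by (simp add: goodT_def edge_out_eq_swap)
  \<comment> \<open>The outgoing edge starts at the root with \<open>j\<close> removed, so the
    exponent \<open>Suc (deg (fst e))\<close> of \<open>good_perm_ge\<close> is the full degree of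
    the root.\<close>
  have "deg T = Suc (deg (fst (prod.swap ?e)))"
  proof -
    obtain N where "children T = add_mset j N" using T(2) by (metis multi_member_split)
    then show ?thesis by (simp add: edge_in_def deg_def)
  qed
  then have hp: "r ^ deg T \<le> h t (prod.swap ?e) p" using good_perm_ge[OF out t] by simp
  have "\<kappa> * r ^ deg T \<le> u t ?e p * h t (prod.swap ?e) p"
    using hp u_perm_ge[OF t] r_pos \<kappa>_pos by (intro mult_mono u_nonneg) (auto intro: less_imp_le)
  also have "\<dots> \<le> Ze t ?e"
    unfolding Ze_def by (rule member_le_sum) (auto intro: mult_nonneg_nonneg u_nonneg h_nonneg)
  finally have le: "\<kappa> * r ^ deg T \<le> Ze t ?e" .
  have pos: "0 < \<kappa> * r ^ deg T" using \<kappa>_pos r_pos by simp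
  show "0 < Ze t ?e" using le pos by linarith
  show "1 / Ze t ?e \<le> M (deg T)"
  proof (cases "\<forall>t s s'. P t s s' > 0")
    case True
    have "(\<Sum>s\<in>UNIV. \<kappa> * h t (prod.swap ?e) s) \<le> Ze t ?e"
      unfolding Ze_def by (intro sum_mono mult_right_mono u_ge P_ge[OF True t] h_nonneg)
    then have "\<kappa> \<le> Ze t ?e" by (simp add: h_sum flip: sum_distrib_left)
    then have "1 / Ze t ?e \<le> 1 / \<kappa>" using \<kappa>_pos by (intro divide_left_mono) auto
    then show ?thesis unfolding M_def if_P[OF True] .
  next
    case False
    have "1 / Ze t ?e \<le> 1 / (\<kappa> * r ^ deg T)" using le pos by (intro divide_left_mono) auto
    then show ?thesis unfolding M_def if_not_P[OF False] .
  qed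
qed

lemma Ze_le: "t \<in> {a..b} \<Longrightarrow> Ze t e \<le> K"
proof -
  assume t: "t \<in> {a..b}"
  have "Ze t e \<le> (\<Sum>s\<in>UNIV. K * h t (prod.swap e) s)"
    unfolding Ze_def by (intro sum_mono mult_right_mono u_le t h_nonneg)
  then show ?thesis by (simp add: h_sum flip: sum_distrib_left)
qed

end

context bethe begin

subsection \<open>Increments of the Bethe functional along a path\<close>

text \<open>Product rule for \<open>u\<close>: the pair factor moves with the parameter, the message
  by its own increment.\<close>

definition Lu :: "real \<Rightarrow> real \<Rightarrow> dtree \<Rightarrow> 'x \<Rightarrow> real" where
  "Lu s t e \<sigma> = (\<Sum>\<sigma>'\<in>UNIV. P s \<sigma> \<sigma>' * dxi P s \<sigma> \<sigma>' * (t - s) * h s e \<sigma>' + P s \<sigma> \<sigma>' * (h t e \<sigma>' - h s e \<sigma>'))"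

definition Lp :: "real \<Rightarrow> real \<Rightarrow> utree \<Rightarrow> real" where
  "Lp s t T = (t - s) * (vx s T + 1/2 * (\<Sum>j\<in>#children T. q s (edge_in T j)))
     + 1/2 * ((\<Sum>j\<in>#children T. Y s t (edge_out T j)) - (\<Sum>j\<in>#children T. Y s t (edge_in T j)))"

text \<open>Against the reversed message, the derivative of the pair factor averages to
  \<open>q\<close>. Symmetry of \<open>P\<close> turns the rest into the increment of
  \<open>ln Ze\<close> in the message on \<open>e\<close>, which is \<open>Y\<close> at the swapped
  edge.\<close>

lemma sum_Lu:
  "(\<Sum>\<sigma>\<in>UNIV. h s (prod.swap e) \<sigma> * Lu s t e \<sigma>) / Ze s e = (t - s) * q s e + Y s t (prod.swap e)"
proof -
  have "(\<Sum>\<sigma>\<in>UNIV. h s (prod.swap e) \<sigma> * Lu s t e \<sigma>)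
     = (\<Sum>\<sigma>\<in>UNIV. \<Sum>\<sigma>'\<in>UNIV. (t - s) * (P s \<sigma> \<sigma>' * dxi P s \<sigma> \<sigma>' * h s e \<sigma>' * h s (prod.swap e) \<sigma>)
         + P s \<sigma>' \<sigma> * h s (prod.swap e) \<sigma> * (h t e \<sigma>' - h s e \<sigma>'))"
    unfolding Lu_def sum_distrib_left by (intro sum.cong refl) (simp add: P_sym[of s] algebra_simps)
  also have "\<dots> = (t - s) * (\<Sum>\<sigma>\<in>UNIV. \<Sum>\<sigma>'\<in>UNIV. P s \<sigma> \<sigma>' * dxi P s \<sigma> \<sigma>' * h s e \<sigma>' * h s (prod.swap e) \<sigma>)
      + (\<Sum>\<sigma>\<in>UNIV. \<Sum>\<sigma>'\<in>UNIV. P s \<sigma>' \<sigma> * h s (prod.swap e) \<sigma> * (h t e \<sigma>' - h s e \<sigma>'))"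
    by (simp only: sum.distrib sum_distrib_left)
  also have "(\<Sum>\<sigma>\<in>UNIV. \<Sum>\<sigma>'\<in>UNIV. P s \<sigma>' \<sigma> * h s (prod.swap e) \<sigma> * (h t e \<sigma>' - h s e \<sigma>'))
     = (\<Sum>\<sigma>'\<in>UNIV. u s (prod.swap e) \<sigma>' * (h t e \<sigma>' - h s e \<sigma>'))"
    unfolding u_def sum_distrib_right by (rule sum.swap)
  finally show ?thesis by (simp add: q_def Y_def Ze_swap add_divide_distrib)
qed

text \<open>The left-hand side is the formal differential of the Bethe functional. The fixed-point
  equation at the outgoing edges makes vertex and edge terms have the same gradient in the
  incoming messages, which leaves the antisymmetric difference in \<open>Lp\<close>.\<close>

lemma root_increment_eq:
  assumes T: "goodT T" and s: "s \<in> {a..b}" and bp: "\<And>j. j \<in># children T \<Longrightarrow> bp s (edge_out T j)"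
  shows "(\<Sum>\<sigma>\<in>UNIV. rw s T \<sigma> * (dxib Q s \<sigma> * (t - s) + (\<Sum>j\<in>#children T. Lu s t (edge_in T j) \<sigma> / u s (edge_in T j) \<sigma>))) / Zv s T
     - 1/2 * (\<Sum>j\<in>#children T. (\<Sum>\<sigma>\<in>UNIV. Lu s t (edge_in T j) \<sigma> * h s (prod.swap (edge_in T j)) \<sigma>
          + u s (edge_in T j) \<sigma> * (h t (prod.swap (edge_in T j)) \<sigma> - h s (prod.swap (edge_in T j)) \<sigma>)) / Ze s (edge_in T j))
     = Lp s t T" (is "?Lv / _ - 1/2 * ?Le = _")
proof -
  let ?A = "\<lambda>j. (t - s) * q s (edge_in T j) + Y s t (edge_out T j)"
  have 1: "(\<Sum>\<sigma>\<in>UNIV. rw s T \<sigma> * (Lu s t (edge_in T j) \<sigma> / u s (edge_in T j) \<sigma>)) / Zv s T = ?A j"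
    if j: "j \<in># children T" for j
  proof -
    let ?e = "edge_in T j"
    have e: "good ?e" using T j by (simp add: goodT_def)
    have rw: "rw s T \<sigma> = u s ?e \<sigma> * (nrm s (prod.swap ?e) * h s (prod.swap ?e) \<sigma>)" for \<sigma>
      using bpw_identity[OF j, of s \<sigma>] bp_bpw(2)[OF bp[OF j]] by (simp add: edge_out_eq_swap)
    have nz: "nrm s (prod.swap ?e) \<noteq> 0" using bp_bpw(1)[OF bp[OF j]] by (simp add: edge_out_eq_swap)
    \<comment> \<open>The root weights split across the edge to \<open>j\<close>, so
      \<open>Zv\<close> is \<open>Ze\<close> up to the normaliser of the outgoing message, and this
      normaliser cancels in the quotient.\<close>
    have Zv: "Zv s T = nrm s (prod.swap ?e) * Ze s ?e"
      unfolding Zv_def rw Ze_def sum_distrib_left by (simp add: mult_ac)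
    have "(\<Sum>\<sigma>\<in>UNIV. rw s T \<sigma> * (Lu s t ?e \<sigma> / u s ?e \<sigma>)) = nrm s (prod.swap ?e) * (\<Sum>\<sigma>\<in>UNIV. h s (prod.swap ?e) \<sigma> * Lu s t ?e \<sigma>)"
      unfolding rw sum_distrib_left
    proof (rule sum.cong[OF refl])
      fix \<sigma> :: 'x
      show "u s ?e \<sigma> * (nrm s (prod.swap ?e) * h s (prod.swap ?e) \<sigma>) * (Lu s t ?e \<sigma> / u s ?e \<sigma>)
          = nrm s (prod.swap ?e) * (h s (prod.swap ?e) \<sigma> * Lu s t ?e \<sigma>)"
        using good_u_pos[OF e s, of \<sigma>] by simp
    qed
    then show ?thesis using sum_Lu[of s ?e t] nz by (simp add: Zv edge_out_eq_swap)
  qed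
  have "?Lv / Zv s T = (t - s) * vx s T + (\<Sum>j\<in>#children T. ?A j)"
  proof -
    have "?Lv = (t - s) * (\<Sum>\<sigma>\<in>UNIV. rw s T \<sigma> * dxib Q s \<sigma>)
       + (\<Sum>\<sigma>\<in>UNIV. rw s T \<sigma> * (\<Sum>j\<in>#children T. Lu s t (edge_in T j) \<sigma> / u s (edge_in T j) \<sigma>))"
      unfolding distrib_left sum.distrib sum_distrib_left by (simp add: mult_ac)
    also have "(\<Sum>\<sigma>\<in>UNIV. rw s T \<sigma> * (\<Sum>j\<in>#children T. Lu s t (edge_in T j) \<sigma> / u s (edge_in T j) \<sigma>))
       = (\<Sum>j\<in>#children T. \<Sum>\<sigma>\<in>UNIV. rw s T \<sigma> * (Lu s t (edge_in T j) \<sigma> / u s (edge_in T j) \<sigma>))"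
      by (rule sum_mult_sum_mset)
    finally have "?Lv / Zv s T = (t - s) * vx s T + inverse (Zv s T) * (\<Sum>j\<in>#children T. \<Sum>\<sigma>\<in>UNIV. rw s T \<sigma> * (Lu s t (edge_in T j) \<sigma> / u s (edge_in T j) \<sigma>))"
      by (simp add: vx_def divide_inverse distrib_left mult_ac)
    also have "inverse (Zv s T) * (\<Sum>j\<in>#children T. \<Sum>\<sigma>\<in>UNIV. rw s T \<sigma> * (Lu s t (edge_in T j) \<sigma> / u s (edge_in T j) \<sigma>))
      = (\<Sum>j\<in>#children T. ?A j)"
      unfolding sum_mset_mult_left[symmetric]
    proof (intro arg_cong[where f = sum_mset] image_mset_cong)
      fix j assume j: "j \<in># children T"
      show "inverse (Zv s T) * (\<Sum>\<sigma>\<in>UNIV. rw s T \<sigma> * (Lu s t (edge_in T j) \<sigma> / u s (edge_in T j) \<sigma>)) = ?A j"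
        unfolding 1[OF j, symmetric] by (simp add: divide_inverse mult.commute)
    qed
    finally show ?thesis .
  qed
  \<comment> \<open>In the edge term both messages move, whence the additional \<open>Y\<close> of
    the incoming edge; in the vertex term only incoming messages move.\<close>
  moreover have "?Le = (\<Sum>j\<in>#children T. ?A j + Y s t (edge_in T j))"
  proof (intro arg_cong[where f = sum_mset] image_mset_cong)
    fix j
    have "(\<Sum>\<sigma>\<in>UNIV. Lu s t (edge_in T j) \<sigma> * h s (prod.swap (edge_in T j)) \<sigma>) / Ze s (edge_in T j) = ?A j"
      using sum_Lu[of s "edge_in T j" t] by (simp add: edge_out_eq_swap mult.commute)
    then show "(\<Sum>\<sigma>\<in>UNIV. Lu s t (edge_in T j) \<sigma> * h s (prod.swap (edge_in T j)) \<sigma>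
          + u s (edge_in T j) \<sigma> * (h t (prod.swap (edge_in T j)) \<sigma> - h s (prod.swap (edge_in T j)) \<sigma>)) / Ze s (edge_in T j)
        = ?A j + Y s t (edge_in T j)"
      by (simp add: sum.distrib add_divide_distrib Y_def)
  qed
  ultimately have "?Lv / Zv s T - 1/2 * ?Le = (t - s) * vx s T + 1/2 * (\<Sum>j\<in>#children T. ?A j) - 1/2 * (\<Sum>j\<in>#children T. Y s t (edge_in T j))"
    unfolding sum_mset.distrib[of ?A] by argo
  also have "\<dots> = Lp s t T"
    unfolding Lp_def sum_mset.distrib sum_mset_mult_left by argo
  finally show ?thesis .
qed

definition variation :: "dtree \<Rightarrow> real \<Rightarrow> real" where
  "variation e t = (\<Sum>s\<in>UNIV. real_of_ereal (tv (\<lambda>t. h t e s) a t))"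

lemma variation_increment:
  assumes "good e" "a \<le> s" "s \<le> t" "t \<le> b"
  shows "\<bar>h t e \<sigma> - h s e \<sigma>\<bar> \<le> variation e t - variation e s" "0 \<le> variation e t - variation e s"
proof -
  let ?v = "\<lambda>\<sigma> t. real_of_ereal (tv (\<lambda>t. h t e \<sigma>) a t)"
  have inc: "\<bar>h t e \<sigma> - h s e \<sigma>\<bar> \<le> ?v \<sigma> t - ?v \<sigma> s" for \<sigma>
    by (rule real_tv_increment(1)[where b = b and C = C]) (use assms in \<open>auto simp: good_def\<close>)
  have nn: "0 \<le> ?v \<sigma> t - ?v \<sigma> s" for \<sigma> using inc[of \<sigma>] by simp
  have eq: "variation e t - variation e s = (\<Sum>\<sigma>\<in>UNIV. ?v \<sigma> t - ?v \<sigma> s)"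
    by (simp add: variation_def sum_subtractf)
  have "?v \<sigma> t - ?v \<sigma> s \<le> (\<Sum>\<sigma>\<in>UNIV. ?v \<sigma> t - ?v \<sigma> s)"
    by (rule member_le_sum) (auto intro: nn[simplified])
  then show "\<bar>h t e \<sigma> - h s e \<sigma>\<bar> \<le> variation e t - variation e s"
    unfolding eq using inc[of \<sigma>] by linarith
  show "0 \<le> variation e t - variation e s" unfolding eq by (rule sum_nonneg) (rule nn)
qed

text \<open>Control for all that moves at the root: the parameter itself and the messages on both
  orientations of each edge. It depends on the tree, which is harmless because the expansion is
  taken tree by tree.\<close>

definition W :: "utree \<Rightarrow> real \<Rightarrow> real" where
  "W T t = t + (\<Sum>j\<in>#children T. variation (edge_in T j) t + variation (edge_out T j) t)"

lemma W_increment: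
  assumes T: "goodT T" and st: "a \<le> s" "s \<le> t" "t \<le> b"
  shows "t - s \<le> W T t - W T s"
    and "j \<in># children T \<Longrightarrow> \<bar>h t (edge_in T j) \<sigma> - h s (edge_in T j) \<sigma>\<bar> \<le> W T t - W T s"
    and "j \<in># children T \<Longrightarrow> \<bar>h t (edge_out T j) \<sigma> - h s (edge_out T j) \<sigma>\<bar> \<le> W T t - W T s"
proof -
  let ?i = "\<lambda>j. variation (edge_in T j) t - variation (edge_in T j) s"
  let ?o = "\<lambda>j. variation (edge_out T j) t - variation (edge_out T j) s"
  have nn: "0 \<le> ?i j" "0 \<le> ?o j" if "j \<in># children T" for j
    using T that st by (auto simp: goodT_def intro!: variation_increment(2)[simplified])
  have eq: "W T t - W T s = (t - s) + (\<Sum>j\<in>#children T. ?i j + ?o j)"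
    by (simp add: W_def sum_mset.distrib sum_mset_diff)
  have "(\<Sum>j\<in>#children T. 0) \<le> (\<Sum>j\<in>#children T. ?i j + ?o j)"
    by (rule sum_mset_mono_real) (use nn in \<open>auto intro: add_nonneg_nonneg\<close>)
  then show "t - s \<le> W T t - W T s" by (simp add: eq)
  have le: "?i j + ?o j \<le> W T t - W T s" if j: "j \<in># children T" for j
  proof -
    obtain N where N: "children T = add_mset j N" using j by (metis multi_member_split)
    have "(\<Sum>j\<in>#N. 0) \<le> (\<Sum>j\<in>#N. ?i j + ?o j)"
      by (rule sum_mset_mono_real) (use nn N in \<open>auto intro: add_nonneg_nonneg\<close>)
    then show ?thesis unfolding eq N using st by simp
  qed
  show "\<bar>h t (edge_in T j) \<sigma> - h s (edge_in T j) \<sigma>\<bar> \<le> W T t - W T s"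
       "\<bar>h t (edge_out T j) \<sigma> - h s (edge_out T j) \<sigma>\<bar> \<le> W T t - W T s" if j: "j \<in># children T"
    using le[OF j] nn[OF j] T j st
      variation_increment(1)[of "edge_in T j" s t \<sigma>] variation_increment(1)[of "edge_out T j" s t \<sigma>]
    by (auto simp: goodT_def intro: order_trans)
qed

lemma P_continuous: "continuous_on S (\<lambda>t. P t s s')"
  using P_deriv by (meson DERIV_isCont continuous_at_imp_continuous_on)

lemma bv_control_W: "goodT T \<Longrightarrow> bv_control a b (W T)"
  by unfold_locales (use a_less_b W_increment(1) in auto)

context
  fixes T assumes T: "goodT T"
begin

interpretation bv_control a b "W T" using T by (rule bv_control_W)

lemma appr_h:
  assumes "j \<in># children T"
  shows "appr (\<lambda>t. h t (edge_in T j) \<sigma>) (\<lambda>s t. h t (edge_in T j) \<sigma> - h s (edge_in T j) \<sigma>)"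
    and "appr (\<lambda>t. h t (prod.swap (edge_in T j)) \<sigma>) (\<lambda>s t. h t (prod.swap (edge_in T j)) \<sigma> - h s (prod.swap (edge_in T j)) \<sigma>)"
  using assms T W_increment(2,3)[OF T _ _ _ assms]
  by (auto intro!: appr_path simp: goodT_def good_def edge_out_eq_swap)

lemma appr_u:
  assumes "j \<in># children T"
  shows "appr (\<lambda>t. u t (edge_in T j) \<sigma>) (\<lambda>s t. Lu s t (edge_in T j) \<sigma>)"
  unfolding u_def Lu_def
proof (rule appr_sum)
  fix \<sigma>' :: 'x
  show "appr (\<lambda>t. P t \<sigma> \<sigma>' * h t (edge_in T j) \<sigma>')
     (\<lambda>s t. P s \<sigma> \<sigma>' * dxi P s \<sigma> \<sigma>' * (t - s) * h s (edge_in T j) \<sigma>' + P s \<sigma> \<sigma>' * (h t (edge_in T j) \<sigma>' - h s (edge_in T j) \<sigma>'))"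
    by (rule appr_mult[OF appr_C1 appr_h(1)[OF assms]])
       (auto intro!: P_deriv continuous_intros P_continuous dxi_continuous)
qed

lemma appr_Ze:
  assumes j: "j \<in># children T"
  shows "appr (\<lambda>t. Ze t (edge_in T j)) (\<lambda>s t. \<Sum>\<sigma>\<in>UNIV. Lu s t (edge_in T j) \<sigma> * h s (prod.swap (edge_in T j)) \<sigma>
          + u s (edge_in T j) \<sigma> * (h t (prod.swap (edge_in T j)) \<sigma> - h s (prod.swap (edge_in T j)) \<sigma>))"
  unfolding Ze_def by (intro appr_sum appr_mult appr_u appr_h j)

text \<open>As the exponential of a sum, the product over the children falls under the rules of
  \<open>appr\<close> for sums and compositions. The logarithms are legitimate because
  \<open>u\<close> is positive on good edges.\<close>

lemma rw_exp:
  assumes "t \<in> {a..b}"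
  shows "rw t T \<sigma> = exp (ln (Q t \<sigma>) + (\<Sum>j\<in>#children T. ln (u t (edge_in T j) \<sigma>)))"
proof -
  have "0 < Q t \<sigma>" using Q_ge[OF assms, of \<sigma>] \<kappa>_pos by linarith
  moreover have "(\<Prod>j\<in>#children T. u t (edge_in T j) \<sigma>) = exp (\<Sum>j\<in>#children T. ln (u t (edge_in T j) \<sigma>))"
    by (rule prod_mset_exp_sum_ln) (use T assms in \<open>auto simp: goodT_def good_u_pos\<close>)
  ultimately show ?thesis by (simp add: rw_eq exp_add)
qed

lemma appr_rw_exp:
  "appr (\<lambda>t. exp (ln (Q t \<sigma>) + (\<Sum>j\<in>#children T. ln (u t (edge_in T j) \<sigma>))))
     (\<lambda>s t. exp (ln (Q s \<sigma>) + (\<Sum>j\<in>#children T. ln (u s (edge_in T j) \<sigma>)))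
        * (dxib Q s \<sigma> * (t - s) + (\<Sum>j\<in>#children T. Lu s t (edge_in T j) \<sigma> / u s (edge_in T j) \<sigma>)))"
  by (intro appr_exp appr_add appr_sum_mset appr_ln appr_u appr_C1 Q_deriv dxib_continuous good_u_pos)
     (use T in \<open>auto simp: goodT_def\<close>)

lemma rw_continuous: "continuous_on {a..b} (\<lambda>t. rw t T \<sigma>)"
  using apprD(1)[OF appr_rw_exp[of \<sigma>]] rw_exp by (subst continuous_on_cong[OF refl]) auto

lemma integrand_continuous:
  "continuous_on {a..b} (\<lambda>t. vx t T + 1/2 * (\<Sum>j\<in>#children T. q t (edge_in T j)))"
proof -
  have q: "continuous_on {a..b} (\<lambda>t. q t (edge_in T j))" if j: "j \<in># children T" for j
    unfolding q_def
    by (intro continuous_intros P_continuous dxi_continuous apprD(1)[OF appr_h(1)[OF j]]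
        apprD(1)[OF appr_h(2)[OF j]] apprD(1)[OF appr_Ze[OF j]]) (use Ze_good(1)[OF T j] in force)
  have "continuous_on {a..b} (\<lambda>t. \<Sum>j\<in>#N. q t (edge_in T j))" if "N \<subseteq># children T" for N
    using that
  proof (induction N)
    case (add j N)
    then have "j \<in># children T" "N \<subseteq># children T" by (auto dest: mset_subset_eq_insertD intro: subset_mset.less_imp_le)
    with add show ?case by (auto intro!: continuous_intros q)
  qed auto
  moreover have "continuous_on {a..b} (\<lambda>t. vx t T)"
    unfolding vx_def Zv_def
  proof (intro continuous_intros rw_continuous dxib_continuous ballI)
    fix t assume "t \<in> {a..b}"
    then show "(\<Sum>s\<in>UNIV. rw t T s) \<noteq> 0" using Zv_pos[of t T] by (simp add: Zv_def)
  qed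
  ultimately show ?thesis by (intro continuous_intros) auto
qed

lemma PhiT_increment_limit:
  "(\<lambda>N. PhiT P Q (\<lambda>_. h) b b T - PhiT P Q (\<lambda>_. h) a a T
      - (\<Sum>k<N. Lp (grid a b N k) (grid a b N (Suc k)) T)) \<longlonglongrightarrow> 0"
proof -
  let ?rw = "\<lambda>t \<sigma>. exp (ln (Q t \<sigma>) + (\<Sum>j\<in>#children T. ln (u t (edge_in T j) \<sigma>)))"
  let ?L = "\<lambda>s t. (\<Sum>\<sigma>\<in>UNIV. ?rw s \<sigma> * (dxib Q s \<sigma> * (t - s) + (\<Sum>j\<in>#children T. Lu s t (edge_in T j) \<sigma> / u s (edge_in T j) \<sigma>))) / (\<Sum>\<sigma>\<in>UNIV. ?rw s \<sigma>)
     - 1/2 * (\<Sum>j\<in>#children T. (\<Sum>\<sigma>\<in>UNIV. Lu s t (edge_in T j) \<sigma> * h s (prod.swap (edge_in T j)) \<sigma>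
          + u s (edge_in T j) \<sigma> * (h t (prod.swap (edge_in T j)) \<sigma> - h s (prod.swap (edge_in T j)) \<sigma>)) / Ze s (edge_in T j))"
  let ?f = "\<lambda>t. ln (\<Sum>\<sigma>\<in>UNIV. ?rw t \<sigma>) - 1/2 * (\<Sum>j\<in>#children T. ln (Ze t (edge_in T j)))"
  have appr: "appr ?f ?L"
    by (intro appr_diff appr_cmult appr_ln appr_sum appr_sum_mset appr_rw_exp appr_Ze Ze_good(1)[OF T])
       (auto intro!: sum_pos)
  have f: "?f t = PhiT P Q (\<lambda>_. h) t t T" if "t \<in> {a..b}" for t
    using that by (simp add: PhiT_eq Zv_def rw_exp)
  \<comment> \<open>The expansion is available from every left endpoint, but its closed form
    \<open>Lp\<close> is derived from the BP equation at that endpoint, which a good tree grants at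
    grid points.\<close>
  have L: "?L (grid a b N k) t = Lp (grid a b N k) t T" if "k \<le> N" for N k t
  proof -
    have m: "grid a b N k \<in> {a..b}" using grid_bounds[OF a_less_b that] by simp
    show ?thesis
      unfolding rw_exp[OF m, symmetric] Zv_def[symmetric]
      by (rule root_increment_eq[OF T m]) (use T that in \<open>auto simp: goodT_def good_def\<close>)
  qed
  have ab: "a \<in> {a..b}" "b \<in> {a..b}" using a_less_b by auto
  have "(\<lambda>N. PhiT P Q (\<lambda>_. h) b b T - PhiT P Q (\<lambda>_. h) a a T - (\<Sum>k<N. ?L (grid a b N k) (grid a b N (Suc k)))) \<longlonglongrightarrow> 0"
    using appr_grid_sum[OF appr] unfolding f[OF ab(1)] f[OF ab(2)] .
  moreover have "(\<Sum>k<N. ?L (grid a b N k) (grid a b N (Suc k))) = (\<Sum>k<N. Lp (grid a b N k) (grid a b N (Suc k)) T)" for N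
    by (intro sum.cong refl L) auto
  ultimately show ?thesis by (simp only:)
qed

end

end

section \<open>Riemann sums of a continuous function\<close>

text \<open>Convergence of Riemann sums is the case of the Stieltjes calculus in which the control
  is the identity and the path is the indefinite integral.\<close>

lemma continuous_grid_sum_limit:
  fixes \<alpha> :: "real \<Rightarrow> real"
  assumes "a < b" and cont: "continuous_on {a..b} \<alpha>"
  shows "(\<lambda>N. \<Sum>k<N. (grid a b N (Suc k) - grid a b N k) * \<alpha> (grid a b N k)) \<longlonglongrightarrow> integral {a..b} \<alpha>"
proof -
  interpret bv_control a b "\<lambda>t. t" by unfold_locales (use assms in auto)
  let ?f = "\<lambda>t. integral {a..t} \<alpha>"
  have int: "\<alpha> integrable_on {s..t}" if "a \<le> s" "t \<le> b" for s t
    using that by (intro integrable_continuous_interval continuous_on_subset[OF cont]) auto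
  have diff: "?f t - ?f s = integral {s..t} \<alpha>" if "a \<le> s" "s \<le> t" "t \<le> b" for s t
    using Henstock_Kurzweil_Integration.integral_combine[of a s t \<alpha>] int[of a t] that by simp
  have "bounded (\<alpha> ` {a..b})" using cont by (intro compact_imp_bounded compact_continuous_image) auto
  then obtain K where K: "K > 0" "\<And>x. x \<in> {a..b} \<Longrightarrow> \<bar>\<alpha> x\<bar> \<le> K" unfolding bounded_pos by auto
  have "appr ?f (\<lambda>s t. (t - s) * \<alpha> s)"
  proof (rule apprI[where C = K])
    show "0 \<le> K" using K(1) by simp
    show "continuous_on {a..b} ?f" by (rule indefinite_integral_continuous_1[OF int]) auto
    fix s t assume st: "a \<le> s" "s \<le> t" "t \<le> b"
    have "norm (integral {s..t} \<alpha>) \<le> K * (t - s)"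
      by (rule integral_bound) (use st K continuous_on_subset[OF cont] in \<open>auto simp: subset_iff\<close>)
    then show "\<bar>?f t - ?f s\<bar> \<le> K * (t - s)" using diff[OF st] by simp
  next
    fix \<epsilon> :: real assume "\<epsilon> > 0"
    have "uniformly_continuous_on {a..b} \<alpha>" using cont by (intro compact_uniformly_continuous) auto
    then obtain \<delta> where \<delta>: "\<delta> > 0" "\<And>s t. s \<in> {a..b} \<Longrightarrow> t \<in> {a..b} \<Longrightarrow> \<bar>t - s\<bar> < \<delta> \<Longrightarrow> \<bar>\<alpha> t - \<alpha> s\<bar> < \<epsilon>"
      using \<open>\<epsilon> > 0\<close> unfolding uniformly_continuous_on_def dist_real_def by metis
    show "\<exists>\<delta>>0. \<forall>s t. a \<le> s \<and> s \<le> t \<and> t \<le> b \<and> t - s < \<delta> \<longrightarrow> \<bar>?f t - ?f s - (t - s) * \<alpha> s\<bar> \<le> \<epsilon> * (t - s)"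
    proof (intro exI[of _ \<delta>] conjI allI impI; (elim conjE)?)
      fix s t assume st: "a \<le> s" "s \<le> t" "t \<le> b" "t - s < \<delta>"
      have "norm (integral {s..t} (\<lambda>x. \<alpha> x - \<alpha> s)) \<le> \<epsilon> * (t - s)"
      proof (rule integral_bound)
        show "continuous_on {s..t} (\<lambda>x. \<alpha> x - \<alpha> s)"
          using st by (intro continuous_intros continuous_on_subset[OF cont]) auto
        fix x assume "x \<in> {s..t}"
        then show "norm (\<alpha> x - \<alpha> s) \<le> \<epsilon>" using st \<delta>(2)[of s x] by (auto intro!: less_imp_le)
      qed (use st in auto)
      moreover have "integral {s..t} (\<lambda>x. \<alpha> x - \<alpha> s) = integral {s..t} \<alpha> - (t - s) * \<alpha> s"
        using st int[of s t] by (subst Henstock_Kurzweil_Integration.integral_diff) auto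
      ultimately show "\<bar>?f t - ?f s - (t - s) * \<alpha> s\<bar> \<le> \<epsilon> * (t - s)" using diff[OF st(1-3)] by simp
    qed (use \<delta> in auto)
  qed
  from appr_grid_sum[OF this]
  have "(\<lambda>N. integral {a..b} \<alpha> - (\<Sum>k<N. (grid a b N (Suc k) - grid a b N k) * \<alpha> (grid a b N k))) \<longlonglongrightarrow> 0" by simp
  from tendsto_diff[OF tendsto_const[of "integral {a..b} \<alpha>"] this] show ?thesis by simp
qed

context bethe begin

subsection \<open>Expectations\<close>

lemma u_measurable [measurable]: "(\<lambda>e. u t e s) \<in> borel_measurable dtreeM"
  unfolding u_def by measurable

lemma h_swap_measurable [measurable]: "(\<lambda>e. h t (prod.swap e) s) \<in> borel_measurable dtreeM"
  by (rule measurable_compose[OF measurable_swap_dtreeM h_measurable])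

lemma Ze_measurable [measurable]: "(\<lambda>e. Ze t e) \<in> borel_measurable dtreeM"
  unfolding Ze_def by measurable

lemma q_measurable [measurable]: "(\<lambda>e. q t e) \<in> borel_measurable dtreeM"
  unfolding q_def by measurable

lemma Y_measurable [measurable]: "(\<lambda>e. Y s t e) \<in> borel_measurable dtreeM"
  unfolding Y_def by measurable

lemma Y_swap_measurable [measurable]: "(\<lambda>e. Y s t (prod.swap e)) \<in> borel_measurable dtreeM"
  by (rule measurable_compose[OF measurable_swap_dtreeM Y_measurable])

lemma rw_measurable [measurable]: "(\<lambda>T. rw t T s) \<in> borel_measurable utreeM"
proof -
  have [measurable]: "(\<lambda>T. \<Prod>j\<in>#children T. u t (edge_in T j) s) \<in> borel_measurable utreeM"
    by (rule measurable_prod_children_root) (auto simp: u_nonneg)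
  show ?thesis unfolding rw_eq by measurable
qed

lemma Zv_measurable [measurable]: "(\<lambda>T. Zv t T) \<in> borel_measurable utreeM"
  unfolding Zv_def by measurable

lemma vx_measurable [measurable]: "(\<lambda>T. vx t T) \<in> borel_measurable utreeM"
  unfolding vx_def by measurable

lemma PhiT_measurable [measurable]: "(\<lambda>T. PhiT P Q (\<lambda>_. h) t t T) \<in> borel_measurable utreeM"
  unfolding PhiT_eq by measurable

lemma Lp_measurable [measurable]: "(\<lambda>T. Lp s t T) \<in> borel_measurable utreeM"
  unfolding Lp_def edge_out_eq_swap by measurable

lemma bpw_measurable [measurable]: "(\<lambda>e. bpw t e s) \<in> borel_measurable dtreeM"
proof -
  \<comment> \<open>Sends the edge from a branch \<open>v\<close> to the rest of the tree at
    \<open>x\<close>, together with the branch beyond \<open>x\<close>, to the same edge with that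
    branch attached again.\<close>
  have [measurable]: "(\<lambda>z. (fst (fst z), Node (add_mset (snd z) (children (snd (fst z)))))) \<in> dtreeM \<Otimes>\<^sub>M utreeM \<rightarrow>\<^sub>M dtreeM"
  proof -
    have "(\<lambda>z. case (snd (fst z), snd z) of (A, B) \<Rightarrow> Node (add_mset B (children A))) \<in> dtreeM \<Otimes>\<^sub>M utreeM \<rightarrow>\<^sub>M utreeM"
      unfolding dtreeM_def by (rule measurable_compose[OF _ measurable_attach]) measurable
    then show ?thesis unfolding dtreeM_def by (intro measurable_Pair) (simp_all add: case_prod_beta)
  qed
  have "(\<lambda>x. \<Prod>v\<in>#children (fst x). (\<lambda>z. u t (fst (fst z), Node (add_mset (snd z) (children (snd (fst z))))) s) (edge_in (fst x) v, snd x))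
     \<in> borel_measurable (utreeM \<Otimes>\<^sub>M utreeM)"
    by (rule measurable_prod_children)
       (rule measurable_compose[of "\<lambda>z. (fst (fst z), Node (add_mset (snd z) (children (snd (fst z)))))" _ dtreeM], measurable, simp add: u_nonneg)
  then have [measurable]: "(\<lambda>x. \<Prod>v\<in>#children (fst x). u t (v, Node (children (fst x) - {#v#} + {#snd x#})) s) \<in> borel_measurable dtreeM"
    unfolding dtreeM_def edge_in_def by simp
  have "bpw t e s = Q t s * (\<Prod>v\<in>#children (fst e). u t (v, Node (children (fst e) - {#v#} + {#snd e#})) s)" for e
    by (simp add: bpu_def u_def)
  then show ?thesis by (simp only:) measurable
qed

lemma integrable_deg: "integrable \<mu> (\<lambda>T. real (deg T))"
  using \<mu>_H2 by (intro integrableI_nonneg) (auto simp: H2_def)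

lemma integrable_deg_M: "integrable \<mu> (\<lambda>T. real (deg T) * M (deg T))"
proof (cases "\<forall>t s s'. P t s s' > 0")
  case True
  show ?thesis unfolding M_def if_P[OF True] by (intro integrable_mult_left integrable_deg)
next
  case False
  \<comment> \<open>With this choice \<open>exp (c * d)\<close> equals \<open>exp d / r^d\<close> at
    degree \<open>d\<close>: the power of \<open>r\<close> is the one in \<open>M\<close>, and
    \<open>exp d\<close> absorbs the factor \<open>d\<close>.\<close>
  define c where "c = 1 - ln r"
  have fin: "(\<integral>\<^sup>+ T. ennreal (exp (c * real (deg T))) \<partial>\<mu>) < \<infinity>"
    using \<mu>_H2 False unfolding H2_def by blast
  have "integrable \<mu> (\<lambda>T. 1 / \<kappa> * exp (c * real (deg T)))"
    using fin by (intro integrable_mult_right integrableI_nonneg) auto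
  then show ?thesis
  proof (rule Bochner_Integration.integrable_bound)
    show "AE T in \<mu>. norm (real (deg T) * M (deg T)) \<le> norm (1 / \<kappa> * exp (c * real (deg T)))"
    proof (rule AE_I2)
      fix T
      have "exp (c * real (deg T)) = exp (real (deg T)) / r ^ deg T"
        using r_pos exp_of_nat_mult[of "deg T" "ln r"]
        by (simp add: c_def left_diff_distrib exp_diff mult.commute[of "ln r"])
      moreover have "real (deg T) \<le> exp (real (deg T))"
        using exp_ge_add_one_self[of "real (deg T)"] by linarith
      ultimately show "norm (real (deg T) * M (deg T)) \<le> norm (1 / \<kappa> * exp (c * real (deg T)))"
        unfolding M_def if_not_P[OF False] using \<kappa>_pos r_pos by (simp add: field_simps)
    qed
  qed measurable
qed

lemma Y_le:
  assumes s: "s \<in> {a..b}" and "0 < Ze s e" "1 / Ze s e \<le> m"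
  shows "\<bar>Y s t e\<bar> \<le> K * m * (\<Sum>\<sigma>\<in>UNIV. \<bar>h t (prod.swap e) \<sigma> - h s (prod.swap e) \<sigma>\<bar>)"
proof -
  let ?d = "\<lambda>\<sigma>. h t (prod.swap e) \<sigma> - h s (prod.swap e) \<sigma>"
  have "\<bar>\<Sum>\<sigma>\<in>UNIV. u s e \<sigma> * ?d \<sigma>\<bar> \<le> (\<Sum>\<sigma>\<in>UNIV. K * \<bar>?d \<sigma>\<bar>)"
    by (intro sum_abs[THEN order_trans] sum_mono)
       (auto simp: abs_mult abs_of_nonneg[OF u_nonneg] intro!: mult_right_mono u_le s)
  then have "\<bar>Y s t e\<bar> \<le> (\<Sum>\<sigma>\<in>UNIV. K * \<bar>?d \<sigma>\<bar>) * (1 / Ze s e)"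
    using assms(2) unfolding Y_def by (simp add: abs_divide divide_right_mono)
  also have "\<dots> \<le> (\<Sum>\<sigma>\<in>UNIV. K * \<bar>?d \<sigma>\<bar>) * m"
    using assms(3) K_ge_1 by (intro mult_left_mono sum_nonneg) auto
  finally show ?thesis by (simp add: sum_distrib_left mult_ac flip: sum_distrib_right)
qed

lemma Y_le_const:
  assumes T: "goodT T" "j \<in># children T" and s: "s \<in> {a..b}"
  shows "\<bar>Y s t (edge_in T j)\<bar> \<le> K * M (deg T) * real CARD('x)"
    and "\<bar>Y s t (edge_out T j)\<bar> \<le> K * M (deg T) * real CARD('x)"
proof -
  have "(\<Sum>\<sigma>\<in>UNIV. \<bar>h t e \<sigma> - h s e \<sigma>\<bar>) \<le> (\<Sum>\<sigma>\<in>(UNIV::'x set). 1)" for e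
  proof (rule sum_mono)
    fix \<sigma>
    show "\<bar>h t e \<sigma> - h s e \<sigma>\<bar> \<le> 1"
      using h_nonneg[of t e \<sigma>] h_nonneg[of s e \<sigma>] h_le_1[of t e \<sigma>] h_le_1[of s e \<sigma>]
      unfolding abs_le_iff by linarith
  qed
  then have le: "K * M (deg T) * (\<Sum>\<sigma>\<in>UNIV. \<bar>h t e \<sigma> - h s e \<sigma>\<bar>) \<le> K * M (deg T) * real CARD('x)" for e
    using K_ge_1 M_pos[of "deg T"] by (intro mult_left_mono) (auto intro: mult_nonneg_nonneg)
  show "\<bar>Y s t (edge_in T j)\<bar> \<le> K * M (deg T) * real CARD('x)"
    by (rule order_trans[OF Y_le le]) (use Ze_good[OF T s] s in auto)
  show "\<bar>Y s t (edge_out T j)\<bar> \<le> K * M (deg T) * real CARD('x)"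
    by (rule order_trans[OF Y_le le]) (use Ze_good[OF T s] s in \<open>auto simp: edge_out_eq_swap Ze_swap\<close>)
qed

text \<open>The bound does not depend on \<open>N\<close>, and on the tree only through its degree,
  because the variation of a message is bounded by the deterministic \<open>C\<close> of (H3). It
  feeds the dominating function for the sums over grids.\<close>

lemma sum_grid_Y_le:
  assumes T: "goodT T" and j: "j \<in># children T" and e: "e = edge_in T j \<or> e = edge_out T j"
  shows "(\<Sum>k<N. \<bar>Y (grid a b N k) (grid a b N (Suc k)) e\<bar>) \<le> K * M (deg T) * (real CARD('x) * C)"
proof -
  let ?g = "grid a b N"
  have Ze: "0 < Ze s e" "1 / Ze s e \<le> M (deg T)" if "s \<in> {a..b}" for s
    using e Ze_good[OF T j that] by (auto simp: edge_out_eq_swap Ze_swap)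
  have good: "good (prod.swap e)" using T j e by (auto simp: goodT_def edge_out_eq_swap)
  have "(\<Sum>k<N. \<bar>Y (?g k) (?g (Suc k)) e\<bar>) \<le> (\<Sum>k<N. K * M (deg T) * (\<Sum>\<sigma>\<in>UNIV. \<bar>h (?g (Suc k)) (prod.swap e) \<sigma> - h (?g k) (prod.swap e) \<sigma>\<bar>))"
  proof (rule sum_mono)
    fix k assume "k \<in> {..<N}"
    then have "?g k \<in> {a..b}" using grid_bounds[OF a_less_b, of k N] by auto
    then show "\<bar>Y (?g k) (?g (Suc k)) e\<bar> \<le> K * M (deg T) * (\<Sum>\<sigma>\<in>UNIV. \<bar>h (?g (Suc k)) (prod.swap e) \<sigma> - h (?g k) (prod.swap e) \<sigma>\<bar>)"
      by (intro Y_le Ze)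
  qed
  also have "\<dots> = K * M (deg T) * (\<Sum>\<sigma>\<in>UNIV. \<Sum>k<N. \<bar>h (?g (Suc k)) (prod.swap e) \<sigma> - h (?g k) (prod.swap e) \<sigma>\<bar>)"
    unfolding sum_distrib_left[symmetric] by (subst sum.swap) simp
  also have "\<dots> \<le> K * M (deg T) * (\<Sum>\<sigma>\<in>(UNIV :: 'x set). C)"
    using good K_ge_1 M_pos[of "deg T"]
    by (intro mult_left_mono sum_mono sum_grid_le_tv a_less_b) (auto simp: good_def)
  finally show ?thesis by simp
qed

text \<open>Envelope for \<open>PhiT\<close>: the first summand dominates \<open>ln Zv\<close>
  through \<open>Zv_ge\<close> and \<open>Zv_le\<close>, the second dominates the edge logarithms
  through \<open>abs_ln_le\<close>.\<close>

definition env :: "utree \<Rightarrow> real" where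
  "env T = (\<bar>ln \<kappa>\<bar> + ln K + ln (real CARD('x))) * (1 + real (deg T)) + real (deg T) * (K + M (deg T))"

lemma integrable_env: "integrable \<mu> env"
proof -
  have "integrable \<mu> (\<lambda>T. (\<bar>ln \<kappa>\<bar> + ln K + ln (real CARD('x))) * (1 + real (deg T)) + (real (deg T) * K + real (deg T) * M (deg T)))"
    by (intro Bochner_Integration.integrable_add integrable_mult_right integrable_mult_left
        integrable_deg integrable_deg_M integrable_const)
  then show ?thesis by (simp add: env_def[abs_def] distrib_left)
qed

lemma PhiT_le_env:
  assumes T: "goodT T" and t: "t \<in> {a..b}"
  shows "\<bar>PhiT P Q (\<lambda>_. h) t t T\<bar> \<le> env T"
proof -
  let ?d = "real (deg T)"
  have lnK: "0 \<le> ln K" and lnn: "0 \<le> ln (real CARD('x))" and ln\<kappa>: "ln \<kappa> \<le> 0"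
    using K_ge_1 \<kappa>_pos \<kappa>_le_1 by (auto simp: Suc_leI)
  have "ln (\<kappa> ^ Suc (deg T)) \<le> ln (Zv t T)"
    using Zv_ge[OF t, of T] Zv_pos[OF t, of T] \<kappa>_pos by (subst ln_le_cancel_iff) auto
  then have lo: "(1 + ?d) * ln \<kappa> \<le> ln (Zv t T)" using \<kappa>_pos by (simp add: ln_realpow algebra_simps del: power_Suc)
  have "ln (Zv t T) \<le> ln (real CARD('x) * K ^ Suc (deg T))"
    using Zv_le[OF t, of T] Zv_pos[OF t, of T] K_ge_1 by (subst ln_le_cancel_iff) (auto intro!: mult_pos_pos simp: card_gt_0_iff)
  also have "\<dots> = ln (real CARD('x)) + (1 + ?d) * ln K"
    using K_ge_1 by (simp add: ln_mult ln_realpow algebra_simps del: power_Suc)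
  finally have hi: "ln (Zv t T) \<le> ln (real CARD('x)) + (1 + ?d) * ln K" .
  have "\<bar>ln (Zv t T)\<bar> \<le> (\<bar>ln \<kappa>\<bar> + ln K + ln (real CARD('x))) * (1 + ?d)"
  proof -
    have "0 \<le> ?d * ln K" "0 \<le> ?d * ln (real CARD('x))" "?d * ln \<kappa> \<le> 0"
      using lnK lnn ln\<kappa> by (auto intro: mult_nonneg_nonpos)
    moreover have "(\<bar>ln \<kappa>\<bar> + ln K + ln (real CARD('x))) * (1 + ?d)
        = - ln \<kappa> + ln K + ln (real CARD('x)) - ?d * ln \<kappa> + ?d * ln K + ?d * ln (real CARD('x))"
      using ln\<kappa> by (simp add: algebra_simps)
    moreover have "(1 + ?d) * ln \<kappa> = ln \<kappa> + ?d * ln \<kappa>" "(1 + ?d) * ln K = ln K + ?d * ln K"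
      by (simp_all add: algebra_simps)
    ultimately show ?thesis using lo hi lnK lnn ln\<kappa> unfolding abs_le_iff by linarith
  qed
  moreover have "\<bar>\<Sum>j\<in>#children T. ln (Ze t (edge_in T j))\<bar> \<le> ?d * (K + M (deg T))"
    unfolding deg_def
  proof (rule abs_sum_mset_le_size)
    fix j assume j: "j \<in># children T"
    show "\<bar>ln (Ze t (edge_in T j))\<bar> \<le> K + M (size (children T))"
      using abs_ln_le[of "Ze t (edge_in T j)"] Ze_good[OF T j t] Ze_le[OF t, of "edge_in T j"] by (simp add: deg_def)
  qed
  ultimately show ?thesis unfolding PhiT_eq env_def by (simp add: abs_le_iff)
qed

lemma integrable_PhiT:
  assumes "t \<in> {a..b}" shows "integrable \<mu> (\<lambda>T. PhiT P Q (\<lambda>_. h) t t T)"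
proof (rule Bochner_Integration.integrable_bound[OF integrable_env])
  show "AE T in \<mu>. norm (PhiT P Q (\<lambda>_. h) t t T) \<le> norm (env T)"
    using AE_goodT
  proof eventually_elim
    case (elim T)
    show ?case using PhiT_le_env[OF elim assms] abs_ge_self[of "env T"] by simp
  qed
qed measurable

lemma integrable_sum_Y:
  assumes "s \<in> {a..b}"
  shows "integrable \<mu> (\<lambda>T. \<Sum>j\<in>#children T. \<bar>Y s t (edge_in T j)\<bar>)"
    and "integrable \<mu> (\<lambda>T. \<Sum>j\<in>#children T. \<bar>Y s t (edge_out T j)\<bar>)"
proof -
  have int: "integrable \<mu> (\<lambda>T. real CARD('x) * K * (real (deg T) * M (deg T)))"
    by (intro integrable_mult_right integrable_deg_M)
  have le: "norm (\<Sum>j\<in>#children T. \<bar>Y s t (E T j)\<bar>) \<le> norm (real CARD('x) * K * (real (deg T) * M (deg T)))"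
    if "\<And>j. j \<in># children T \<Longrightarrow> \<bar>Y s t (E T j)\<bar> \<le> K * M (deg T) * real CARD('x)" for T and E :: "utree \<Rightarrow> utree \<Rightarrow> dtree"
  proof -
    have "norm (\<Sum>j\<in>#children T. \<bar>Y s t (E T j)\<bar>) \<le> real (deg T) * (K * M (deg T) * real CARD('x))"
      unfolding real_norm_def deg_def by (rule abs_sum_mset_le_size) (use that in \<open>simp add: deg_def\<close>)
    also have "\<dots> = real CARD('x) * K * (real (deg T) * M (deg T))" by (simp only: mult_ac)
    also have "\<dots> \<le> norm \<dots>" by simp
    finally show ?thesis .
  qed
  show "integrable \<mu> (\<lambda>T. \<Sum>j\<in>#children T. \<bar>Y s t (edge_in T j)\<bar>)"
  proof (rule Bochner_Integration.integrable_bound[OF int])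
    show "AE T in \<mu>. norm (\<Sum>j\<in>#children T. \<bar>Y s t (edge_in T j)\<bar>) \<le> norm (real CARD('x) * K * (real (deg T) * M (deg T)))"
      using AE_goodT by eventually_elim (intro le Y_le_const assms)
  qed measurable
  show "integrable \<mu> (\<lambda>T. \<Sum>j\<in>#children T. \<bar>Y s t (edge_out T j)\<bar>)"
  proof (rule Bochner_Integration.integrable_bound[OF int])
    show "AE T in \<mu>. norm (\<Sum>j\<in>#children T. \<bar>Y s t (edge_out T j)\<bar>) \<le> norm (real CARD('x) * K * (real (deg T) * M (deg T)))"
      using AE_goodT by eventually_elim (intro le Y_le_const assms)
  qed (unfold edge_out_eq_swap, measurable)
qed

text \<open>Signed mass transport, obtained from positive and negative parts. Applied to
  \<open>Y\<close>, it makes the antisymmetric part of \<open>Lp\<close> vanish in the mean.\<close>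

lemma integral_edge_swap:
  fixes F :: "dtree \<Rightarrow> real"
  assumes F [measurable]: "F \<in> borel_measurable dtreeM"
    and i1: "integrable \<mu> (\<lambda>T. \<Sum>j\<in>#children T. \<bar>F (edge_in T j)\<bar>)"
    and i2: "integrable \<mu> (\<lambda>T. \<Sum>j\<in>#children T. \<bar>F (edge_out T j)\<bar>)"
  shows "integrable \<mu> (\<lambda>T. \<Sum>j\<in>#children T. F (edge_in T j))"
    and "integrable \<mu> (\<lambda>T. \<Sum>j\<in>#children T. F (edge_out T j))"
    and "(\<integral>T. (\<Sum>j\<in>#children T. F (edge_in T j)) \<partial>\<mu>) = (\<integral>T. (\<Sum>j\<in>#children T. F (edge_out T j)) \<partial>\<mu>)"
proof -
  have bnd: "integrable \<mu> (\<lambda>T. \<Sum>j\<in>#children T. G (edge_in T j))" "integrable \<mu> (\<lambda>T. \<Sum>j\<in>#children T. G (edge_out T j))"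
    if G [measurable]: "G \<in> borel_measurable dtreeM" and le: "\<And>e. \<bar>G e\<bar> \<le> \<bar>F e\<bar>" for G :: "dtree \<Rightarrow> real"
  proof -
    have le': "norm (\<Sum>j\<in>#children T. G (E T j)) \<le> norm (\<Sum>j\<in>#children T. \<bar>F (E T j)\<bar>)" for T and E :: "utree \<Rightarrow> utree \<Rightarrow> dtree"
    proof -
      have "\<bar>\<Sum>j\<in>#children T. G (E T j)\<bar> \<le> (\<Sum>j\<in>#children T. \<bar>G (E T j)\<bar>)" by (rule abs_sum_mset_le)
      also have "\<dots> \<le> (\<Sum>j\<in>#children T. \<bar>F (E T j)\<bar>)" by (rule sum_mset_mono_real) (rule le)
      also have "\<dots> \<le> \<bar>\<dots>\<bar>" by simp
      finally show ?thesis by simp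
    qed
    have [measurable]: "(\<lambda>e. G (prod.swap e)) \<in> borel_measurable dtreeM"
      by (rule measurable_compose[OF measurable_swap_dtreeM G])
    show "integrable \<mu> (\<lambda>T. \<Sum>j\<in>#children T. G (edge_in T j))"
      by (rule Bochner_Integration.integrable_bound[OF i1]) (measurable, rule AE_I2, rule le')
    show "integrable \<mu> (\<lambda>T. \<Sum>j\<in>#children T. G (edge_out T j))"
      by (rule Bochner_Integration.integrable_bound[OF i2]) (unfold edge_out_eq_swap, measurable, rule AE_I2, rule le')
  qed
  have eq: "(\<integral>T. (\<Sum>j\<in>#children T. G (edge_in T j)) \<partial>\<mu>) = (\<integral>T. (\<Sum>j\<in>#children T. G (edge_out T j)) \<partial>\<mu>)"
    if G [measurable]: "G \<in> borel_measurable dtreeM" and nn: "\<And>e. 0 \<le> G e" for G :: "dtree \<Rightarrow> real"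
  proof -
    have [measurable]: "(\<lambda>e. G (prod.swap e)) \<in> borel_measurable dtreeM"
      by (rule measurable_compose[OF measurable_swap_dtreeM G])
    have "(\<integral>T. (\<Sum>j\<in>#children T. G (edge_in T j)) \<partial>\<mu>) = enn2real (\<integral>\<^sup>+T. (\<Sum>j\<in>#children T. ennreal (G (edge_in T j))) \<partial>\<mu>)"
      by (subst integral_eq_nn_integral) (measurable, auto simp: sum_mset_ennreal nn)
    also have "(\<integral>\<^sup>+T. (\<Sum>j\<in>#children T. ennreal (G (edge_in T j))) \<partial>\<mu>) = (\<integral>\<^sup>+T. (\<Sum>j\<in>#children T. ennreal (G (edge_out T j))) \<partial>\<mu>)"
      by (rule unimodular_edges[OF \<mu>_unimodular]) measurable
    also have "enn2real \<dots> = (\<integral>T. (\<Sum>j\<in>#children T. G (edge_out T j)) \<partial>\<mu>)"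
      unfolding edge_out_eq_swap by (subst integral_eq_nn_integral) (measurable, auto simp: sum_mset_ennreal nn)
    finally show ?thesis .
  qed
  show "integrable \<mu> (\<lambda>T. \<Sum>j\<in>#children T. F (edge_in T j))" "integrable \<mu> (\<lambda>T. \<Sum>j\<in>#children T. F (edge_out T j))"
    by (rule bnd; simp)+
  let ?p = "\<lambda>e. max 0 (F e)" and ?m = "\<lambda>e. max 0 (- F e)"
  have F_eq: "(\<Sum>j\<in>#N. F (E j)) = (\<Sum>j\<in>#N. ?p (E j)) - (\<Sum>j\<in>#N. ?m (E j))" for N and E :: "utree \<Rightarrow> dtree"
    unfolding sum_mset_diff[symmetric] by (intro arg_cong[where f = sum_mset] image_mset_cong) (auto simp: max_def)
  show "(\<integral>T. (\<Sum>j\<in>#children T. F (edge_in T j)) \<partial>\<mu>) = (\<integral>T. (\<Sum>j\<in>#children T. F (edge_out T j)) \<partial>\<mu>)"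
    unfolding F_eq
    by (subst (1 2) Bochner_Integration.integral_diff) (auto intro!: bnd eq arg_cong2[where f = "(-)"])
qed

text \<open>\<open>ae\<close> uses unnormalised BP updates of both messages. At a fixed point these
  are multiples of the messages, and the constants cancel in the quotient. A single \<open>t\<close>
  is involved, so \<open>h_fixed\<close> applies directly, on or off the grids.\<close>

lemma ae_eq:
  assumes t: "t \<in> {a..b}"
  shows "ae \<mu> P Q (\<lambda>_. h) t t = 1/2 * (\<integral>T. (\<Sum>j\<in>#children T. q t (edge_in T j)) \<partial>\<mu>)"
proof -
  let ?w = "\<lambda>e so sj. P t so sj * bpw t (prod.swap e) so * bpw t e sj"
  let ?F = "\<lambda>e. (\<Sum>so\<in>UNIV. \<Sum>sj\<in>UNIV. ?w e so sj * dxi P t so sj) / (\<Sum>so\<in>UNIV. \<Sum>sj\<in>UNIV. ?w e so sj)"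
  have [measurable]: "(\<lambda>e. bpw t (prod.swap e) s) \<in> borel_measurable dtreeM" for s
    by (rule measurable_compose[OF measurable_swap_dtreeM bpw_measurable])
  have F: "?F e = q t e" if "bp t e" "bp t (prod.swap e)" for e
  proof -
    let ?c = "nrm t e * nrm t (prod.swap e)"
    have "?F e = (\<Sum>so\<in>UNIV. \<Sum>sj\<in>UNIV. ?c * (P t so sj * dxi P t so sj * h t e sj * h t (prod.swap e) so))
        / (\<Sum>so\<in>UNIV. \<Sum>sj\<in>UNIV. ?c * (P t so sj * h t e sj * h t (prod.swap e) so))"
      unfolding bp_bpw(2)[OF that(1)] bp_bpw(2)[OF that(2)] by (simp only: mult_ac)
    also have "\<dots> = q t e"
      unfolding sum_distrib_left[symmetric] q_def Ze_def u_def sum_distrib_right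
      using bp_bpw(1)[OF that(1)] bp_bpw(1)[OF that(2)] by simp
    finally show ?thesis .
  qed
  have "AE e in mu_up \<mu>. bp t e" using h_fixed[OF t] by (simp add: bp_def)
  then have "AE T in \<mu>. \<forall>j\<in>#children T. bp t (edge_in T j) \<and> bp t (edge_out T j)"
    by (rule AE_mu_upD[OF \<mu>_sets \<mu>_prob \<mu>_unimodular])
  then have "AE T in \<mu>. (\<Sum>j\<in>#children T. ?F (edge_in T j)) = (\<Sum>j\<in>#children T. q t (edge_in T j))"
    by eventually_elim (intro arg_cong[where f = sum_mset] image_mset_cong F, auto simp: edge_out_eq_swap)
  moreover have "(\<lambda>T. \<Sum>j\<in>#children T. ?F (edge_in T j)) \<in> borel_measurable \<mu>"
    by measurable
  moreover have "(\<lambda>T. \<Sum>j\<in>#children T. q t (edge_in T j)) \<in> borel_measurable \<mu>"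
    by measurable
  ultimately have "(\<integral>T. (\<Sum>j\<in>#children T. ?F (edge_in T j)) \<partial>\<mu>) = (\<integral>T. (\<Sum>j\<in>#children T. q t (edge_in T j)) \<partial>\<mu>)"
    by (intro integral_cong_AE)
  then show ?thesis by (simp add: ae_def edgew_def edge_out_eq_swap)
qed

lemma avx_eq: "avx \<mu> P Q (\<lambda>_. h) t t = (\<integral>T. vx t T \<partial>\<mu>)"
  by (simp add: avx_def vx_def Zv_def)

text \<open>Total derivative with both factors moving; when one factor is frozen its summand is
  0.\<close>

definition slope :: "real \<Rightarrow> real" where
  "slope t = ae \<mu> P Q (\<lambda>_. h) t t + avx \<mu> P Q (\<lambda>_. h) t t"

abbreviation rate :: "real \<Rightarrow> utree \<Rightarrow> real" where
  "rate t T \<equiv> vx t T + 1/2 * (\<Sum>j\<in>#children T. q t (edge_in T j))"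

lemma sum_q_le: "t \<in> {a..b} \<Longrightarrow> \<bar>\<Sum>j\<in>#children T. q t (edge_in T j)\<bar> \<le> real (deg T) * K"
  unfolding deg_def by (intro abs_sum_mset_le_size q_le)

lemma rate_le: "t \<in> {a..b} \<Longrightarrow> \<bar>rate t T\<bar> \<le> K + real (deg T) * K"
  using sum_q_le[of t T] vx_le[of t T] by (simp add: abs_le_iff)

lemma integrable_rate_bound: "integrable \<mu> (\<lambda>T. K + real (deg T) * K)"
  by (intro Bochner_Integration.integrable_add integrable_mult_left integrable_deg integrable_const)

lemma slope_eq:
  assumes t: "t \<in> {a..b}"
  shows "integrable \<mu> (rate t)" "slope t = (\<integral>T. rate t T \<partial>\<mu>)"
proof -
  have q: "integrable \<mu> (\<lambda>T. \<Sum>j\<in>#children T. q t (edge_in T j))"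
    by (rule Bochner_Integration.integrable_bound[where f = "\<lambda>T. real (deg T) * K"])
       (use sum_q_le[OF t] K_ge_1 in \<open>auto intro!: integrable_mult_left integrable_deg simp: abs_mult\<close>)
  have v: "integrable \<mu> (\<lambda>T. vx t T)"
    by (rule Bochner_Integration.integrable_bound[where f = "\<lambda>T. K"]) (use vx_le[OF t] K_ge_1 in auto)
  show "integrable \<mu> (rate t)" using q v by auto
  show "slope t = (\<integral>T. rate t T \<partial>\<mu>)"
    unfolding slope_def ae_eq[OF t] avx_eq using q v by simp
qed

text \<open>On good trees \<open>rate\<close> is continuous in the parameter, and it is dominated by
  a multiple of 1 plus the degree. Continuity of the mean is what lets the Riemann sums of
  \<open>slope\<close> converge.\<close>

lemma slope_continuous: "continuous_on {a..b} slope"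
proof (subst continuous_on_cong[OF refl slope_eq(2)], assumption, unfold continuous_on_sequentially, intro allI ballI impI, elim conjE)
  fix X t assume t: "t \<in> {a..b}" and X: "\<forall>n. X n \<in> {a..b}" "X \<longlonglongrightarrow> t"
  have "(\<lambda>n. \<integral>T. rate (X n) T \<partial>\<mu>) \<longlonglongrightarrow> (\<integral>T. rate t T \<partial>\<mu>)"
  proof (rule integral_dominated_convergence[OF _ _ integrable_rate_bound])
    show "AE T in \<mu>. (\<lambda>n. rate (X n) T) \<longlonglongrightarrow> rate t T"
      using AE_goodT
    proof eventually_elim
      case (elim T)
      show ?case using integrand_continuous[OF elim] X t unfolding continuous_on_sequentially comp_def by blast
    qed
    show "AE T in \<mu>. norm (rate (X n) T) \<le> K + real (deg T) * K" for n
      using rate_le X(1) by auto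
  qed measurable
  then show "((\<lambda>t. \<integral>T. rate t T \<partial>\<mu>) \<circ> X) \<longlonglongrightarrow> (\<integral>T. rate t T \<partial>\<mu>)" by (simp add: comp_def)
qed

lemma integral_Lp:
  assumes s: "s \<in> {a..b}"
  shows "integrable \<mu> (Lp s t)" "(\<integral>T. Lp s t T \<partial>\<mu>) = (t - s) * slope s"
proof -
  note Y = integral_edge_swap[OF Y_measurable integrable_sum_Y[OF s], of t]
  show "integrable \<mu> (Lp s t)"
    unfolding Lp_def[abs_def]
    by (intro Bochner_Integration.integrable_add integrable_mult_right Bochner_Integration.integrable_diff Y(1,2) slope_eq(1)[OF s])
  show "(\<integral>T. Lp s t T \<partial>\<mu>) = (t - s) * slope s"
  proof -
    let ?o = "\<lambda>T. \<Sum>j\<in>#children T. Y s t (edge_out T j)" and ?i = "\<lambda>T. \<Sum>j\<in>#children T. Y s t (edge_in T j)"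
    have "(\<integral>T. Lp s t T \<partial>\<mu>) = (\<integral>T. (t - s) * rate s T \<partial>\<mu>) + (\<integral>T. 1/2 * (?o T - ?i T) \<partial>\<mu>)"
      unfolding Lp_def
      by (intro Bochner_Integration.integral_add integrable_mult_right Bochner_Integration.integrable_diff Y(1,2) slope_eq(1)[OF s])
    also have "(\<integral>T. 1/2 * (?o T - ?i T) \<partial>\<mu>) = 0"
      using Bochner_Integration.integral_diff[OF Y(2) Y(1)] Y(3) by simp
    finally show ?thesis unfolding slope_eq(2)[OF s] by (simp only: integral_mult_right_zero add_0_right)
  qed
qed

lemma sum_grid_Lp_le:
  assumes T: "goodT T"
  shows "\<bar>\<Sum>k<N. Lp (grid a b N k) (grid a b N (Suc k)) T\<bar>
    \<le> (b - a) * (K + real (deg T) * K) + real CARD('x) * C * K * (real (deg T) * M (deg T))"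
proof (cases "N = 0")
  case True
  \<comment> \<open>The sign of \<open>C\<close> is not part of the locale. A child supplies an edge
    whose variation forces \<open>C\<close> to be nonnegative; without children the coefficient of
    \<open>C\<close> is 0.\<close>
  have C: "0 \<le> C" if "children T \<noteq> {#}"
  proof -
    obtain j where "j \<in># children T" using \<open>children T \<noteq> {#}\<close> by auto
    then have le: "tv (\<lambda>t. h t (edge_in T j) p) a b \<le> ereal C" using T by (auto simp: goodT_def good_def)
    have "0 \<le> ereal C" by (rule order_trans[OF tv_nonneg le]) (use a_less_b in simp)
    then show ?thesis by simp
  qed
  have "0 \<le> (b - a) * (K + real (deg T) * K)" using a_less_b K_ge_1 by (intro mult_nonneg_nonneg) auto
  moreover have "0 \<le> real CARD('x) * C * K * (real (deg T) * M (deg T))"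
    using C K_ge_1 M_pos[of "deg T"] by (cases "children T = {#}") (auto simp: deg_def intro!: mult_nonneg_nonneg)
  ultimately show ?thesis using True by simp
next
  case False
  let ?g = "grid a b N"
  have Ysum: "(\<Sum>k<N. \<bar>\<Sum>j\<in>#children T. Y (?g k) (?g (Suc k)) (E T j)\<bar>) \<le> real CARD('x) * C * K * (real (deg T) * M (deg T))"
    if E: "E = edge_in \<or> E = edge_out" for E
  proof -
    have "(\<Sum>k<N. \<bar>\<Sum>j\<in>#children T. Y (?g k) (?g (Suc k)) (E T j)\<bar>) \<le> (\<Sum>k<N. \<Sum>j\<in>#children T. \<bar>Y (?g k) (?g (Suc k)) (E T j)\<bar>)"
      by (intro sum_mono abs_sum_mset_le)
    also have "\<dots> = (\<Sum>j\<in>#children T. \<Sum>k<N. \<bar>Y (?g k) (?g (Suc k)) (E T j)\<bar>)"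
      by (rule sum_sum_mset_swap)
    also have "\<dots> \<le> (\<Sum>j\<in>#children T. K * M (deg T) * (real CARD('x) * C))"
      by (intro sum_mset_mono_real sum_grid_Y_le[OF T]) (use E in auto)
    also have "\<dots> = real CARD('x) * C * K * (real (deg T) * M (deg T))"
      by (simp add: deg_def mult_ac)
    finally show ?thesis .
  qed
  have rsum: "(\<Sum>k<N. \<bar>(?g (Suc k) - ?g k) * rate (?g k) T\<bar>) \<le> (b - a) * (K + real (deg T) * K)"
  proof -
    have "(\<Sum>k<N. \<bar>(?g (Suc k) - ?g k) * rate (?g k) T\<bar>) \<le> (\<Sum>k<N. (?g (Suc k) - ?g k) * (K + real (deg T) * K))"
    proof (rule sum_mono)
      fix k assume "k \<in> {..<N}"
      then have "?g k \<in> {a..b}" using grid_bounds[OF a_less_b, of k N] by auto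
      moreover have "0 \<le> ?g (Suc k) - ?g k" using a_less_b by (simp add: grid_Suc)
      ultimately show "\<bar>(?g (Suc k) - ?g k) * rate (?g k) T\<bar> \<le> (?g (Suc k) - ?g k) * (K + real (deg T) * K)"
        unfolding abs_mult by (intro mult_mono rate_le) auto
    qed
    also have "\<dots> = (b - a) * (K + real (deg T) * K)"
      using sum_grid_telescope[of N "\<lambda>t. t" a b] False by (simp flip: sum_distrib_right)
    finally show ?thesis .
  qed
  have "\<bar>\<Sum>k<N. Lp (?g k) (?g (Suc k)) T\<bar> \<le> (\<Sum>k<N. \<bar>(?g (Suc k) - ?g k) * rate (?g k) T\<bar>
     + 1/2 * (\<bar>\<Sum>j\<in>#children T. Y (?g k) (?g (Suc k)) (edge_out T j)\<bar> + \<bar>\<Sum>j\<in>#children T. Y (?g k) (?g (Suc k)) (edge_in T j)\<bar>))"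
  proof (intro sum_abs[THEN order_trans] sum_mono)
    have "\<bar>x + 1/2 * (y - z)\<bar> \<le> \<bar>x\<bar> + 1/2 * (\<bar>y\<bar> + \<bar>z\<bar>)" for x y z :: real
    proof -
      have "\<bar>x + 1/2 * (y - z)\<bar> \<le> \<bar>x\<bar> + \<bar>1/2 * (y - z)\<bar>" by (rule abs_triangle_ineq)
      also have "\<bar>1/2 * (y - z)\<bar> = 1/2 * \<bar>y - z\<bar>" by (simp add: abs_mult)
      also have "1/2 * \<bar>y - z\<bar> \<le> 1/2 * (\<bar>y\<bar> + \<bar>z\<bar>)" by (intro mult_left_mono abs_triangle_ineq4) simp
      finally show ?thesis by simp
    qed
    then show "\<bar>Lp s t T\<bar> \<le> \<bar>(t - s) * rate s T\<bar> + 1/2 * (\<bar>\<Sum>j\<in>#children T. Y s t (edge_out T j)\<bar>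
        + \<bar>\<Sum>j\<in>#children T. Y s t (edge_in T j)\<bar>)" for s t
      unfolding Lp_def .
  qed
  also have "\<dots> \<le> (b - a) * (K + real (deg T) * K) + real CARD('x) * C * K * (real (deg T) * M (deg T))"
  proof -
    have "A + 1/2 * (D + B) \<le> x + y" if "A \<le> x" "B \<le> y" "D \<le> y" for A B D x y :: real
      using that by (simp add: field_simps)
    from this[OF rsum Ysum[of edge_in] Ysum[of edge_out]] show ?thesis
      unfolding sum.distrib sum_distrib_left[symmetric] by simp
  qed
  finally show ?thesis .
qed

text \<open>The means of the grid sums of \<open>Lp\<close> are Riemann sums of
  \<open>slope\<close>. The treewise error tends to 0 and is dominated by \<open>?B\<close>, which
  does not depend on \<open>N\<close>, so the error of the mean tends to 0 as well.\<close>

lemma Phi_increment: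
  "Phi \<mu> P Q (\<lambda>_. h) b b - Phi \<mu> P Q (\<lambda>_. h) a a = integral {a..b} slope"
proof -
  let ?g = "grid a b"
  let ?R = "\<lambda>N. \<Sum>k<N. (?g N (Suc k) - ?g N k) * slope (?g N k)"
  let ?D = "\<lambda>N T. PhiT P Q (\<lambda>_. h) b b T - PhiT P Q (\<lambda>_. h) a a T - (\<Sum>k<N. Lp (?g N k) (?g N (Suc k)) T)"
  let ?B = "\<lambda>T. env T + env T + ((b - a) * (K + real (deg T) * K) + real CARD('x) * C * K * (real (deg T) * M (deg T)))"
  have ab: "a \<in> {a..b}" "b \<in> {a..b}" using a_less_b by auto
  have Lp_int: "integrable \<mu> (\<lambda>T. \<Sum>k<N. Lp (?g N k) (?g N (Suc k)) T)" "(\<integral>T. (\<Sum>k<N. Lp (?g N k) (?g N (Suc k)) T) \<partial>\<mu>) = ?R N" for N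
  proof -
    have m: "?g N k \<in> {a..b}" if "k < N" for k using grid_bounds[OF a_less_b, of k N] that by auto
    show "integrable \<mu> (\<lambda>T. \<Sum>k<N. Lp (?g N k) (?g N (Suc k)) T)"
      by (intro Bochner_Integration.integrable_sum integral_Lp(1) m) auto
    show "(\<integral>T. (\<Sum>k<N. Lp (?g N k) (?g N (Suc k)) T) \<partial>\<mu>) = ?R N"
      using m by (subst Bochner_Integration.integral_sum) (auto intro!: sum.cong integral_Lp)
  qed
  have "(\<lambda>N. \<integral>T. ?D N T \<partial>\<mu>) \<longlonglongrightarrow> (\<integral>T. 0 \<partial>\<mu>)"
  proof (rule integral_dominated_convergence[where w = ?B])
    show "integrable \<mu> ?B"
      by (intro Bochner_Integration.integrable_add integrable_env integrable_mult_right integrable_rate_bound integrable_deg_M)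
    show "AE T in \<mu>. (\<lambda>N. ?D N T) \<longlonglongrightarrow> 0"
      using AE_goodT by eventually_elim (rule PhiT_increment_limit)
    show "AE T in \<mu>. norm (?D N T) \<le> ?B T" for N
      using AE_goodT
    proof eventually_elim
      case (elim T)
      show ?case
        using PhiT_le_env[OF elim ab(1)] PhiT_le_env[OF elim ab(2)] sum_grid_Lp_le[OF elim, of N]
        unfolding real_norm_def abs_le_iff by linarith
    qed
  qed measurable
  moreover have "(\<integral>T. ?D N T \<partial>\<mu>) = Phi \<mu> P Q (\<lambda>_. h) b b - Phi \<mu> P Q (\<lambda>_. h) a a - ?R N" for N
    using integrable_PhiT[OF ab(1)] integrable_PhiT[OF ab(2)] Lp_int[of N] by (simp add: Phi_def)
  ultimately have "(\<lambda>N. Phi \<mu> P Q (\<lambda>_. h) b b - Phi \<mu> P Q (\<lambda>_. h) a a - ?R N) \<longlonglongrightarrow> 0" by simp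
  moreover have "(\<lambda>N. Phi \<mu> P Q (\<lambda>_. h) b b - Phi \<mu> P Q (\<lambda>_. h) a a - ?R N)
      \<longlonglongrightarrow> Phi \<mu> P Q (\<lambda>_. h) b b - Phi \<mu> P Q (\<lambda>_. h) a a - integral {a..b} slope"
    by (intro tendsto_intros continuous_grid_sum_limit a_less_b slope_continuous)
  ultimately show ?thesis using LIMSEQ_unique by fastforce
qed

end

section \<open>Consequences of the regularity hypothesis\<close>

lemma C1_deriv:
  assumes "C1 f"
  shows "(f has_real_derivative deriv f x) (at x)" "continuous_on S (deriv f)"
proof -
  obtain f' where f': "continuous_on UNIV f'" "\<And>x. (f has_real_derivative f' x) (at x)"
    using assms unfolding C1_def by blast
  have eq: "deriv f = f'" using f'(2) by (auto intro!: DERIV_imp_deriv)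
  show "(f has_real_derivative deriv f x) (at x)" unfolding eq by (rule f')
  show "continuous_on S (deriv f)" unfolding eq by (rule continuous_on_subset[OF f'(1)]) simp
qed

text \<open>The factored form of the derivative also covers pairs whose factor is identically 0,
  where both the derivative and the product are 0.\<close>

lemma H1_pair_deriv:
  assumes "H1 P Q"
  shows "((\<lambda>t. P t s s') has_real_derivative P t s s' * dxi P t s s') (at t)"
    and "continuous_on S (\<lambda>t. dxi P t s s')"
proof -
  consider "\<forall>t. P t s s' = 0" | "\<forall>t. P t s s' > 0" "C1 (\<lambda>t. ln (P t s s'))"
    using assms unfolding H1_def by blast
  then have "((\<lambda>t. P t s s') has_real_derivative P t s s' * dxi P t s s') (at t) \<and> continuous_on S (\<lambda>t. dxi P t s s')"
  proof cases
    case 1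
    then have "P t s s' = 0" "dxi P t s s' = 0" for t by (simp_all add: dxi_def)
    then show ?thesis by simp
  next
    case 2
    then have d: "(\<lambda>t. dxi P t s s') = deriv (\<lambda>t. ln (P t s s'))" by (auto simp: dxi_def fun_eq_iff less_le)
    have "((\<lambda>t. exp (ln (P t s s'))) has_real_derivative exp (ln (P t s s')) * deriv (\<lambda>t. ln (P t s s')) t) (at t)"
      by (rule DERIV_chain2[OF DERIV_exp C1_deriv(1)[OF 2(2)]])
    then show ?thesis using 2(1) C1_deriv(2)[OF 2(2), of S] by (simp add: d[THEN fun_cong] d)
  qed
  then show "((\<lambda>t. P t s s') has_real_derivative P t s s' * dxi P t s s') (at t)" "continuous_on S (\<lambda>t. dxi P t s s')" by auto
qed

lemma H1_vertex_deriv: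
  assumes "H1 P Q"
  shows "((\<lambda>t. ln (Q t s)) has_real_derivative dxib Q t s) (at t)"
    and "((\<lambda>t. Q t s) has_real_derivative Q t s * dxib Q t s) (at t)"
    and "continuous_on S (\<lambda>t. dxib Q t s)"
proof -
  have pos: "\<And>t. Q t s > 0" and c1: "C1 (\<lambda>t. ln (Q t s))" using assms by (auto simp: H1_def)
  show ln: "((\<lambda>t. ln (Q t s)) has_real_derivative dxib Q t s) (at t)" for t
    unfolding dxib_def by (rule C1_deriv(1)[OF c1])
  have "((\<lambda>t. exp (ln (Q t s))) has_real_derivative exp (ln (Q t s)) * dxib Q t s) (at t)"
    by (rule DERIV_chain2[OF DERIV_exp ln])
  then show "((\<lambda>t. Q t s) has_real_derivative Q t s * dxib Q t s) (at t)" using pos by simp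
  show "continuous_on S (\<lambda>t. dxib Q t s)"
    unfolding dxib_def using C1_deriv(2)[OF c1, of S] by simp
qed

lemma finite_continuous_bound:
  fixes f :: "'i \<Rightarrow> real \<Rightarrow> real"
  assumes "finite I" "\<And>i. i \<in> I \<Longrightarrow> continuous_on {a..b} (f i)"
  shows "\<exists>K\<ge>1. \<forall>i\<in>I. \<forall>t\<in>{a..b}. \<bar>f i t\<bar> \<le> K"
  using assms
proof (induction I)
  case empty then show ?case by auto
next
  case (insert i I)
  then obtain K where K: "K \<ge> 1" "\<forall>i\<in>I. \<forall>t\<in>{a..b}. \<bar>f i t\<bar> \<le> K" by auto
  have "bounded (f i ` {a..b})" using insert by (intro compact_imp_bounded compact_continuous_image) auto
  then obtain L where "\<forall>x\<in>f i ` {a..b}. norm x \<le> L" unfolding bounded_iff by blast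
  then have "\<forall>j\<in>insert i I. \<forall>t\<in>{a..b}. \<bar>f j t\<bar> \<le> max K L" using K by force
  then show ?case using K(1) by (intro exI[of _ "max K L"]) auto
qed

lemma betheI:
  fixes P :: "real \<Rightarrow> 'x::finite \<Rightarrow> 'x \<Rightarrow> real"
  assumes ab: "a < b" and spec: "spec P Q" and H1: "H1 P Q" and lwc: "lwc G \<mu>" and H2: "H2 \<mu> P"
    and h: "\<And>t s. (\<lambda>e. h t e s) \<in> borel_measurable dtreeM" "\<And>t e s. 0 \<le> h t e s" "\<And>t e. (\<Sum>s\<in>UNIV. h t e s) = 1"
    and fx: "\<And>t. t \<in> {a..b} \<Longrightarrow> AE e in mu_up \<mu>. h t e = BP P Q (\<lambda>_. h) t t e"
    and bv: "AE e in mu_up \<mu>. \<forall>s. continuous_on {a..b} (\<lambda>t. h t e s) \<and> tv (\<lambda>t. h t e s) a b \<le> ereal C"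
  shows "\<exists>p K \<kappa>. bethe P Q h \<mu> a b p K \<kappa> C"
proof -
  obtain p where p: "\<And>t s. P t s p > 0" using H1 unfolding H1_def by blast
  have Qpos: "\<And>t s. Q t s > 0" using H1 unfolding H1_def by blast
  have contP: "continuous_on {a..b} (\<lambda>t. P t s s')" for s s'
    using H1_pair_deriv(1)[OF H1] by (meson DERIV_isCont continuous_at_imp_continuous_on)
  have contQ: "continuous_on {a..b} (\<lambda>t. Q t s)" for s
    using H1_vertex_deriv(2)[OF H1] by (meson DERIV_isCont continuous_at_imp_continuous_on)
  obtain K1 where K1: "K1 \<ge> 1" "\<And>t i. t \<in> {a..b} \<Longrightarrow> \<bar>P t (fst i) (snd i)\<bar> \<le> K1"
    using finite_continuous_bound[of UNIV a b "\<lambda>i t. P t (fst i) (snd i)"] contP by auto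
  obtain K2 where K2: "K2 \<ge> 1" "\<And>t s. t \<in> {a..b} \<Longrightarrow> \<bar>Q t s\<bar> \<le> K2"
    using finite_continuous_bound[of UNIV a b "\<lambda>s t. Q t s"] contQ by auto
  obtain K3 where K3: "K3 \<ge> 1" "\<And>t i. t \<in> {a..b} \<Longrightarrow> \<bar>dxi P t (fst i) (snd i)\<bar> \<le> K3"
    using finite_continuous_bound[of UNIV a b "\<lambda>i t. dxi P t (fst i) (snd i)"] H1_pair_deriv(2)[OF H1] by auto
  obtain K4 where K4: "K4 \<ge> 1" "\<And>t s. t \<in> {a..b} \<Longrightarrow> \<bar>dxib Q t s\<bar> \<le> K4"
    using finite_continuous_bound[of UNIV a b "\<lambda>s t. dxib Q t s"] H1_vertex_deriv(3)[OF H1] by auto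
  obtain L1 where L1: "L1 \<ge> 1" "\<And>t s. t \<in> {a..b} \<Longrightarrow> \<bar>1 / Q t s\<bar> \<le> L1"
  proof -
    have "continuous_on {a..b} (\<lambda>t. 1 / Q t s)" for s
      by (intro continuous_intros contQ ballI) (metis Qpos less_irrefl)
    then obtain L where "L \<ge> 1" "\<forall>s\<in>UNIV. \<forall>t\<in>{a..b}. \<bar>1 / Q t s\<bar> \<le> L"
      using finite_continuous_bound[of UNIV a b "\<lambda>s t. 1 / Q t s", OF finite] by blast
    then show ?thesis by (intro that[of L]) auto
  qed
  obtain L2 where L2: "L2 \<ge> 1" "\<And>t i. t \<in> {a..b} \<Longrightarrow> P t (fst i) (snd i) > 0 \<Longrightarrow> \<bar>1 / P t (fst i) (snd i)\<bar> \<le> L2"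
  proof -
    let ?I = "{i. \<forall>t. P t (fst i) (snd i) > 0}"
    have "continuous_on {a..b} (\<lambda>t. 1 / P t (fst i) (snd i))" if "i \<in> ?I" for i
    proof -
      have "0 < P t (fst i) (snd i)" for t using that by simp
      then have "P t (fst i) (snd i) \<noteq> 0" for t by (rule less_imp_neq[THEN not_sym])
      then show ?thesis by (intro continuous_intros contP ballI)
    qed
    then obtain L where L: "L \<ge> 1" "\<And>i t. i \<in> ?I \<Longrightarrow> t \<in> {a..b} \<Longrightarrow> \<bar>1 / P t (fst i) (snd i)\<bar> \<le> L"
      using finite_continuous_bound[of ?I a b "\<lambda>i t. 1 / P t (fst i) (snd i)", OF finite] by blast
    \<comment> \<open>By the dichotomy in (H1), positivity at one parameter is positivity at all, so
      reciprocals are bounded over the finite set of nonvanishing pairs.\<close>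
    have pos: "i \<in> ?I" if "P t (fst i) (snd i) > 0" for t i
    proof -
      have "(\<forall>t. P t (fst i) (snd i) = 0) \<or> (\<forall>t. P t (fst i) (snd i) > 0)" using H1 unfolding H1_def by blast
      then show ?thesis using that by auto
    qed
    show ?thesis
    proof (rule that[OF L(1)])
      fix t i assume t: "t \<in> {a..b}" and P: "P t (fst i) (snd i) > 0"
      show "\<bar>1 / P t (fst i) (snd i)\<bar> \<le> L" by (rule L(2)[OF pos[OF P] t])
    qed
  qed
  define K where "K = max (max K1 K2) (max K3 K4)"
  \<comment> \<open>\<open>L1\<close> and \<open>L2\<close> bound the reciprocals of the vertex
    factors and of the nonvanishing pair factors; both are at least 1, whence
    \<open>\<kappa> \<le> 1\<close>.\<close>
  define \<kappa> where "\<kappa> = 1 / max L1 L2"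
  have K: "K1 \<le> K" "K2 \<le> K" "K3 \<le> K" "K4 \<le> K" by (auto simp: K_def)
  have inv: "\<kappa> \<le> x" if "x > 0" "\<bar>1 / x\<bar> \<le> L" "L \<le> max L1 L2" for x L
  proof -
    have "1 / x \<le> max L1 L2" using that(2,3) by linarith
    then have "1 \<le> max L1 L2 * x" using that(1) by (simp add: divide_le_eq)
    then show ?thesis using L1(1) by (simp add: \<kappa>_def divide_le_eq mult.commute)
  qed
  have Pge: "\<kappa> \<le> P t s s'" if "t \<in> {a..b}" "P t s s' > 0" for t s s'
    using inv[of "P t s s'" L2] L2(2)[of t "(s, s')"] that by simp
  have "bethe P Q h \<mu> a b p K \<kappa> C"
  proof (rule bethe.intro)
    show "1 \<le> K" using K1 K by linarith
    show "0 < \<kappa>" "\<kappa> \<le> 1" using L1(1) by (auto simp: \<kappa>_def max_def)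
    fix t s s' assume t: "t \<in> {a..b}"
    show "P t s s' \<le> K" using K1(2)[OF t, of "(s, s')"] K by auto
    show "Q t s \<le> K" using K2(2)[OF t, of s] K by auto
    show "\<bar>dxi P t s s'\<bar> \<le> K" using K3(2)[OF t, of "(s, s')"] K by auto
    show "\<bar>dxib Q t s\<bar> \<le> K" using K4(2)[OF t, of s] K by auto
    show "\<kappa> \<le> Q t s" using inv[OF Qpos L1(2)[OF t]] by simp
    show "\<kappa> \<le> P t s p" by (rule Pge[OF t p])
    show "\<forall>t s s'. P t s s' > 0 \<Longrightarrow> \<kappa> \<le> P t s s'" by (rule Pge[OF t]) blast
  next
    show "sets \<mu> = sets utreeM" "prob_space \<mu>" "unimodular \<mu>" using lwc by (simp_all add: lwc_def)
    fix t s s'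
    show "P t s s' = P t s' s" "0 \<le> P t s s'" "0 \<le> Q t s" using spec by (simp_all add: spec_def)
  qed (fact ab H2 h fx bv H1_pair_deriv[OF H1] H1_vertex_deriv(1,3)[OF H1])+
  then show ?thesis by blast
qed

section \<open>Finite graphs\<close>

text \<open>Logarithmic differentiation without logarithms: with each derivative given as a multiple
  of its factor, vanishing factors are allowed.\<close>

lemma DERIV_prod_log:
  fixes f :: "'i \<Rightarrow> real \<Rightarrow> real"
  assumes "\<And>i. i \<in> I \<Longrightarrow> (f i has_real_derivative f i t * d i) (at t)"
  shows "((\<lambda>t. \<Prod>i\<in>I. f i t) has_real_derivative (\<Prod>i\<in>I. f i t) * (\<Sum>i\<in>I. d i)) (at t)"
  using assms
proof (induction I rule: infinite_finite_induct)
  case (insert i I)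
  then have "((\<lambda>t. f i t * (\<Prod>i\<in>I. f i t)) has_real_derivative
     (f i t * d i) * (\<Prod>i\<in>I. f i t) + ((\<Prod>i\<in>I. f i t) * (\<Sum>i\<in>I. d i)) * f i t) (at t)"
    by (intro DERIV_mult) auto
  then show ?case using insert by (simp add: algebra_simps)
qed auto

text \<open>Double counting: each edge occurs as an increasing and as a decreasing ordered pair, and
  \<open>Min\<close>, \<open>Max\<close> select the increasing one.\<close>

lemma sum_edges:
  fixes F :: "nat \<Rightarrow> nat \<Rightarrow> real"
  assumes E: "graph_on n E" and sym: "\<And>i j. F i j = F j i"
  shows "(\<Sum>e\<in>E. F (Min e) (Max e)) = 1/2 * (\<Sum>i<n. \<Sum>j\<in>nbrs E i. F i j)"
proof -
  have e2: "\<exists>i j. e = {i, j} \<and> i < j \<and> j < n" if "e \<in> E" for e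
  proof -
    have "card e = 2" "e \<subseteq> {..<n}" using E that by (auto simp: graph_on_def)
    then obtain i j where ij: "e = {i, j}" "i \<noteq> j" by (auto simp: card_2_iff)
    then show ?thesis using \<open>e \<subseteq> {..<n}\<close> by (intro exI[of _ "min i j"] exI[of _ "max i j"]) (auto simp: min_def max_def)
  qed
  have nb: "i \<noteq> j" "i < n" "j < n" if "{i, j} \<in> E" for i j
    using e2[OF that] by (auto simp: doubleton_eq_iff)
  let ?U = "{(i, j). {i, j} \<in> E \<and> i < j}" and ?L = "{(i, j). {i, j} \<in> E \<and> j < i}"
  have sub: "?U \<subseteq> {..<n} \<times> {..<n}" "?L \<subseteq> {..<n} \<times> {..<n}" using nb by auto
  then have fin: "finite ?U" "finite ?L" by (auto intro: finite_subset)
  have fn: "finite (nbrs E i)" for i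
    by (rule finite_subset[of _ "{..<n}"]) (use nb in \<open>auto simp: nbrs_def\<close>)
  have "(\<Sum>i<n. \<Sum>j\<in>nbrs E i. F i j) = (\<Sum>(i, j)\<in>Sigma {..<n} (nbrs E). F i j)"
    by (rule sum.Sigma) (auto simp: fn)
  also have "Sigma {..<n} (nbrs E) = ?U \<union> ?L"
    using nb by (auto simp: nbrs_def) (metis nat_neq_iff)
  also have "(\<Sum>(i, j)\<in>?U \<union> ?L. F i j) = (\<Sum>(i, j)\<in>?U. F i j) + (\<Sum>(i, j)\<in>?L. F i j)"
    by (rule sum.union_disjoint) (use fin in auto)
  also have "(\<Sum>(i, j)\<in>?L. F i j) = (\<Sum>(i, j)\<in>?U. F i j)"
    by (rule sum.reindex_bij_witness[of _ prod.swap prod.swap]) (auto simp: insert_commute sym)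
  also have "(\<Sum>(i, j)\<in>?U. F i j) = (\<Sum>e\<in>E. F (Min e) (Max e))"
  proof (rule sum.reindex_bij_witness[of _ "\<lambda>e. (Min e, Max e)" "\<lambda>(i, j). {i, j}"])
    fix e assume "e \<in> E"
    then obtain i j where ij: "e = {i, j}" "i < j" using e2 by blast
    show "(case (Min e, Max e) of (i, j) \<Rightarrow> {i, j}) = e" using ij by simp
    show "(Min e, Max e) \<in> ?U" using ij \<open>e \<in> E\<close> by simp
  qed auto
  finally show ?thesis by simp
qed

lemma finite_configs: "finite (configs n :: (nat \<Rightarrow> 'x::finite) set)"
  unfolding configs_def by (intro finite_PiE) auto

context
  fixes P :: "real \<Rightarrow> 'x::finite \<Rightarrow> 'x \<Rightarrow> real" and Q :: "real \<Rightarrow> 'x \<Rightarrow> real"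
  assumes spec: "spec P Q" and H1: "H1 P Q"
begin

lemma gweight_nonneg: "0 \<le> gweight P Q \<beta> B n E \<sigma>"
  using spec unfolding gweight_def spec_def by (intro mult_nonneg_nonneg prod_nonneg) auto

text \<open>The configuration constantly equal to the permissive spin has positive weight.\<close>

lemma Zg_pos:
  assumes E: "graph_on n E"
  shows "0 < Zg P Q \<beta> B n E"
proof -
  obtain p where p: "\<And>t s. P t s p > 0" using H1 unfolding H1_def by blast
  have Qpos: "\<And>t s. Q t s > 0" using H1 unfolding H1_def by blast
  let ?\<sigma> = "\<lambda>i\<in>{..<n}. p"
  have conf: "?\<sigma> \<in> configs n" by (auto simp: configs_def)
  have "?\<sigma> (Max e) = p" if "e \<in> E" for e
  proof -
    have "card e = 2" "e \<subseteq> {..<n}" using E that by (auto simp: graph_on_def)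
    then have "Max e \<in> e" by (intro Max_in) (auto intro: card_ge_0_finite)
    then show ?thesis using \<open>e \<subseteq> {..<n}\<close> by auto
  qed
  then have "0 < gweight P Q \<beta> B n E ?\<sigma>"
    unfolding gweight_def using p Qpos by (intro mult_pos_pos prod_pos) auto
  also have "\<dots> \<le> Zg P Q \<beta> B n E"
    unfolding Zg_def by (rule member_le_sum[OF conf]) (auto simp: gweight_nonneg finite_configs)
  finally show ?thesis .
qed

definition log_deriv :: "real \<Rightarrow> nat \<Rightarrow> nat set set \<Rightarrow> (nat \<Rightarrow> 'x) \<Rightarrow> real" where
  "log_deriv t n E \<sigma> = (\<Sum>e\<in>E. dxi P t (\<sigma> (Min e)) (\<sigma> (Max e))) + (\<Sum>i<n. dxib Q t (\<sigma> i))"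

lemma gweight_deriv:
  "((\<lambda>t. gweight P Q t t n E \<sigma>) has_real_derivative gweight P Q t t n E \<sigma> * log_deriv t n E \<sigma>) (at t)"
proof -
  let ?A = "\<lambda>t. \<Prod>e\<in>E. P t (\<sigma> (Min e)) (\<sigma> (Max e))" and ?B = "\<lambda>t. \<Prod>i<n. Q t (\<sigma> i)"
  have "(?A has_real_derivative ?A t * (\<Sum>e\<in>E. dxi P t (\<sigma> (Min e)) (\<sigma> (Max e)))) (at t)"
    by (rule DERIV_prod_log[of E "\<lambda>e t. P t (\<sigma> (Min e)) (\<sigma> (Max e))"]) (rule H1_pair_deriv(1)[OF H1])
  moreover have "(?B has_real_derivative ?B t * (\<Sum>i<n. dxib Q t (\<sigma> i))) (at t)"
    by (rule DERIV_prod_log[of _ "\<lambda>i t. Q t (\<sigma> i)"]) (rule H1_vertex_deriv(2)[OF H1])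
  ultimately have "((\<lambda>t. ?A t * ?B t) has_real_derivative
      ?A t * (\<Sum>e\<in>E. dxi P t (\<sigma> (Min e)) (\<sigma> (Max e))) * ?B t + ?B t * (\<Sum>i<n. dxib Q t (\<sigma> i)) * ?A t) (at t)"
    by (rule DERIV_mult)
  then show ?thesis
    unfolding gweight_def log_deriv_def by (rule DERIV_cong) (simp only: distrib_left mult_ac)
qed

lemma gibbs_exp_sum:
  "gibbs_exp P Q \<beta> B n E (\<lambda>\<sigma>. \<Sum>i\<in>I. f i \<sigma>) = (\<Sum>i\<in>I. gibbs_exp P Q \<beta> B n E (f i))"
  unfolding gibbs_exp_def sum_divide_distrib[symmetric] sum_distrib_left by (subst sum.swap) simp

lemma gibbs_exp_add:
  "gibbs_exp P Q \<beta> B n E (\<lambda>\<sigma>. f \<sigma> + g \<sigma>) = gibbs_exp P Q \<beta> B n E f + gibbs_exp P Q \<beta> B n E g"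
  by (simp add: gibbs_exp_def distrib_left sum.distrib add_divide_distrib)

lemma gibbs_exp_cmult:
  "gibbs_exp P Q \<beta> B n E (\<lambda>\<sigma>. c * f \<sigma>) = c * gibbs_exp P Q \<beta> B n E f"
  by (simp add: gibbs_exp_def mult.left_commute[of _ c] flip: sum_distrib_left)

lemma gibbs_exp_le:
  assumes "\<And>\<sigma>. \<bar>f \<sigma>\<bar> \<le> c"
  shows "\<bar>gibbs_exp P Q \<beta> B n E f\<bar> \<le> c"
  unfolding gibbs_exp_def Zg_def
  by (intro abs_weighted_mean_le gweight_nonneg assms order_trans[OF abs_ge_zero assms])

text \<open>The derivative of \<open>ln Zg\<close> for one graph; its mean over the random graph,
  divided by \<open>n\<close>, is \<open>aen\<close> plus \<open>avxn\<close>.\<close>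

definition edge_vertex_mean :: "real \<Rightarrow> nat \<Rightarrow> nat set set \<Rightarrow> real" where
  "edge_vertex_mean t n E = 1/2 * (\<Sum>i<n. \<Sum>j\<in>nbrs E i. gibbs_exp P Q t t n E (\<lambda>\<sigma>. dxi P t (\<sigma> i) (\<sigma> j)))
     + (\<Sum>i<n. gibbs_exp P Q t t n E (\<lambda>\<sigma>. dxib Q t (\<sigma> i)))"

lemma dxi_sym: "dxi P t s s' = dxi P t s' s"
proof -
  have "P = (\<lambda>b x y. P b y x)" using spec unfolding spec_def by (intro ext) blast
  from arg_cong[OF this, of "\<lambda>P. dxi P t s s'"] show ?thesis by (simp only: dxi_def)
qed

lemma ln_Zg_deriv:
  assumes E: "graph_on n E"
  shows "((\<lambda>t. ln (Zg P Q t t n E)) has_real_derivative edge_vertex_mean t n E) (at t)"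
proof -
  have Z: "((\<lambda>t. Zg P Q t t n E) has_real_derivative (\<Sum>\<sigma>\<in>configs n. gweight P Q t t n E \<sigma> * log_deriv t n E \<sigma>)) (at t)"
    unfolding Zg_def by (intro DERIV_sum gweight_deriv)
  have "((\<lambda>t. ln (Zg P Q t t n E)) has_real_derivative
     1 / Zg P Q t t n E * (\<Sum>\<sigma>\<in>configs n. gweight P Q t t n E \<sigma> * log_deriv t n E \<sigma>)) (at t)"
    using DERIV_chain2[OF DERIV_ln_divide[OF Zg_pos[OF E]] Z] by simp
  also have "1 / Zg P Q t t n E * (\<Sum>\<sigma>\<in>configs n. gweight P Q t t n E \<sigma> * log_deriv t n E \<sigma>)
     = gibbs_exp P Q t t n E (log_deriv t n E)"
    by (simp add: gibbs_exp_def)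
  also have "log_deriv t n E = (\<lambda>\<sigma>. 1/2 * (\<Sum>i<n. \<Sum>j\<in>nbrs E i. dxi P t (\<sigma> i) (\<sigma> j)) + (\<Sum>i<n. dxib Q t (\<sigma> i)))"
    unfolding log_deriv_def by (intro ext arg_cong2[where f = "(+)"] refl sum_edges[OF E] dxi_sym)
  also have "gibbs_exp P Q t t n E \<dots> = edge_vertex_mean t n E"
    unfolding gibbs_exp_add gibbs_exp_cmult gibbs_exp_sum edge_vertex_mean_def ..
  finally show ?thesis .
qed

lemma edge_vertex_mean_continuous:
  assumes E: "graph_on n E"
  shows "continuous_on S (\<lambda>t. edge_vertex_mean t n E)"
proof -
  have g: "continuous_on S (\<lambda>t. gweight P Q t t n E \<sigma>)" for \<sigma>
    using gweight_deriv by (meson DERIV_isCont continuous_at_imp_continuous_on)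
  have Z: "Zg P Q t t n E \<noteq> 0" for t using Zg_pos[OF E, of t t] by simp
  have ZS: "continuous_on S (\<lambda>t. Zg P Q t t n E)" unfolding Zg_def by (intro continuous_intros g)
  show ?thesis
    unfolding edge_vertex_mean_def gibbs_exp_def
    by (intro continuous_intros g ZS H1_pair_deriv(2)[OF H1] H1_vertex_deriv(3)[OF H1] ballI Z)
qed

end

section \<open>Expectations over the random graph\<close>

text \<open>There are finitely many graphs on \<open>n\<close> vertices, so expectations over
  \<open>G n\<close> are finite sums and commute with derivatives.\<close>

lemma finite_set_pmf_graph:
  assumes "\<And>E. E \<in> set_pmf (G n) \<Longrightarrow> graph_on n E"
  shows "finite (set_pmf (G n))"
proof (rule finite_subset)
  show "set_pmf (G n) \<subseteq> Pow (Pow {..<n})" using assms by (fastforce simp: graph_on_def)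
qed auto

lemma expectation_pmf_finite:
  fixes f :: "'a \<Rightarrow> real"
  assumes "finite (set_pmf p)"
  shows "measure_pmf.expectation p f = (\<Sum>x\<in>set_pmf p. pmf p x * f x)"
  using integral_measure_pmf[OF assms, of p f] by simp

lemma abs_expectation_pmf_le:
  fixes f :: "'a \<Rightarrow> real"
  assumes "finite (set_pmf p)" "\<And>x. x \<in> set_pmf p \<Longrightarrow> \<bar>f x\<bar> \<le> g x"
  shows "\<bar>measure_pmf.expectation p f\<bar> \<le> measure_pmf.expectation p g"
  unfolding expectation_pmf_finite[OF assms(1)]
  by (intro sum_abs[THEN order_trans] sum_mono) (auto simp: abs_mult intro!: mult_left_mono assms)

text \<open>Uniform sparsity at a single level \<open>L\<close>: degrees below \<open>L\<close>
  contribute at most \<open>L\<close> to the mean, the others eventually less than 1.\<close>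

lemma mean_degree_bounded:
  assumes "lwc G \<mu>"
  shows "\<exists>D\<ge>0. eventually (\<lambda>n. En G n (\<lambda>E i. real (gdeg E i)) \<le> D) sequentially"
proof -
  have gr: "\<And>n E. E \<in> set_pmf (G n) \<Longrightarrow> graph_on n E" using assms by (auto simp: lwc_def)
  let ?X = "\<lambda>(L::nat) n. En G n (\<lambda>E i. real (gdeg E i) * (if gdeg E i \<ge> L then 1 else 0))"
  have "(\<lambda>L. limsup (\<lambda>n. ereal (?X L n))) \<longlonglongrightarrow> 0" using assms by (simp add: lwc_def)
  then have "eventually (\<lambda>L. limsup (\<lambda>n. ereal (?X L n)) < 1) sequentially"
    by (rule order_tendstoD) simp
  then obtain L where L: "limsup (\<lambda>n. ereal (?X L n)) < 1" using eventually_happens by force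
  then have ev: "eventually (\<lambda>n. ereal (?X L n) < 1) sequentially" by (rule Limsup_lessD)
  have le: "En G n (\<lambda>E i. real (gdeg E i)) \<le> real L + ?X L n" for n
  proof -
    have fin: "finite (set_pmf (G n))" using gr by (rule finite_set_pmf_graph)
    have "(\<Sum>i<n. real (gdeg E i)) / real n \<le> real L + (\<Sum>i<n. real (gdeg E i) * (if gdeg E i \<ge> L then 1 else 0)) / real n" for E
    proof (cases "n = 0")
      case False
      have "(\<Sum>i<n. real (gdeg E i)) \<le> (\<Sum>i<n. real L + real (gdeg E i) * (if gdeg E i \<ge> L then 1 else 0))"
        by (rule sum_mono) auto
      also have "\<dots> = real n * real L + (\<Sum>i<n. real (gdeg E i) * (if gdeg E i \<ge> L then 1 else 0))"
        by (simp add: sum.distrib)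
      finally show ?thesis using False by (simp add: field_simps)
    qed simp
    then have "En G n (\<lambda>E i. real (gdeg E i)) \<le> (\<Sum>E\<in>set_pmf (G n). pmf (G n) E * (real L + (\<Sum>i<n. real (gdeg E i) * (if gdeg E i \<ge> L then 1 else 0)) / real n))"
      unfolding En_def expectation_pmf_finite[OF fin] by (intro sum_mono mult_left_mono) auto
    also have "\<dots> = real L + ?X L n"
      unfolding En_def expectation_pmf_finite[OF fin] distrib_left sum.distrib
      by (simp add: sum_distrib_right[symmetric] sum_pmf_eq_1[OF fin])
    finally show ?thesis .
  qed
  show ?thesis
  proof (intro exI[of _ "real L + 1"] conjI)
    show "eventually (\<lambda>n. En G n (\<lambda>E i. real (gdeg E i)) \<le> real L + 1) sequentially"
      using ev
    proof eventually_elim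
      case (elim n) then show ?case using le[of n] by (simp add: one_ereal_def)
    qed
  qed simp
qed

lemma phin_increment:
  fixes P :: "real \<Rightarrow> 'x::finite \<Rightarrow> 'x \<Rightarrow> real"
  assumes spec: "spec P Q" and H1: "H1 P Q" and gr: "\<And>E. E \<in> set_pmf (G n) \<Longrightarrow> graph_on n E"
  shows "((\<lambda>t. phin P Q G n t t) has_real_derivative (aen P Q G n t t + avxn P Q G n t t)) (at t)"
    and "continuous_on S (\<lambda>t. aen P Q G n t t + avxn P Q G n t t)"
proof -
  have fin: "finite (set_pmf (G n))" using gr by (rule finite_set_pmf_graph)
  let ?m = "edge_vertex_mean P Q"
  have eq: "aen P Q G n t t + avxn P Q G n t t = (\<Sum>E\<in>set_pmf (G n). pmf (G n) E * ?m t n E) / real n" for t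
    unfolding aen_def avxn_def En_def expectation_pmf_finite[OF fin] edge_vertex_mean_def[OF spec H1]
    by (simp add: sum_divide_distrib sum_distrib_left sum.distrib[symmetric] distrib_left add_divide_distrib mult_ac)
  have "((\<lambda>t. (\<Sum>E\<in>set_pmf (G n). pmf (G n) E * ln (Zg P Q t t n E)) / real n) has_real_derivative
      (\<Sum>E\<in>set_pmf (G n). pmf (G n) E * ?m t n E) / real n) (at t)"
    by (intro DERIV_cdivide DERIV_sum DERIV_cmult ln_Zg_deriv[OF spec H1] gr)
  then show "((\<lambda>t. phin P Q G n t t) has_real_derivative (aen P Q G n t t + avxn P Q G n t t)) (at t)"
    unfolding eq phin_def expectation_pmf_finite[OF fin] .
  show "continuous_on S (\<lambda>t. aen P Q G n t t + avxn P Q G n t t)"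
    unfolding eq divide_inverse
    by (intro continuous_on_mult_right continuous_on_sum continuous_on_mult_left edge_vertex_mean_continuous[OF spec H1] gr)
qed

text \<open>The edge part is bounded through the mean degree, the vertex part by the bound on
  \<open>dxib\<close>. The result dominates when the hypothesis on the derivatives is integrated
  over the parameter.\<close>

lemma phin_slope_bounded:
  fixes P :: "real \<Rightarrow> 'x::finite \<Rightarrow> 'x \<Rightarrow> real"
  assumes spec: "spec P Q" and H1: "H1 P Q" and lwc: "lwc G \<mu>"
  shows "\<exists>K. eventually (\<lambda>n. \<forall>t\<in>{a..b}. \<bar>aen P Q G n t t + avxn P Q G n t t\<bar> \<le> K) sequentially"
proof -
  obtain K1 where K1: "K1 \<ge> 1" "\<And>t i. t \<in> {a..b} \<Longrightarrow> \<bar>dxi P t (fst i) (snd i)\<bar> \<le> K1"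
    using finite_continuous_bound[of UNIV a b "\<lambda>i t. dxi P t (fst i) (snd i)"] H1_pair_deriv(2)[OF H1] by auto
  obtain K2 where K2: "K2 \<ge> 1" "\<And>t s. t \<in> {a..b} \<Longrightarrow> \<bar>dxib Q t s\<bar> \<le> K2"
    using finite_continuous_bound[of UNIV a b "\<lambda>s t. dxib Q t s"] H1_vertex_deriv(3)[OF H1] by auto
  obtain D where D: "D \<ge> 0" "eventually (\<lambda>n. En G n (\<lambda>E i. real (gdeg E i)) \<le> D) sequentially"
    using mean_degree_bounded[OF lwc] by blast
  have gr: "\<And>n E. E \<in> set_pmf (G n) \<Longrightarrow> graph_on n E" using lwc by (auto simp: lwc_def)
  have "eventually (\<lambda>n. \<forall>t\<in>{a..b}. \<bar>aen P Q G n t t + avxn P Q G n t t\<bar> \<le> K1 * D + K2) sequentially"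
    using D(2)
  proof eventually_elim
    case (elim n)
    have fin: "finite (set_pmf (G n))" using gr by (rule finite_set_pmf_graph)
    show ?case
    proof
      fix t assume t: "t \<in> {a..b}"
      have "\<bar>En G n (\<lambda>E i. \<Sum>j\<in>nbrs E i. gibbs_exp P Q t t n E (\<lambda>\<sigma>. dxi P t (\<sigma> i) (\<sigma> j)))\<bar>
          \<le> measure_pmf.expectation (G n) (\<lambda>E. K1 * ((\<Sum>i<n. real (gdeg E i)) / real n))"
        unfolding En_def
      proof (rule abs_expectation_pmf_le[OF fin])
        fix E
        have "\<bar>\<Sum>i<n. \<Sum>j\<in>nbrs E i. gibbs_exp P Q t t n E (\<lambda>\<sigma>. dxi P t (\<sigma> i) (\<sigma> j))\<bar> \<le> (\<Sum>i<n. \<Sum>j\<in>nbrs E i. K1)"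
          using K1(2)[OF t, of "(_, _)"]
          by (intro sum_abs[THEN order_trans] sum_mono gibbs_exp_le[OF spec H1]) auto
        also have "\<dots> = K1 * (\<Sum>i<n. real (gdeg E i))" by (simp add: gdeg_def sum_distrib_left mult.commute)
        finally show "\<bar>(\<Sum>i<n. \<Sum>j\<in>nbrs E i. gibbs_exp P Q t t n E (\<lambda>\<sigma>. dxi P t (\<sigma> i) (\<sigma> j))) / real n\<bar>
            \<le> K1 * ((\<Sum>i<n. real (gdeg E i)) / real n)"
          by (simp add: divide_right_mono)
      qed
      also have "\<dots> = K1 * En G n (\<lambda>E i. real (gdeg E i))" by (simp add: En_def)
      also have "\<dots> \<le> K1 * D" using elim K1(1) by (intro mult_left_mono) auto
      finally have e: "\<bar>aen P Q G n t t\<bar> \<le> K1 * D" unfolding aen_def by simp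
      have "\<bar>avxn P Q G n t t\<bar> \<le> measure_pmf.expectation (G n) (\<lambda>E. K2)"
        unfolding avxn_def En_def
      proof (rule abs_expectation_pmf_le[OF fin])
        fix E
        have "\<bar>\<Sum>i<n. gibbs_exp P Q t t n E (\<lambda>\<sigma>. dxib Q t (\<sigma> i))\<bar> \<le> (\<Sum>i<n. K2)"
          using K2(2)[OF t] by (intro sum_abs[THEN order_trans] sum_mono gibbs_exp_le[OF spec H1]) auto
        then show "\<bar>(\<Sum>i<n. gibbs_exp P Q t t n E (\<lambda>\<sigma>. dxib Q t (\<sigma> i))) / real n\<bar> \<le> K2"
          using K2(1) by (cases "n = 0") (auto simp: field_simps)
      qed
      then have v: "\<bar>avxn P Q G n t t\<bar> \<le> K2" by simp
      show "\<bar>aen P Q G n t t + avxn P Q G n t t\<bar> \<le> K1 * D + K2"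
        by (rule order_trans[OF abs_triangle_ineq add_mono[OF e v]])
    qed
  qed
  then show ?thesis by blast
qed

section \<open>Integrating the derivatives\<close>

text \<open>A reverse Fatou lemma: the positive part of \<open>A n - \<alpha>\<close> tends to 0
  pointwise and is eventually dominated, so its integral tends to 0.\<close>

lemma limsup_integral_le:
  fixes A :: "nat \<Rightarrow> real \<Rightarrow> real"
  assumes A: "\<And>n. continuous_on {a..b} (A n)"
    and bnd: "eventually (\<lambda>n. \<forall>t\<in>{a..b}. \<bar>A n t\<bar> \<le> K) sequentially"
    and \<alpha>: "continuous_on {a..b} \<alpha>"
    and le: "\<And>t. t \<in> {a..b} \<Longrightarrow> limsup (\<lambda>n. ereal (A n t)) \<le> ereal (\<alpha> t)"
  shows "limsup (\<lambda>n. ereal (integral {a..b} (A n))) \<le> ereal (integral {a..b} \<alpha>)"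
proof -
  obtain n0 where n0: "\<And>n t. n \<ge> n0 \<Longrightarrow> t \<in> {a..b} \<Longrightarrow> \<bar>A n t\<bar> \<le> K"
    using bnd unfolding eventually_sequentially by blast
  define B where "B n t = max (A n t - \<alpha> t) 0" for n t
  have contB: "continuous_on {a..b} (B n)" for n
    unfolding B_def by (intro continuous_intros A \<alpha>)
  have B0: "(\<lambda>n. B n t) \<longlonglongrightarrow> 0" if t: "t \<in> {a..b}" for t
  proof (rule order_tendstoI)
    fix x :: real assume "x < 0"
    then show "eventually (\<lambda>n. x < B n t) sequentially" by (auto simp: B_def less_max_iff_disj)
  next
    fix x :: real assume x: "0 < x"
    have "limsup (\<lambda>n. ereal (A n t)) < ereal (\<alpha> t + x)" by (rule le_less_trans[OF le[OF t]]) (use x in simp)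
    then have "eventually (\<lambda>n. ereal (A n t) < ereal (\<alpha> t + x)) sequentially" by (rule Limsup_lessD)
    then show "eventually (\<lambda>n. B n t < x) sequentially"
      by eventually_elim (use x in \<open>auto simp: B_def\<close>)
  qed
  \<comment> \<open>The domination holds only from \<open>n0\<close> on, while the convergence
    theorem asks for it at every index; hence the shift.\<close>
  have "(\<lambda>n. integral {a..b} (B (n + n0))) \<longlonglongrightarrow> integral {a..b} (\<lambda>_. 0)"
  proof (rule dominated_convergence(2)[where h = "\<lambda>t. K + \<bar>\<alpha> t\<bar>"])
    show "B (n + n0) integrable_on {a..b}" for n by (rule integrable_continuous_interval[OF contB])
    show "(\<lambda>t. K + \<bar>\<alpha> t\<bar>) integrable_on {a..b}" by (intro integrable_continuous_interval continuous_intros \<alpha>)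
    show "norm (B (n + n0) t) \<le> K + \<bar>\<alpha> t\<bar>" if "t \<in> {a..b}" for n t
      using n0[OF _ that, of "n + n0"] by (auto simp: B_def max_def abs_if split: if_splits)
    show "(\<lambda>n. B (n + n0) t) \<longlonglongrightarrow> 0" if "t \<in> {a..b}" for t
      by (rule LIMSEQ_ignore_initial_segment[OF B0[OF that]])
  qed
  then have "(\<lambda>n. integral {a..b} (B n)) \<longlonglongrightarrow> 0" by (simp add: LIMSEQ_offset)
  then have "(\<lambda>n. integral {a..b} \<alpha> + integral {a..b} (B n)) \<longlonglongrightarrow> integral {a..b} \<alpha> + 0"
    by (intro tendsto_intros)
  then have lim: "limsup (\<lambda>n. ereal (integral {a..b} \<alpha> + integral {a..b} (B n))) = ereal (integral {a..b} \<alpha>)"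
    by (intro lim_imp_Limsup) auto
  have "integral {a..b} (A n) \<le> integral {a..b} \<alpha> + integral {a..b} (B n)" for n
  proof -
    have "integral {a..b} (A n) \<le> integral {a..b} (\<lambda>t. \<alpha> t + B n t)"
      by (rule integral_le)
         (auto simp: B_def intro!: integrable_continuous_interval continuous_intros A \<alpha>)
    also have "\<dots> = integral {a..b} \<alpha> + integral {a..b} (B n)"
      by (rule Henstock_Kurzweil_Integration.integral_add) (intro integrable_continuous_interval \<alpha> contB)+
    finally show ?thesis .
  qed
  then have "limsup (\<lambda>n. ereal (integral {a..b} (A n))) \<le> limsup (\<lambda>n. ereal (integral {a..b} \<alpha> + integral {a..b} (B n)))"
    by (intro Limsup_mono always_eventually) simp
  then show ?thesis unfolding lim .
qed

lemma liminf_integral_ge: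
  fixes A :: "nat \<Rightarrow> real \<Rightarrow> real"
  assumes A: "\<And>n. continuous_on {a..b} (A n)"
    and bnd: "eventually (\<lambda>n. \<forall>t\<in>{a..b}. \<bar>A n t\<bar> \<le> K) sequentially"
    and \<alpha>: "continuous_on {a..b} \<alpha>"
    and ge: "\<And>t. t \<in> {a..b} \<Longrightarrow> ereal (\<alpha> t) \<le> liminf (\<lambda>n. ereal (A n t))"
  shows "ereal (integral {a..b} \<alpha>) \<le> liminf (\<lambda>n. ereal (integral {a..b} (A n)))"
proof -
  have neg: "limsup (\<lambda>n. ereal (- f n)) = - liminf (\<lambda>n. ereal (f n))" for f :: "nat \<Rightarrow> real"
    using ereal_Limsup_uminus[of sequentially "\<lambda>n. ereal (f n)"] by simp
  have "limsup (\<lambda>n. ereal (integral {a..b} (\<lambda>t. - A n t))) \<le> ereal (integral {a..b} (\<lambda>t. - \<alpha> t))"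
  proof (rule limsup_integral_le[where K = K])
    show "limsup (\<lambda>n. ereal (- A n t)) \<le> ereal (- \<alpha> t)" if "t \<in> {a..b}" for t
      unfolding neg using ge[OF that] by (simp add: ereal_uminus_le_reorder)
  qed (use A \<alpha> bnd in \<open>auto intro!: continuous_intros\<close>)
  then show ?thesis
    by (simp add: Henstock_Kurzweil_Integration.integral_neg neg ereal_uminus_le_reorder)
qed

text \<open>Both increments are integrals over the parameter, of \<open>A n\<close> by Gibbs'
  formula and of \<open>\<alpha>\<close> by \<open>Phi_increment\<close>, so only the integrands
  remain to be compared.\<close>

lemma phin_increment_bounds:
  fixes P :: "real \<Rightarrow> 'x::finite \<Rightarrow> 'x \<Rightarrow> real" and h :: "real \<Rightarrow> dtree \<Rightarrow> 'x \<Rightarrow> real"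
  assumes ab: "a < b" and spec: "spec P Q" and H1: "H1 P Q" and lwc: "lwc G \<mu>" and H2: "H2 \<mu> P"
    and h: "\<And>t s. (\<lambda>e. h t e s) \<in> borel_measurable dtreeM" "\<And>t e s. 0 \<le> h t e s" "\<And>t e. (\<Sum>s\<in>UNIV. h t e s) = 1"
    and fx: "\<And>t. t \<in> {a..b} \<Longrightarrow> AE e in mu_up \<mu>. h t e = BP P Q (\<lambda>_. h) t t e"
    and bv: "AE e in mu_up \<mu>. \<forall>s. continuous_on {a..b} (\<lambda>t. h t e s) \<and> tv (\<lambda>t. h t e s) a b \<le> ereal C"
  defines "A \<equiv> \<lambda>n t. aen P Q G n t t + avxn P Q G n t t"
    and "\<alpha> \<equiv> \<lambda>t. ae \<mu> P Q (\<lambda>_. h) t t + avx \<mu> P Q (\<lambda>_. h) t t"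
    and "inc \<equiv> \<lambda>n. phin P Q G n b b - phin P Q G n a a"
    and "Inc \<equiv> Phi \<mu> P Q (\<lambda>_. h) b b - Phi \<mu> P Q (\<lambda>_. h) a a"
  shows "(\<forall>t\<in>{a..b}. limsup (\<lambda>n. ereal (A n t)) \<le> ereal (\<alpha> t)) \<Longrightarrow> limsup (\<lambda>n. ereal (inc n)) \<le> ereal Inc"
    and "(\<forall>t\<in>{a..b}. liminf (\<lambda>n. ereal (A n t)) \<ge> ereal (\<alpha> t)) \<Longrightarrow> liminf (\<lambda>n. ereal (inc n)) \<ge> ereal Inc"
proof -
  have "\<exists>p K \<kappa>. bethe P Q h \<mu> a b p K \<kappa> C" by (rule betheI[OF ab spec H1 lwc H2 h fx bv])
  then obtain p K \<kappa> where "bethe P Q h \<mu> a b p K \<kappa> C" by blast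
  then interpret bethe P Q h \<mu> a b p K \<kappa> C .
  have slope: "slope = \<alpha>" unfolding \<alpha>_def by (rule ext) (rule slope_def)
  have \<alpha>: "continuous_on {a..b} \<alpha>" and Inc: "Inc = integral {a..b} \<alpha>"
    using slope_continuous Phi_increment unfolding slope Inc_def .
  have gr: "\<And>n E. E \<in> set_pmf (G n) \<Longrightarrow> graph_on n E" using lwc by (auto simp: lwc_def)
  have A: "continuous_on {a..b} (A n)" for n
    unfolding A_def by (rule phin_increment(2)[OF spec H1]) (rule gr)
  have "((\<lambda>t. phin P Q G n t t) has_vector_derivative A n t) (at t within {a..b})" for n t
    unfolding A_def has_real_derivative_iff_has_vector_derivative[symmetric]
    by (rule has_field_derivative_at_within, rule phin_increment(1)[OF spec H1]) (rule gr)
  then have "(A n has_integral (phin P Q G n b b - phin P Q G n a a)) {a..b}" for n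
    by (rule fundamental_theorem_of_calculus[OF less_imp_le[OF ab]])
  then have inc: "inc n = integral {a..b} (A n)" for n
    unfolding inc_def by (rule integral_unique[symmetric])
  obtain L where L: "eventually (\<lambda>n. \<forall>t\<in>{a..b}. \<bar>A n t\<bar> \<le> L) sequentially"
    using phin_slope_bounded[OF spec H1 lwc] unfolding A_def by blast
  show "limsup (\<lambda>n. ereal (inc n)) \<le> ereal Inc" if "\<forall>t\<in>{a..b}. limsup (\<lambda>n. ereal (A n t)) \<le> ereal (\<alpha> t)"
    unfolding inc Inc by (rule limsup_integral_le[OF A L \<alpha>]) (use that in blast)
  show "liminf (\<lambda>n. ereal (inc n)) \<ge> ereal Inc" if "\<forall>t\<in>{a..b}. liminf (\<lambda>n. ereal (A n t)) \<ge> ereal (\<alpha> t)"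
    unfolding inc Inc by (rule liminf_integral_ge[OF A L \<alpha>]) (use that in blast)
qed

section \<open>Freezing one of the two parameters\<close>

lemma C1_const: "C1 (\<lambda>_. c)"
  unfolding C1_def by (rule exI[of _ "\<lambda>_. 0"]) auto

lemma H1_const_vertex: "H1 \<psi> \<psi>b \<Longrightarrow> H1 \<psi> (\<lambda>_. \<psi>b B)"
  by (simp add: H1_def C1_const)

lemma H1_const_pair:
  assumes "H1 \<psi> \<psi>b" shows "H1 (\<lambda>_. \<psi> \<beta>) \<psi>b"
proof -
  have "(\<forall>b::real. \<psi> \<beta> s s' = 0) \<or> ((\<forall>b::real. \<psi> \<beta> s s' > 0) \<and> C1 (\<lambda>_. ln (\<psi> \<beta> s s')))" for s s'
    using assms C1_const unfolding H1_def by blast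
  then show ?thesis using assms unfolding H1_def by blast
qed

lemma H2_const_pair:
  assumes "H2 \<mu> \<psi>" shows "H2 \<mu> (\<lambda>_. \<psi> \<beta>)"
  using assms unfolding H2_def by blast

lemma message_measurable:
  assumes "is_message h"
  shows "(\<lambda>e. h \<beta> B e s) \<in> borel_measurable dtreeM"
proof -
  have m: "(\<lambda>(p, e). h (fst p) (snd p) e s) \<in> borel_measurable ((borel \<Otimes>\<^sub>M borel) \<Otimes>\<^sub>M dtreeM)"
    using assms by (simp add: is_message_def)
  have "(\<lambda>e. ((\<beta>, B), e)) \<in> dtreeM \<rightarrow>\<^sub>M (borel \<Otimes>\<^sub>M borel) \<Otimes>\<^sub>M dtreeM"
    by (rule measurable_Pair1') (simp add: space_pair_measure)
  from measurable_compose[OF this m] show ?thesis by simp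
qed

lemma message_dist:
  assumes "is_message h"
  shows "0 \<le> h \<beta> B e s" "(\<Sum>s\<in>UNIV. h \<beta> B e s) = 1"
  using assms unfolding is_message_def by blast+

lemma beta_increment_bounds:
  fixes h :: "'x::finite message"
  assumes "spec \<psi> \<psi>b" "H1 \<psi> \<psi>b" "lwc G \<mu>" "H2 \<mu> \<psi>"
    and "\<beta>0 < \<beta>1" "is_message h" "fixed_on \<mu> \<psi> \<psi>b h ({\<beta>0..\<beta>1} \<times> {B})" "H3beta \<mu> h B \<beta>0 \<beta>1"
  shows "(\<forall>\<beta>\<in>{\<beta>0..\<beta>1}. limsup (\<lambda>n. ereal (aen \<psi> \<psi>b G n \<beta> B)) \<le> ereal (ae \<mu> \<psi> \<psi>b h \<beta> B))
      \<Longrightarrow> limsup (\<lambda>n. ereal (phin \<psi> \<psi>b G n \<beta>1 B - phin \<psi> \<psi>b G n \<beta>0 B))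
            \<le> ereal (Phi \<mu> \<psi> \<psi>b h \<beta>1 B - Phi \<mu> \<psi> \<psi>b h \<beta>0 B)"
    and "(\<forall>\<beta>\<in>{\<beta>0..\<beta>1}. liminf (\<lambda>n. ereal (aen \<psi> \<psi>b G n \<beta> B)) \<ge> ereal (ae \<mu> \<psi> \<psi>b h \<beta> B))
      \<Longrightarrow> liminf (\<lambda>n. ereal (phin \<psi> \<psi>b G n \<beta>1 B - phin \<psi> \<psi>b G n \<beta>0 B))
            \<ge> ereal (Phi \<mu> \<psi> \<psi>b h \<beta>1 B - Phi \<mu> \<psi> \<psi>b h \<beta>0 B)"
proof -
  let ?Q = "\<lambda>_::real. \<psi>b B" and ?k = "\<lambda>t. h t B"
  obtain C where C: "AE e in mu_up \<mu>. \<forall>s. continuous_on {\<beta>0..\<beta>1} (\<lambda>t. ?k t e s) \<and> tv (\<lambda>t. ?k t e s) \<beta>0 \<beta>1 \<le> ereal C"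
    using assms(8) unfolding H3beta_def by blast
  have spec: "spec \<psi> ?Q" using assms(1) by (simp add: spec_def)
  have BP: "BP \<psi> ?Q (\<lambda>_. ?k) t t = BP \<psi> \<psi>b h t B" for t
    by (intro ext) (simp add: BP_def bpu_def)
  have fx: "AE e in mu_up \<mu>. ?k t e = BP \<psi> ?Q (\<lambda>_. ?k) t t e" if "t \<in> {\<beta>0..\<beta>1}" for t
    using assms(7) that by (simp add: fixed_on_def BP)
  have eqs: "phin \<psi> ?Q G n t t = phin \<psi> \<psi>b G n t B" "aen \<psi> ?Q G n t t = aen \<psi> \<psi>b G n t B"
    "avxn \<psi> ?Q G n t t = 0" "ae \<mu> \<psi> ?Q (\<lambda>_. ?k) t t = ae \<mu> \<psi> \<psi>b h t B"
    "avx \<mu> \<psi> ?Q (\<lambda>_. ?k) t t = 0" "Phi \<mu> \<psi> ?Q (\<lambda>_. ?k) t t = Phi \<mu> \<psi> \<psi>b h t B" for n t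
    by (simp_all add: phin_def aen_def avxn_def En_def gibbs_exp_def Zg_def gweight_def dxib_def
        ae_def edgew_def bpu_def avx_def Phi_def PhiT_def rootw_def)
  note bounds = phin_increment_bounds[where h = ?k and Q = ?Q, OF assms(5) spec H1_const_vertex[OF assms(2)] assms(3,4)
      message_measurable[OF assms(6)] message_dist[OF assms(6)] fx C, unfolded eqs add_0_right]
  show "(\<forall>\<beta>\<in>{\<beta>0..\<beta>1}. limsup (\<lambda>n. ereal (aen \<psi> \<psi>b G n \<beta> B)) \<le> ereal (ae \<mu> \<psi> \<psi>b h \<beta> B))
      \<Longrightarrow> limsup (\<lambda>n. ereal (phin \<psi> \<psi>b G n \<beta>1 B - phin \<psi> \<psi>b G n \<beta>0 B))
            \<le> ereal (Phi \<mu> \<psi> \<psi>b h \<beta>1 B - Phi \<mu> \<psi> \<psi>b h \<beta>0 B)"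
    and "(\<forall>\<beta>\<in>{\<beta>0..\<beta>1}. liminf (\<lambda>n. ereal (aen \<psi> \<psi>b G n \<beta> B)) \<ge> ereal (ae \<mu> \<psi> \<psi>b h \<beta> B))
      \<Longrightarrow> liminf (\<lambda>n. ereal (phin \<psi> \<psi>b G n \<beta>1 B - phin \<psi> \<psi>b G n \<beta>0 B))
            \<ge> ereal (Phi \<mu> \<psi> \<psi>b h \<beta>1 B - Phi \<mu> \<psi> \<psi>b h \<beta>0 B)"
    by (rule bounds; assumption)+
qed

lemma B_increment_bounds:
  fixes h :: "'x::finite message"
  assumes "spec \<psi> \<psi>b" "H1 \<psi> \<psi>b" "lwc G \<mu>" "H2 \<mu> \<psi>"
    and "B0 < B1" "is_message h" "fixed_on \<mu> \<psi> \<psi>b h ({\<beta>} \<times> {B0..B1})" "H3B \<mu> h \<beta> B0 B1"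
  shows "(\<forall>B\<in>{B0..B1}. limsup (\<lambda>n. ereal (avxn \<psi> \<psi>b G n \<beta> B)) \<le> ereal (avx \<mu> \<psi> \<psi>b h \<beta> B))
      \<Longrightarrow> limsup (\<lambda>n. ereal (phin \<psi> \<psi>b G n \<beta> B1 - phin \<psi> \<psi>b G n \<beta> B0))
            \<le> ereal (Phi \<mu> \<psi> \<psi>b h \<beta> B1 - Phi \<mu> \<psi> \<psi>b h \<beta> B0)"
    and "(\<forall>B\<in>{B0..B1}. liminf (\<lambda>n. ereal (avxn \<psi> \<psi>b G n \<beta> B)) \<ge> ereal (avx \<mu> \<psi> \<psi>b h \<beta> B))
      \<Longrightarrow> liminf (\<lambda>n. ereal (phin \<psi> \<psi>b G n \<beta> B1 - phin \<psi> \<psi>b G n \<beta> B0))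
            \<ge> ereal (Phi \<mu> \<psi> \<psi>b h \<beta> B1 - Phi \<mu> \<psi> \<psi>b h \<beta> B0)"
proof -
  let ?P = "\<lambda>_::real. \<psi> \<beta>" and ?k = "\<lambda>t. h \<beta> t"
  obtain C where C: "AE e in mu_up \<mu>. \<forall>s. continuous_on {B0..B1} (\<lambda>t. ?k t e s) \<and> tv (\<lambda>t. ?k t e s) B0 B1 \<le> ereal C"
    using assms(8) unfolding H3B_def by blast
  have spec: "spec ?P \<psi>b" using assms(1) by (simp add: spec_def)
  have BP: "BP ?P \<psi>b (\<lambda>_. ?k) t t = BP \<psi> \<psi>b h \<beta> t" for t
    by (intro ext) (simp add: BP_def bpu_def)
  have fx: "AE e in mu_up \<mu>. ?k t e = BP ?P \<psi>b (\<lambda>_. ?k) t t e" if "t \<in> {B0..B1}" for t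
    using assms(7) that by (simp add: fixed_on_def BP)
  \<comment> \<open>Both branches of \<open>dxi\<close> give 0: the convention where the pair factor
    vanishes, the derivative of a constant elsewhere.\<close>
  have dxi: "dxi ?P t = (\<lambda>s s'. 0)" for t by (simp add: dxi_def fun_eq_iff)
  have eqs: "phin ?P \<psi>b G n t t = phin \<psi> \<psi>b G n \<beta> t" "avxn ?P \<psi>b G n t t = avxn \<psi> \<psi>b G n \<beta> t"
    "aen ?P \<psi>b G n t t = 0" "avx \<mu> ?P \<psi>b (\<lambda>_. ?k) t t = avx \<mu> \<psi> \<psi>b h \<beta> t"
    "ae \<mu> ?P \<psi>b (\<lambda>_. ?k) t t = 0" "Phi \<mu> ?P \<psi>b (\<lambda>_. ?k) t t = Phi \<mu> \<psi> \<psi>b h \<beta> t" for n t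
    by (simp_all add: phin_def aen_def avxn_def En_def gibbs_exp_def Zg_def gweight_def dxi
        ae_def avx_def Phi_def PhiT_def rootw_def)
  note bounds = phin_increment_bounds[where h = ?k and P = ?P, OF assms(5) spec H1_const_pair[OF assms(2)] assms(3) H2_const_pair[OF assms(4)]
      message_measurable[OF assms(6)] message_dist[OF assms(6)] fx C, unfolded eqs add_0_left]
  show "(\<forall>B\<in>{B0..B1}. limsup (\<lambda>n. ereal (avxn \<psi> \<psi>b G n \<beta> B)) \<le> ereal (avx \<mu> \<psi> \<psi>b h \<beta> B))
      \<Longrightarrow> limsup (\<lambda>n. ereal (phin \<psi> \<psi>b G n \<beta> B1 - phin \<psi> \<psi>b G n \<beta> B0))
            \<le> ereal (Phi \<mu> \<psi> \<psi>b h \<beta> B1 - Phi \<mu> \<psi> \<psi>b h \<beta> B0)"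
    and "(\<forall>B\<in>{B0..B1}. liminf (\<lambda>n. ereal (avxn \<psi> \<psi>b G n \<beta> B)) \<ge> ereal (avx \<mu> \<psi> \<psi>b h \<beta> B))
      \<Longrightarrow> liminf (\<lambda>n. ereal (phin \<psi> \<psi>b G n \<beta> B1 - phin \<psi> \<psi>b G n \<beta> B0))
            \<ge> ereal (Phi \<mu> \<psi> \<psi>b h \<beta> B1 - Phi \<mu> \<psi> \<psi>b h \<beta> B0)"
    by (rule bounds; assumption)+
qed

theorem mainTheorem5:
  fixes \<psi> :: "real \<Rightarrow> 'x::finite \<Rightarrow> 'x \<Rightarrow> real" and \<psi>b :: "real \<Rightarrow> 'x \<Rightarrow> real"
    and G :: "nat \<Rightarrow> nat set set pmf" and \<mu> :: "utree measure"
  assumes "spec \<psi> \<psi>b" and "H1 \<psi> \<psi>b" and "lwc G \<mu>" and "H2 \<mu> \<psi>"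
  shows
    "(\<forall>B \<beta>0 \<beta>1 (h :: 'x message).
        \<beta>0 < \<beta>1 \<and> is_message h \<and> fixed_on \<mu> \<psi> \<psi>b h ({\<beta>0..\<beta>1} \<times> {B}) \<and> H3beta \<mu> h B \<beta>0 \<beta>1 \<and>
        (\<forall>\<beta>\<in>{\<beta>0..\<beta>1}. limsup (\<lambda>n. ereal (aen \<psi> \<psi>b G n \<beta> B)) \<le> ereal (ae \<mu> \<psi> \<psi>b h \<beta> B))
      \<longrightarrow> limsup (\<lambda>n. ereal (phin \<psi> \<psi>b G n \<beta>1 B - phin \<psi> \<psi>b G n \<beta>0 B))
            \<le> ereal (Phi \<mu> \<psi> \<psi>b h \<beta>1 B - Phi \<mu> \<psi> \<psi>b h \<beta>0 B))
   \<and> (\<forall>B \<beta>0 \<beta>1 (h :: 'x message).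
        \<beta>0 < \<beta>1 \<and> is_message h \<and> fixed_on \<mu> \<psi> \<psi>b h ({\<beta>0..\<beta>1} \<times> {B}) \<and> H3beta \<mu> h B \<beta>0 \<beta>1 \<and>
        (\<forall>\<beta>\<in>{\<beta>0..\<beta>1}. liminf (\<lambda>n. ereal (aen \<psi> \<psi>b G n \<beta> B)) \<ge> ereal (ae \<mu> \<psi> \<psi>b h \<beta> B))
      \<longrightarrow> liminf (\<lambda>n. ereal (phin \<psi> \<psi>b G n \<beta>1 B - phin \<psi> \<psi>b G n \<beta>0 B))
            \<ge> ereal (Phi \<mu> \<psi> \<psi>b h \<beta>1 B - Phi \<mu> \<psi> \<psi>b h \<beta>0 B))
   \<and> (\<forall>\<beta> B0 B1 (h :: 'x message).
        B0 < B1 \<and> is_message h \<and> fixed_on \<mu> \<psi> \<psi>b h ({\<beta>} \<times> {B0..B1}) \<and> H3B \<mu> h \<beta> B0 B1 \<and>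
        (\<forall>B\<in>{B0..B1}. limsup (\<lambda>n. ereal (avxn \<psi> \<psi>b G n \<beta> B)) \<le> ereal (avx \<mu> \<psi> \<psi>b h \<beta> B))
      \<longrightarrow> limsup (\<lambda>n. ereal (phin \<psi> \<psi>b G n \<beta> B1 - phin \<psi> \<psi>b G n \<beta> B0))
            \<le> ereal (Phi \<mu> \<psi> \<psi>b h \<beta> B1 - Phi \<mu> \<psi> \<psi>b h \<beta> B0))
   \<and> (\<forall>\<beta> B0 B1 (h :: 'x message).
        B0 < B1 \<and> is_message h \<and> fixed_on \<mu> \<psi> \<psi>b h ({\<beta>} \<times> {B0..B1}) \<and> H3B \<mu> h \<beta> B0 B1 \<and>
        (\<forall>B\<in>{B0..B1}. liminf (\<lambda>n. ereal (avxn \<psi> \<psi>b G n \<beta> B)) \<ge> ereal (avx \<mu> \<psi> \<psi>b h \<beta> B))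
      \<longrightarrow> liminf (\<lambda>n. ereal (phin \<psi> \<psi>b G n \<beta> B1 - phin \<psi> \<psi>b G n \<beta> B0))
            \<ge> ereal (Phi \<mu> \<psi> \<psi>b h \<beta> B1 - Phi \<mu> \<psi> \<psi>b h \<beta> B0))"
  by (intro conjI allI impI; elim conjE)
     (rule beta_increment_bounds[OF assms] B_increment_bounds[OF assms]; assumption)+

end
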